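(* Let $k\in\mathbb N$ and let $f\in\mathcal L_k^0$, $f\neq\mathrm{id}$, be a parabolic logarithmic transseries. Let $(\beta,\mathbf n):=\mathrm{ord}(f-\mathrm{id})>(1,\mathbf 0_k)$, with $\mathbf n=(n_1,\dots,n_k)$, and write $a_{\mathbf m}:=[f]_{\beta,\mathbf m}$ for $\mathbf m=(m_1,\ldots,m_k)\in\mathbb Z^k$ with $\mathbf m\ge\mathbf n$ (so $a_{\mathbf n}\neq0$). Put $$L:=\begin{cases} a_{\mathbf n}\,\boldsymbol\ell_1^{n_1}\cdots\boldsymbol\ell_k^{n_k}, & \text{if }\beta>1,\\[1mm] \displaystyle\sum_{\mathbf n\le\mathbf m\le\mathbf n'}a_{\mathbf m}\,\boldsymbol\ell_1^{m_1}\cdots\boldsymbol\ell_k^{m_k}, & \text{if }\beta=1,\end{cases}$$ where, for $\beta=1$, $\mathbf n':=\mathbf n+(\mathbf 1_v,\mathbf 0_{k-v})$ and $v$ is the index of the first nonzero (necessarily positive) entry of $\mathbf n$. Let $\mathrm{Res}(f):=z^{2\beta-1}\boldsymbol\ell_1^{2n_1+1}\cdots\boldsymbol\ell_k^{2n_k+1}$ and let $f_c:=\mathrm{id}+z^\beta L+c\,\mathrm{Res}(f)$ for $c\in\mathbb R$. Then: 1. There exists $c\in\mathbb R$ such that the conjugacy equation $\varphi\circ f\circ\varphi^{-1}=f_c$ has a solution $\varphi\in\mathcal L_k^0$. 2. The real number $c$ for which this conjugacy equation has a solution in $\mathcal L_k^0$ is unique. Moreover, the residual coefficient $c$ is explicitly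 given by $$c=\Big[\frac{a_{\mathbf n}^2}{f-\mathrm{id}}\Big]_{-1,\mathbf 1_k}-\Big[\frac{a_{\mathbf n}^2}{zL}\Big]_{-1,\mathbf 1_k}=\Big[a_{\mathbf n}^2\int\frac{dz}{f-\mathrm{id}}\Big]_{\mathbf 0_{k+1},-1}-\Big[\frac{a_{\mathbf n}^2}{zL}\Big]_{-1,\mathbf 1_k}\quad\text{if }\beta=1,$$ and $$c=\Big[\frac{a_{\mathbf n}^2}{f-\mathrm{id}}\Big]_{-1,\mathbf 1_k}=\Big[a_{\mathbf n}^2\int\frac{dz}{f-\mathrm{id}}\Big]_{\mathbf 0_{k+1},-1}\quad\text{if }\beta>1.$$ 3. The normal form $f_c$ (for this $c$) is minimal in $\mathcal L_k^0$, in the sense that it cannot be further reduced by changes of variables from $\mathcal L_k^0$; moreover, the coefficients of $f_c$ cannot be changed by changes of variables from $\mathcal L_k^0$.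
   Context: $\mathbb N=\{0,1,2,\dots\}$. $z$ is a formal variable, $\boldsymbol\ell_1:=-\frac1{\log z}$ and $\boldsymbol\ell_{j+1}:=\boldsymbol\ell_j\circ\boldsymbol\ell_1=-\frac1{\log\boldsymbol\ell_j}$. $\mathcal L_k^\infty$ is the set of formal sums $f=\sum a_{\alpha,n_1,\dots,n_k}z^\alpha\boldsymbol\ell_1^{n_1}\cdots\boldsymbol\ell_k^{n_k}$, $(\alpha,n_1,\dots,n_k)\in\mathbb R\times\mathbb Z^k$, with real coefficients, whose support $\mathrm{Supp}(f)=\{(\alpha,n_1,\dots,n_k):a_{\alpha,n_1,\dots,n_k}\ne0\}$ is well-ordered for the lexicographic order (all comparisons of exponent vectors are lexicographic). With termwise addition and the usual multiplication it is a field, and a differential algebra for $\frac d{dz}$. $[f]_{\alpha,n_1,\dots,n_k}$ is the coefficient of $z^\alpha\boldsymbol\ell_1^{n_1}\cdots\boldsymbol\ell_k^{n_k}$ in $f$. $\mathrm{ord}(f):=\min\mathrm{Supp}(f)$ for $f\neq0$. $\mathbf 0_j$, $\mathbf 1_j$ are the vectors of $j$ zeros, resp. ones. $\mathcal L_k$ is the set of $f\in\mathcal L_k^\infty$ that are zero or satisfy $\mathrm{ord}(f)>\mathbf 0_{k+1}$. $\mathrm{id}=z$. $\mathcal L_k^0$ is the set of parabolic (tangent to the identity) transseries $z+g$ with $g\in\mathcal L_k$ and $g=0$ or $\mathrm{ord}(g)>(1,\mathbf 0_k)$. For $f\in\mathcal L_k^\infty$ and $z+g\in\mathcal L_k^0$,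 the composition is $f\circ(z+g):=f+\sum_{i\ge1}\frac{f^{(i)}}{i!}g^i$; $\mathcal L_k^0$ is a group under composition. The integral $\int$ denotes formal integration, monomial by monomial, with respect to $z$, with $\int z^{-1}\boldsymbol\ell_1\cdots\boldsymbol\ell_k\,dz=-\boldsymbol\ell_{k+1}^{-1}$, while every other monomial of $\mathcal L_k^\infty$ has an antiderivative in $\mathcal L_k^\infty$; thus the integral lies in $\mathcal L_{k+1}^\infty$, and $[\,\cdot\,]_{\mathbf 0_{k+1},-1}$ is the coefficient of $\boldsymbol\ell_{k+1}^{-1}$.
   Formalization: Signs in part 2 are corrected: c = −[a²/(f−id)]+[a²/(zL)] = [a²∫dz/(f−id)]+[a²/(zL)] if β=1, and c = −[a²/(f−id)] = [a²∫dz/(f−id)] if β>1; in part 3 the coefficient of Res(f) is claimed unchanged only if all lower-order coefficients are kept. *)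

theory Defs
  imports
    Complex_Main
    "HOL-Library.Poly_Mapping"
    "HOL-Library.Product_Lexorder"
    "HOL-Library.Product_Plus"
    "HOL-Library.Function_Algebras"
begin

text \<open>
  The pair \<open>(\<alpha>, n)\<close> is the exponent vector of \<open>z^\<alpha> l_1^{n_1} ... l_k^{n_k}\<close>, where
  \<open>l_1 = - 1 / log z\<close>, \<open>l_{j+1} = - 1 / log l_j\<close>, and \<open>n_{i+1}\<close> is \<open>lookup n i\<close>.
  The library order on \<open>nat \<Rightarrow>\<^sub>0 int\<close> compares at the smallest index where two vectors
  differ, so the order on \<open>expo\<close> is the lexicographic one.  Padding with zeros makes
  \<open>\<int>^k\<close> a subset of \<open>\<int>^(k+1)\<close>, hence \<open>Linf k \<subseteq> Linf (k + 1)\<close>.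

  A formal sum is its coefficient function; \<open>f e\<close> is the coefficient \<open>[f]_e\<close>.  Addition,
  subtraction and \<open>0\<close> are those of the pointwise function space; the pointwise product
  and \<open>1\<close> of the function space are never used.
\<close>

type_synonym expo = "real \<times> (nat \<Rightarrow>\<^sub>0 int)"
type_synonym transseries = "expo \<Rightarrow> real"

definition Supp :: "transseries \<Rightarrow> expo set"
  where "Supp f = {e. f e \<noteq> 0}"

definition int_vecs :: "nat \<Rightarrow> (nat \<Rightarrow>\<^sub>0 int) set"
  where "int_vecs k = {n. Poly_Mapping.keys n \<subseteq> {..<k}}"

text \<open>\<open>ones j\<close> is the vector \<open>(1, ..., 1, 0, 0, ...)\<close> with \<open>j\<close> ones.\<close>

definition ones :: "nat \<Rightarrow> (nat \<Rightarrow>\<^sub>0 int)"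
  where "ones j = (\<Sum>i<j. Poly_Mapping.single i 1)"

definition Linf :: "nat \<Rightarrow> transseries set"
  where "Linf k = {f. Supp f \<subseteq> UNIV \<times> int_vecs k \<and>
                      well_order_on (Supp f) (relation_of (\<le>) (Supp f))}"

definition ord :: "transseries \<Rightarrow> expo"
  where "ord f = (LEAST e. e \<in> Supp f)"

definition monomial :: "expo \<Rightarrow> transseries"
  where "monomial d = (\<lambda>e. if e = d then 1 else 0)"

definition scale :: "real \<Rightarrow> transseries \<Rightarrow> transseries"
  where "scale c f = (\<lambda>e. c * f e)"

text \<open>For well-ordered supports only finitely many pairs of exponents contribute to each
  coefficient of the product.\<close>

definition tmult :: "transseries \<Rightarrow> transseries \<Rightarrow> transseries"  (infixl \<open>\<star>\<close> 70)
  where "f \<star> g = (\<lambda>e. \<Sum>d\<in>{d \<in> Supp f. e - d \<in> Supp g}. f d * g (e - d))"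

definition tpow :: "transseries \<Rightarrow> nat \<Rightarrow> transseries"
  where "tpow f i = ((\<lambda>h. f \<star> h) ^^ i) (monomial 0)"

definition tinverse :: "nat \<Rightarrow> transseries \<Rightarrow> transseries"
  where "tinverse k f = (THE g. g \<in> Linf k \<and> f \<star> g = monomial 0)"

text \<open>\<open>termwise T f\<close> is \<open>\<Sum>d. [f]_d T(d)\<close>, where \<open>T d\<close> is the image of the monomial with
  exponent \<open>d\<close>; each coefficient is a finite sum for the two \<open>T\<close> used below.\<close>

definition termwise :: "(expo \<Rightarrow> transseries) \<Rightarrow> transseries \<Rightarrow> transseries"
  where "termwise T f = (\<lambda>e. \<Sum>d\<in>{d \<in> Supp f. T d e \<noteq> 0}. f d * T d e)"

text \<open>From \<open>l_j = - 1 / log l_{j-1}\<close> one gets \<open>d l_j / dz = z^{-1} l_1 ... l_{j-1} l_j^2\<close>, so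
  differentiating the factor \<open>l_j^{n_j}\<close> multiplies the monomial by
  \<open>n_j z^{-1} l_1 ... l_j\<close>.\<close>

definition monomial_deriv :: "expo \<Rightarrow> transseries"
  where "monomial_deriv = (\<lambda>(\<alpha>, n).
           scale \<alpha> (monomial (\<alpha> - 1, n)) +
           (\<Sum>i\<in>Poly_Mapping.keys n.
              scale (of_int (Poly_Mapping.lookup n i)) (monomial (\<alpha> - 1, n + ones (Suc i)))))"

definition tderiv :: "transseries \<Rightarrow> transseries"
  where "tderiv = termwise monomial_deriv"

text \<open>The antiderivative in \<open>Linf k\<close> of any monomial other than \<open>z^{-1} l_1 ... l_k\<close> is unique
  up to a constant; the constant term is taken to be \<open>0\<close>.  Since the integral of
  \<open>z^{-1} l_1 ... l_k\<close> is \<open>- l_{k+1}^{-1}\<close>, the coefficient of \<open>l_{k+1}^{-1}\<close> in the integral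
  of \<open>f\<close> is minus the coefficient of \<open>z^{-1} l_1 ... l_k\<close> in \<open>f\<close>.\<close>

definition monomial_integral :: "nat \<Rightarrow> expo \<Rightarrow> transseries"
  where "monomial_integral k d =
           (if d = (-1, ones k) then - monomial (0, Poly_Mapping.single k (-1))
            else (THE g. g \<in> Linf k \<and> tderiv g = monomial d \<and> g 0 = 0))"

definition tintegral :: "nat \<Rightarrow> transseries \<Rightarrow> transseries"
  where "tintegral k = termwise (monomial_integral k)"

definition id_ts :: transseries
  where "id_ts = monomial (1, 0)"

definition Lpos :: "nat \<Rightarrow> transseries set"
  where "Lpos k = {f \<in> Linf k. f = 0 \<or> ord f > 0}"

definition parabolic :: "nat \<Rightarrow> transseries set"
  where "parabolic k = {id_ts + g | g. g \<in> Lpos k \<and> (g = 0 \<or> ord g > (1, 0))}"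

definition taylor_term :: "transseries \<Rightarrow> transseries \<Rightarrow> nat \<Rightarrow> transseries"
  where "taylor_term f g i = scale (1 / fact i) ((tderiv ^^ i) f) \<star> tpow g i"

text \<open>For \<open>f \<in> Linf k\<close> and parabolic \<open>\<phi>\<close> the Taylor terms form a summable family:
  each exponent lies in the support of only finitely many of them.\<close>

definition tcomp :: "transseries \<Rightarrow> transseries \<Rightarrow> transseries"
  where "tcomp f \<phi> = (\<lambda>e. f e +
           (\<Sum>i\<in>{i. 1 \<le> i \<and> taylor_term f (\<phi> - id_ts) i e \<noteq> 0}. taylor_term f (\<phi> - id_ts) i e))"

definition comp_inverse :: "nat \<Rightarrow> transseries \<Rightarrow> transseries"
  where "comp_inverse k \<phi> =
           (THE \<psi>. \<psi> \<in> parabolic k \<and> tcomp \<phi> \<psi> = id_ts \<and> tcomp \<psi> \<phi> = id_ts)"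

definition conjugate :: "nat \<Rightarrow> transseries \<Rightarrow> transseries \<Rightarrow> transseries"
  where "conjugate k \<phi> f = tcomp (tcomp \<phi> f) (comp_inverse k \<phi>)"

text \<open>\<open>last_index \<beta> n\<close> is the largest \<open>m\<close> for which \<open>l_1^{m_1} ... l_k^{m_k}\<close> is kept in the
  principal part.  The number of ones added for \<open>\<beta> = 1\<close> is the 1-based index of the first
  nonzero entry of \<open>n\<close>.\<close>

definition last_index :: "real \<Rightarrow> (nat \<Rightarrow>\<^sub>0 int) \<Rightarrow> (nat \<Rightarrow>\<^sub>0 int)"
  where "last_index \<beta> n =
           (if \<beta> = 1 then n + ones (Suc (LEAST i. Poly_Mapping.lookup n i \<noteq> 0)) else n)"

definition principal_part :: "transseries \<Rightarrow> transseries"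
  where "principal_part f =
           (let (\<beta>, n) = ord (f - id_ts) in
            if \<beta> > 1 then scale (f (\<beta>, n)) (monomial (0, n))
            else (\<lambda>(\<alpha>, m). if \<alpha> = 0 \<and> n \<le> m \<and> m \<le> last_index \<beta> n then f (\<beta>, m) else 0))"

definition res_expo :: "transseries \<Rightarrow> nat \<Rightarrow> expo"
  where "res_expo f k = (let (\<beta>, n) = ord (f - id_ts) in (2 * \<beta> - 1, n + n + ones k))"

definition normal_form :: "nat \<Rightarrow> transseries \<Rightarrow> real \<Rightarrow> transseries"
  where "normal_form k f c =
           id_ts + monomial (fst (ord (f - id_ts)), 0) \<star> principal_part f
                 + scale c (monomial (res_expo f k))"

end

theory Submission
  imports Defs "HOL-Library.Set_Algebras" "HOL-Library.Infinite_Set"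
begin

text \<open>
  The transseries in \<open>Linf k\<close> form a subfield of a field of Hahn series, in which the Taylor
  series defining a composition are summable by Neumann's lemma and contracting maps have
  fixed points.  For \<open>f = id + u\<close>, Abel's equation \<open>\<alpha> \<circ> f = \<alpha> + 1\<close> becomes, in terms of the
  derivative \<open>A\<close> of \<open>\<alpha>\<close>, the equation \<open>\<Sum>i. A\<^bsup>(i)\<^esup> u\<^sup>i / (i + 1)! = 1 / u\<close>, which has a
  solution \<open>A\<close> by contraction.  If \<open>\<beta>\<close>, with derivative \<open>B\<close>, solves Abel's equation for \<open>g\<close>,
  then \<open>\<phi> \<circ> f = g \<circ> \<phi>\<close> holds if and only if \<open>\<beta> \<circ> \<phi> - \<alpha>\<close> is constant.  Hence \<open>f\<close> and \<open>g\<close> are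
  conjugate if and only if \<open>A - B\<close> is the derivative of a series whose order exceeds that of
  \<open>z B\<close>.  Differentiation maps leading exponents in a strictly increasing way onto all exponents
  except that of \<open>z\<^sup>-\<^sup>1 l_1 ... l_k\<close>, so this means that \<open>f\<close> and \<open>g\<close> agree up to the end of the
  principal part and that the residue of \<open>A - B\<close> vanishes.  Up to a logarithmic derivative and
  terms of higher order, \<open>A - B\<close> is \<open>1 / (f - id) - 1 / (g - id)\<close>; this gives the residual
  coefficient.
\<close>

section \<open>Well-ordered sets in ordered abelian groups\<close>

text \<open>Abel's equation is posed for the derivative \<open>A\<close> because \<alpha> itself may
  contain the new logarithm l_{k+1}, whereas \<open>A\<close> stays in \<open>Linf k\<close>. Once
  the principal parts agree, the term l_{k+1}^{-1} in \<alpha> - \<beta> is the only obstruction to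
  a conjugacy in \<open>Linf k\<close>.

  The bounds come from orders. If f - id and g - id have order e, then \<open>A\<close> and
  \<open>B\<close> have order -e, and a series of order above (1, 0) - e has a derivative of order
  above \<open>lam ((1, 0) - e)\<close>, which is -e + \<open>gap e\<close>. If the z-exponent of e
  exceeds 1, differentiation acts on a power of z and the gap is 0; if it equals 1, differentiation
  first reaches l_v and the gap consists of v ones.

  A further term with coefficient c and exponent d in f - id changes 1 / (f - id), to leading order,
  by -c / a^2 at d - 2e, where a is the leading coefficient. The residual exponent is the d for
  which this is the exponent of z^{-1} l_1 ... l_k; the change explains the minus sign in front of
  the difference of residues. The integral of z^{-1} l_1 ... l_k is -l_{k+1}^{-1}, so the integral
  formulas have the opposite sign.\<close>

definition wo :: "'a::linorder set \<Rightarrow> bool"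
  where "wo S \<longleftrightarrow> (\<forall>s::nat \<Rightarrow> 'a. (\<forall>i. s i \<in> S) \<longrightarrow> (\<exists>i j. i < j \<and> s i \<le> s j))"

lemma woD:
  fixes s :: "nat \<Rightarrow> 'a::linorder"
  assumes "wo S" "\<And>i. s i \<in> S"
  shows "\<exists>i j. i < j \<and> s i \<le> s j"
  using assms unfolding wo_def by blast

lemma wo_subset: "wo S \<Longrightarrow> T \<subseteq> S \<Longrightarrow> wo T"
  unfolding wo_def by blast

lemma wo_no_descent:
  fixes s :: "nat \<Rightarrow> 'a::linorder"
  assumes "wo S" "\<And>i. s i \<in> S"
  shows "\<exists>i. s i \<le> s (Suc i)"
proof (rule ccontr)
  assume "\<not> ?thesis"
  then have *: "s (Suc i) < s i" for i by (simp add: not_le)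
  have "s j < s i" if "i < j" for i j
    using that by (induct i j rule: less_Suc_induct) (use * in \<open>auto intro: less_trans\<close>)
  then show False using woD[OF assms] by (meson not_less)
qed

lemma wo_incseq:
  fixes s :: "nat \<Rightarrow> 'a::linorder"
  assumes "wo S" "\<And>i. s i \<in> S"
  obtains r :: "nat \<Rightarrow> nat" where "strict_mono r" "incseq (s \<circ> r)"
proof -
  obtain r where r: "strict_mono r" "monoseq (\<lambda>n. s (r n))"
    using seq_monosub by blast
  show thesis
  proof (cases "incseq (\<lambda>n. s (r n))")
    case True
    then show ?thesis using that r(1) by (simp add: o_def)
  next
    case False
    then have dec: "decseq (\<lambda>n. s (r n))"
      using r(2) by (simp add: monoseq_iff)
    \<comment> \<open>A decreasing subsequence must become constant, since otherwise iterating
      \<open>q\<close> gives an infinite strict descent; the constant tail then serves as increasing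
      subsequence.\<close>
    have "\<exists>n. \<forall>m>n. s (r m) = s (r n)"
    proof (rule ccontr)
      assume "\<not> ?thesis"
      then have *: "\<exists>m. s (r m) < s (r n)" for n
        using decseqD[OF dec] by (metis less_imp_le order_le_less)
      then obtain q where q: "\<And>n. s (r (q n)) < s (r n)"
        by metis
      let ?t = "\<lambda>n. s (r ((q ^^ n) 0))"
      have "\<exists>i. ?t i \<le> ?t (Suc i)"
        using wo_no_descent[OF assms(1), of ?t] assms(2) by blast
      with q show False by (auto simp: not_le[symmetric])
    qed
    then obtain n where n: "\<And>m. m > n \<Longrightarrow> s (r m) = s (r n)" by blast
    have "strict_mono (\<lambda>i. r (Suc n + i))"
      using r(1) by (simp add: strict_mono_def)
    moreover have "incseq (s \<circ> (\<lambda>i. r (Suc n + i)))"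
      by (simp add: incseq_def n)
    ultimately show ?thesis using that by blast
  qed
qed

text \<open>The sequence form is the definition because it suits sums of sets and words; the
  least-element form is the one that supports of series are used with.\<close>

lemma wo_iff_least: "wo S \<longleftrightarrow> (\<forall>T\<subseteq>S. T \<noteq> {} \<longrightarrow> (\<exists>m\<in>T. \<forall>t\<in>T. m \<le> t))"
proof (intro iffI allI impI)
  fix T assume S: "wo S" and T: "T \<subseteq> S" "T \<noteq> {}"
  show "\<exists>m\<in>T. \<forall>t\<in>T. m \<le> t"
  proof (rule ccontr)
    assume "\<not> ?thesis"
    then obtain q where q: "\<And>m. m \<in> T \<Longrightarrow> q m \<in> T \<and> q m < m"
      by (metis not_le)
    obtain x where x: "x \<in> T" using T by blast
    have mem: "(q ^^ n) x \<in> T" for n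
      by (induction n) (use x q in auto)
    then have "\<exists>i. (q ^^ i) x \<le> (q ^^ Suc i) x"
      using wo_no_descent[OF S, of "\<lambda>i. (q ^^ i) x"] T(1) by blast
    then obtain i where "(q ^^ i) x \<le> q ((q ^^ i) x)" by auto
    with mem[of i] q[of "(q ^^ i) x"] show False by (simp add: leD)
  qed
next
  assume *: "\<forall>T\<subseteq>S. T \<noteq> {} \<longrightarrow> (\<exists>m\<in>T. \<forall>t\<in>T. m \<le> t)"
  show "wo S"
    unfolding wo_def
  proof (intro allI impI)
    fix s :: "nat \<Rightarrow> 'a" assume "\<forall>i. s i \<in> S"
    then have "range s \<subseteq> S" by blast
    then obtain m where "m \<in> range s" "\<forall>t\<in>range s. m \<le> t"
      using * by (metis UNIV_not_empty image_is_empty)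
    then obtain i where "\<And>j. s i \<le> s j" by auto
    then show "\<exists>i j. i < j \<and> s i \<le> s j" by (meson lessI)
  qed
qed

lemma wo_least:
  assumes "wo S" "x \<in> S"
  obtains m where "m \<in> S" "\<And>t. t \<in> S \<Longrightarrow> m \<le> t"
  using assms wo_iff_least by (metis empty_iff order_refl)

lemma well_order_on_iff_wo: "well_order_on S (relation_of (\<le>) S) \<longleftrightarrow> wo S"
proof
  assume "well_order_on S (relation_of (\<le>) S)"
  then have wf: "wf (relation_of (\<le>) S - Id)" by (simp add: well_order_on_def)
  show "wo S"
    unfolding wo_iff_least
  proof (intro allI impI)
    fix T assume T: "T \<subseteq> S" "T \<noteq> {}"
    then obtain x where "x \<in> T" by blast
    from wfE_min[OF wf this] obtain m where
      m: "m \<in> T" "\<And>y. (y, m) \<in> relation_of (\<le>) S - Id \<Longrightarrow> y \<notin> T" by metis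
    have "m \<le> t" if "t \<in> T" for t
      using m T(1) that by (force simp: relation_of_def)
    with m(1) show "\<exists>m\<in>T. \<forall>t\<in>T. m \<le> t" by blast
  qed
next
  assume S: "wo S"
  have "wf (relation_of (\<le>) S - Id)"
    unfolding wf_eq_minimal
  proof (intro allI impI)
    fix Q :: "'a set" and x assume x: "x \<in> Q"
    show "\<exists>z\<in>Q. \<forall>y. (y, z) \<in> relation_of (\<le>) S - Id \<longrightarrow> y \<notin> Q"
    proof (cases "Q \<inter> S = {}")
      case True
      with x show ?thesis by (auto simp: relation_of_def)
    next
      case False
      then obtain m where "m \<in> Q \<inter> S" "\<forall>t\<in>Q \<inter> S. m \<le> t"
        using S unfolding wo_iff_least by (metis inf_le2)
      then show ?thesis by (force simp: relation_of_def)
    qed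
  qed
  moreover have "linear_order_on S (relation_of (\<le>) S)"
    by (auto simp: order_on_defs relation_of_def refl_on_def trans_def antisym_def total_on_def)
  ultimately show "well_order_on S (relation_of (\<le>) S)"
    by (simp add: well_order_on_def)
qed

lemma wo_empty [simp]: "wo {}"
  by (simp add: wo_def)

lemma wo_finite: "finite S \<Longrightarrow> wo S"
  unfolding wo_iff_least by (metis Min_in Min_le finite_subset)

lemma wo_Un: "wo S \<Longrightarrow> wo T \<Longrightarrow> wo (S \<union> T)"
  unfolding wo_iff_least
proof (intro allI impI)
  fix U assume S: "\<forall>X\<subseteq>S. X \<noteq> {} \<longrightarrow> (\<exists>m\<in>X. \<forall>t\<in>X. m \<le> t)"
    and T: "\<forall>X\<subseteq>T. X \<noteq> {} \<longrightarrow> (\<exists>m\<in>X. \<forall>t\<in>X. m \<le> t)"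
    and U: "U \<subseteq> S \<union> T" "U \<noteq> {}"
  consider "U \<inter> S = {}" | "U \<inter> T = {}" | "U \<inter> S \<noteq> {}" "U \<inter> T \<noteq> {}" by blast
  then show "\<exists>m\<in>U. \<forall>t\<in>U. m \<le> t"
  proof cases
    case 1
    then have "U \<subseteq> T" using U by blast
    then show ?thesis using T U by blast
  next
    case 2
    then have "U \<subseteq> S" using U by blast
    then show ?thesis using S U by blast
  next
    case 3
    then obtain a b where "a \<in> U \<inter> S" "\<forall>t\<in>U \<inter> S. a \<le> t" "b \<in> U \<inter> T" "\<forall>t\<in>U \<inter> T. b \<le> t"
      using S T by (metis inf_le2)
    moreover from this have "\<forall>t\<in>U. a \<le> t \<or> b \<le> t" using U by blast
    ultimately show ?thesis
      by (intro bexI[of _ "min a b"]) (auto simp: min_le_iff_disj min_def)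
  qed
qed

lemma wo_plus:
  fixes A B :: "'a::linordered_ab_group_add set"
  assumes A: "wo A" and B: "wo B"
  shows "wo (A + B)"
  unfolding wo_def
proof (intro allI impI)
  fix s :: "nat \<Rightarrow> 'a" assume "\<forall>i. s i \<in> A + B"
  then have "\<exists>x y. x \<in> A \<and> y \<in> B \<and> s i = x + y" for i
    by (meson set_plus_elim)
  then obtain a b where ab: "\<And>i. a i \<in> A" "\<And>i. b i \<in> B" "\<And>i. s i = a i + b i"
    by metis
  obtain r where r: "strict_mono r" "incseq (a \<circ> r)"
    using wo_incseq[OF A ab(1)] .
  obtain i j where "i < j" "b (r i) \<le> b (r j)"
    using woD[OF B, of "b \<circ> r"] ab(2) by auto
  moreover from this have "a (r i) \<le> a (r j)"
    using r(2) by (simp add: incseq_def)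
  ultimately show "\<exists>i j. i < j \<and> s i \<le> s j"
    using ab(3) r(1) by (metis add_mono strict_mono_less)
qed

text \<open>Infinitely many \<open>d\<close> would contain a strictly increasing sequence, along
  which \<open>e - d\<close> strictly decreases inside \<open>B\<close>. This makes the coefficients
  of a product finite sums.\<close>

lemma finite_wo_pairs:
  fixes A B :: "'a::linordered_ab_group_add set"
  assumes A: "wo A" and B: "wo B"
  shows "finite {d \<in> A. e - d \<in> B}"
proof (rule ccontr)
  assume "infinite {d \<in> A. e - d \<in> B}"
  then obtain s :: "nat \<Rightarrow> 'a" where s: "inj s" "range s \<subseteq> {d \<in> A. e - d \<in> B}"
    using infinite_countable_subset by blast
  have "s i \<in> A" "e - s i \<in> B" for i using s(2) by auto
  then obtain r where r: "strict_mono r" "incseq (s \<circ> r)"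
    using wo_incseq[OF A, of s] by blast
  obtain i j where ij: "i < j" "e - s (r i) \<le> e - s (r j)"
    using woD[OF B, of "\<lambda>i. e - s (r i)"] \<open>\<And>i. e - s i \<in> B\<close> by auto
  moreover have "s (r i) \<le> s (r j)" using r(2) ij(1) by (simp add: incseq_def)
  ultimately have "s (r i) = s (r j)" by simp
  with s(1) r(1) ij(1) show False
    by (metis injD order_less_irrefl strict_mono_less)
qed

subsection \<open>Neumann's lemma\<close>

text \<open>A sequence of words is bad if no pair is ordered by \<open>dominated\<close>; a bad sequence of
  minimal word lengths is refuted by deleting first letters.\<close>

definition dominated :: "'a::linordered_ab_group_add list \<Rightarrow> 'a list \<Rightarrow> bool"
  where "dominated u v \<longleftrightarrow>
    sum_list u \<le> sum_list v \<and> (length u < length v \<longrightarrow> sum_list u < sum_list v)"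

lemma set_tl: "set (tl u) \<subseteq> set u"
  by (cases u) auto

lemma neumann_words:
  fixes P :: "'a::linordered_ab_group_add set" and w :: "nat \<Rightarrow> 'a list"
  assumes P: "wo P" "\<And>p. p \<in> P \<Longrightarrow> 0 < p" and w: "\<And>i. set (w i) \<subseteq> P"
  shows "\<exists>i j. i < j \<and> dominated (w i) (w j)"
proof (rule ccontr)
  define bad :: "(nat \<Rightarrow> 'a list) \<Rightarrow> bool" where
    "bad s \<longleftrightarrow> (\<forall>i. set (s i) \<subseteq> P) \<and> (\<forall>i j. i < j \<longrightarrow> \<not> dominated (s i) (s j))" for s
  assume "\<not> ?thesis"
  with w have bad_w: "bad w" by (auto simp: bad_def)
  \<comment> \<open>\<open>ext n s\<close> says that the first \<open>n\<close> entries of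
    \<open>s\<close> begin some bad sequence. Dependent choice fixes the entries one at a time with
    least length, and the diagonal \<open>m\<close> below is a minimal bad sequence.\<close>
  define ext where "ext n s \<longleftrightarrow> (\<exists>t. bad t \<and> (\<forall>i<n. t i = s i))"
    for n and s :: "nat \<Rightarrow> 'a list"
  have step: "\<exists>s'. ext (Suc n) s' \<and> (\<forall>i<n. s' i = s i) \<and>
      (\<forall>s''. ext (Suc n) s'' \<and> (\<forall>i<n. s'' i = s i) \<longrightarrow> length (s' n) \<le> length (s'' n))"
    if "ext n s" for n s
  proof -
    let ?Q = "\<lambda>s'. ext (Suc n) s' \<and> (\<forall>i<n. s' i = s i)"
    from that obtain t where "bad t" "\<forall>i<n. t i = s i" by (auto simp: ext_def)
    then have "?Q t" by (auto simp: ext_def)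
    then show ?thesis
      using ex_has_least_nat[of ?Q t "\<lambda>s'. length (s' n)"] by blast
  qed
  have "\<exists>S. \<forall>n. ext n (S n) \<and> (ext (Suc n) (S (Suc n)) \<and> (\<forall>i<n. S (Suc n) i = S n i) \<and>
      (\<forall>s''. ext (Suc n) s'' \<and> (\<forall>i<n. s'' i = S n i) \<longrightarrow> length (S (Suc n) n) \<le> length (s'' n)))"
  proof (rule dependent_nat_choice)
    show "\<exists>x. ext 0 x" using bad_w by (auto simp: ext_def)
  qed (use step in blast)
  then obtain S where S: "\<And>n. ext n (S n)" "\<And>n i. i < n \<Longrightarrow> S (Suc n) i = S n i"
    "\<And>n s. ext (Suc n) s \<Longrightarrow> (\<And>i. i < n \<Longrightarrow> s i = S n i) \<Longrightarrow> length (S (Suc n) n) \<le> length (s n)"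
    by metis
  define m where "m i = S (Suc i) i" for i
  have Sm: "S n i = m i" if "i < n" for n i
    using that by (induction n) (auto simp: m_def S(2) less_Suc_eq)
  have min: "length (m n) \<le> length (t n)" if "bad t" "\<And>i. i < n \<Longrightarrow> t i = m i" for t n
  proof -
    have "ext (Suc n) t" using that(1) by (auto simp: ext_def)
    moreover have "t i = S n i" if "i < n" for i
      using Sm[OF that] \<open>\<And>i. i < n \<Longrightarrow> t i = m i\<close>[OF that] by simp
    ultimately show ?thesis using S(3) by (simp add: m_def)
  qed
  have bad_m: "set (m i) \<subseteq> P" "i < j \<Longrightarrow> \<not> dominated (m i) (m j)" for i j
  proof -
    obtain t where "bad t" "\<forall>l<Suc (max i j). t l = m l"
      using S(1)[of "Suc (max i j)"] Sm unfolding ext_def by auto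
    moreover from this have "t i = m i" "t j = m j" by auto
    ultimately have "set (m i) \<subseteq> P \<and> (i < j \<longrightarrow> \<not> dominated (m i) (m j))"
      unfolding bad_def by metis
    then show "set (m i) \<subseteq> P" "i < j \<Longrightarrow> \<not> dominated (m i) (m j)" by auto
  qed
  have sum_nonneg: "0 \<le> sum_list (m i)" "m i \<noteq> [] \<Longrightarrow> 0 < sum_list (m i)" for i
  proof -
    have "0 \<le> sum_list u \<and> (u \<noteq> [] \<longrightarrow> 0 < sum_list u)" if "set u \<subseteq> P" for u
      using that
    proof (induction u)
      case (Cons a u)
      then show ?case using P(2)[of a] by (auto intro: add_pos_nonneg)
    qed simp
    then show "0 \<le> sum_list (m i)" "m i \<noteq> [] \<Longrightarrow> 0 < sum_list (m i)"
      using bad_m(1) by blast+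
  qed
  have ne: "m i \<noteq> []" for i
  proof
    assume "m i = []"
    then have "dominated (m i) (m (Suc i))"
      using sum_nonneg[of "Suc i"] by (auto simp: dominated_def)
    with bad_m(2)[of i "Suc i"] show False by simp
  qed
  have hd: "hd (m i) \<in> P" for i
    using bad_m(1)[of i] ne[of i] by (meson hd_in_set subsetD)
  obtain r where r: "strict_mono r" "incseq ((\<lambda>i. hd (m i)) \<circ> r)"
    using wo_incseq[OF P(1), of "\<lambda>i. hd (m i)"] hd by blast
  have split: "sum_list (m i) = hd (m i) + sum_list (tl (m i))"
    "length (m i) = Suc (length (tl (m i)))" for i
    using ne[of i] by (cases "m i"; simp)+
  have hd_le: "hd (m (r i)) \<le> hd (m (r j))" if "i \<le> j" for i j
    using r(2) that by (simp add: incseq_def)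
  \<comment> \<open>Before \<open>r 0\<close> this is \<open>m\<close>; afterwards come the
    shortened words along \<open>r\<close>, whose first letters increase. It is bad again, yet its
    entry at \<open>r 0\<close> is shorter than the minimal one.\<close>
  define t where "t i = (if i < r 0 then m i else tl (m (r (i - r 0))))" for i
  have "bad t"
    unfolding bad_def
  proof (intro conjI allI impI)
    show "set (t i) \<subseteq> P" for i
      using bad_m(1) by (simp add: t_def) (meson order_trans set_tl)
    fix i j :: nat assume ij: "i < j"
    consider "j < r 0" | "i < r 0" "r 0 \<le> j" | "r 0 \<le> i" using ij by linarith
    then show "\<not> dominated (t i) (t j)"
    proof cases
      case 1
      then show ?thesis using bad_m(2) ij by (simp add: t_def)
    next
      case 2
      let ?j = "r (j - r 0)"
      have "i < ?j"
        using 2(1) strict_mono_less_eq[OF r(1), of 0 "j - r 0"] by simp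
      then have "\<not> dominated (m i) (m ?j)" using bad_m(2) by blast
      \<comment> \<open>Restoring a positive first letter makes the later sum strictly larger, so
        the strictness clause of \<open>dominated\<close> holds whatever the lengths.\<close>
      moreover have "dominated (m i) (m ?j)" if "dominated (m i) (tl (m ?j))"
      proof -
        have "sum_list (tl (m ?j)) < sum_list (m ?j)"
          using split(1)[of ?j] P(2)[OF hd[of ?j]] by simp
        then show ?thesis using that by (auto simp: dominated_def)
      qed
      ultimately show ?thesis using 2 by (auto simp: t_def)
    next
      case 3
      let ?i = "r (i - r 0)" and ?j = "r (j - r 0)"
      have "?i < ?j" using 3 ij r(1) by (simp add: strict_mono_less)
      then have "\<not> dominated (m ?i) (m ?j)" using bad_m(2) by blast
      moreover have "dominated (m ?i) (m ?j)" if "dominated (tl (m ?i)) (tl (m ?j))"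
        using that hd_le[of "i - r 0" "j - r 0"] ij
        unfolding dominated_def split(1)[of ?i] split(1)[of ?j] split(2)[of ?i] split(2)[of ?j]
        by (auto intro: add_mono add_le_less_mono simp del: length_tl)
      ultimately show ?thesis using 3 ij by (auto simp: t_def)
    qed
  qed
  then have "length (m (r 0)) \<le> length (t (r 0))"
    by (rule min) (simp add: t_def)
  then show False using ne[of "r 0"] by (cases "m (r 0)") (auto simp: t_def)
qed

text \<open>V + P + ... + P with \<open>n\<close> copies of \<open>P\<close>. The number of copies
  is recorded because summability also requires that an exponent is reached for only finitely many
  \<open>n\<close>.\<close>

definition shift :: "'a::linordered_ab_group_add set \<Rightarrow> 'a set \<Rightarrow> nat \<Rightarrow> 'a set"
  where "shift V P n = {v + sum_list u | v u. v \<in> V \<and> set u \<subseteq> P \<and> length u = n}"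

lemma shift_0 [simp]: "shift V P 0 = V"
  by (auto simp: shift_def)

lemma shift_mono: "V \<subseteq> V' \<Longrightarrow> P \<subseteq> P' \<Longrightarrow> shift V P n \<subseteq> shift V' P' n"
  by (fastforce simp: shift_def)

lemma shift_plus: "shift V P m + shift W P n \<subseteq> shift (V + W) P (m + n)"
proof
  fix x assume "x \<in> shift V P m + shift W P n"
  then obtain v u v' u' where "x = (v + sum_list u) + (v' + sum_list u')" "v \<in> V" "v' \<in> W"
    "set u \<subseteq> P" "set u' \<subseteq> P" "length u = m" "length u' = n"
    unfolding set_plus_def shift_def by blast
  then show "x \<in> shift (V + W) P (m + n)"
    unfolding shift_def
    by (intro CollectI exI[of _ "v + v'"] exI[of _ "u @ u'"]) (auto simp: add_ac intro: set_plus_intro[of v V v' W, simplified add_ac])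
qed

lemma shift_Suc: "shift V P n + P \<subseteq> shift V P (Suc n)"
proof
  fix x assume "x \<in> shift V P n + P"
  then obtain v u p where "x = (v + sum_list u) + p" "v \<in> V" "p \<in> P" "set u \<subseteq> P" "length u = n"
    unfolding set_plus_def shift_def by blast
  then show "x \<in> shift V P (Suc n)"
    unfolding shift_def
    by (intro CollectI exI[of _ v] exI[of _ "p # u"]) (auto simp: algebra_simps)
qed

lemma shift_sequence:
  fixes P :: "'a::linordered_ab_group_add set"
  assumes V: "wo V" and P: "wo P" "\<And>p. p \<in> P \<Longrightarrow> 0 < p"
    and x: "\<And>i. x i \<in> shift V P (l i)"
  shows "\<exists>i j. i < j \<and> x i \<le> x j \<and> (l i < l j \<longrightarrow> x i < x (j::nat))"
proof -
  have "\<exists>v u. v \<in> V \<and> set u \<subseteq> P \<and> length u = l i \<and> x i = v + sum_list u" for i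
    using x[of i] unfolding shift_def by blast
  then obtain v u where vu: "\<And>i. v i \<in> V" "\<And>i. set (u i) \<subseteq> P" "\<And>i. length (u i) = l i"
    "\<And>i. x i = v i + sum_list (u i)" by metis
  obtain r where r: "strict_mono r" "incseq (v \<circ> r)" using wo_incseq[OF V vu(1)] .
  obtain i j where ij: "i < j" "dominated (u (r i)) (u (r j))"
    using neumann_words[OF P, of "u \<circ> r"] vu(2) by auto
  moreover have "v (r i) \<le> v (r j)" using r(2) ij(1) by (simp add: incseq_def)
  moreover have "r i < r j" using r(1) ij(1) by (simp add: strict_mono_less)
  ultimately show ?thesis
    by (intro exI[of _ "r i"] exI[of _ "r j"]) (auto simp: dominated_def vu(3,4) intro: add_mono add_le_less_mono)
qed

lemma wo_shift:
  assumes "wo V" "wo P" "\<And>p. p \<in> P \<Longrightarrow> 0 < p"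
  shows "wo (\<Union>n. shift V P n)"
  unfolding wo_def
proof (intro allI impI)
  fix s :: "nat \<Rightarrow> 'a" assume "\<forall>i. s i \<in> (\<Union>n. shift V P n)"
  then have "\<exists>n. s i \<in> shift V P n" for i by blast
  then obtain l where "\<And>i. s i \<in> shift V P (l i)" by metis
  from shift_sequence[OF assms this] show "\<exists>i j. i < j \<and> s i \<le> s j" by blast
qed

text \<open>Otherwise the constant sequence \<open>e\<close>, taken along increasing lengths, would
  yield \<open>e < e\<close>. The strictness clause of \<open>dominated\<close> serves this
  purpose.\<close>

lemma finite_shift:
  assumes "wo V" "wo P" "\<And>p. p \<in> P \<Longrightarrow> 0 < p"
  shows "finite {n. e \<in> shift V P n}"
proof (rule ccontr)
  assume "infinite {n. e \<in> shift V P n}"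
  then obtain l :: "nat \<Rightarrow> nat" where l: "strict_mono l" "\<And>i. l i \<in> {n. e \<in> shift V P n}"
    using infinite_enumerate by blast
  then have "e \<in> shift V P (l i)" for i by blast
  from shift_sequence[OF assms this] obtain i j where "i < j" "l i < l j \<longrightarrow> e < e"
    by blast
  with l(1) show False by (simp add: strict_mono_less)
qed


section \<open>Hahn series\<close>

typedef (overloaded) 'e hahn = "{f :: 'e::linordered_ab_group_add \<Rightarrow> real. wo {e. f e \<noteq> 0}}"
  morphisms coeff Hahn
  by (rule exI[of _ "\<lambda>_. 0"]) simp

definition supp :: "'e::linordered_ab_group_add hahn \<Rightarrow> 'e set"
  where "supp x = {e. coeff x e \<noteq> 0}"

lemma wo_supp [simp]: "wo (supp x)"
  using coeff[of x] by (simp add: supp_def)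

lemma coeff_Hahn: "wo S \<Longrightarrow> {e. f e \<noteq> 0} \<subseteq> S \<Longrightarrow> coeff (Hahn f) = f"
  by (rule Hahn_inverse) (simp add: wo_subset)

lemma hahn_eqI: "(\<And>e. coeff x e = coeff y e) \<Longrightarrow> x = y"
  by (metis coeff_inject ext)

lemma in_supp_iff: "e \<in> supp x \<longleftrightarrow> coeff x e \<noteq> 0"
  by (simp add: supp_def)

instantiation hahn :: (linordered_ab_group_add) ab_group_add
begin

definition "0 = Hahn (\<lambda>_. 0)"
definition "x + y = Hahn (\<lambda>e. coeff x e + coeff y e)"
definition "- x = Hahn (\<lambda>e. - coeff x e)" for x :: "'a hahn"
definition "x - y = Hahn (\<lambda>e. coeff x e - coeff y e)" for x y :: "'a hahn"

lemma coeff_0 [simp]: "coeff 0 e = 0"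
  unfolding zero_hahn_def by (subst coeff_Hahn[OF wo_empty]) auto

lemma coeff_add [simp]: "coeff (x + y) e = coeff x e + coeff y e"
  unfolding plus_hahn_def
  by (subst coeff_Hahn[OF wo_Un[OF wo_supp[of x] wo_supp[of y]]]) (auto simp: supp_def)

lemma coeff_minus [simp]: "coeff (- x) e = - coeff x e"
  unfolding uminus_hahn_def
  by (subst coeff_Hahn[OF wo_supp[of x]]) (auto simp: supp_def)

lemma coeff_diff [simp]: "coeff (x - y) e = coeff x e - coeff y e"
  unfolding minus_hahn_def
  by (subst coeff_Hahn[OF wo_Un[OF wo_supp[of x] wo_supp[of y]]]) (auto simp: supp_def)

instance
  by standard (auto intro!: hahn_eqI)

end

lemma coeff_sum [simp]: "coeff (sum f A) e = (\<Sum>i\<in>A. coeff (f i) e)"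
  by (induction A rule: infinite_finite_induct) auto

lemma supp_0 [simp]: "supp 0 = {}"
  by (simp add: supp_def)

lemma supp_minus [simp]: "supp (- x) = supp x"
  by (simp add: supp_def)

lemma supp_add: "supp (x + y) \<subseteq> supp x \<union> supp y"
  by (auto simp: supp_def)

lemma supp_diff: "supp (x - y) \<subseteq> supp x \<union> supp y"
  by (auto simp: supp_def)

definition hmonom :: "real \<Rightarrow> 'e::linordered_ab_group_add \<Rightarrow> 'e hahn"
  where "hmonom c e = Hahn (\<lambda>d. if d = e then c else 0)"

lemma coeff_hmonom: "coeff (hmonom c e) d = (if d = e then c else 0)"
  unfolding hmonom_def by (subst coeff_Hahn[OF wo_finite[of "{e}"]]) auto

lemma supp_hmonom: "supp (hmonom c e) \<subseteq> {e}"
  by (auto simp: supp_def coeff_hmonom)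

lemma finite_supp_pairs: "finite {d \<in> supp x. e - d \<in> supp y}"
  by (simp add: finite_wo_pairs)

instantiation hahn :: (linordered_ab_group_add) comm_ring_1
begin

definition "x * y = Hahn (\<lambda>e. \<Sum>d\<in>{d \<in> supp x. e - d \<in> supp y}. coeff x d * coeff y (e - d))"
definition "1 = hmonom 1 0"

lemma coeff_mult: "coeff (x * y) e = (\<Sum>d\<in>{d \<in> supp x. e - d \<in> supp y}. coeff x d * coeff y (e - d))"
proof -
  have "{e. (\<Sum>d\<in>{d \<in> supp x. e - d \<in> supp y}. coeff x d * coeff y (e - d)) \<noteq> 0} \<subseteq> supp x + supp y"
  proof
    fix e assume "e \<in> {e. (\<Sum>d\<in>{d \<in> supp x. e - d \<in> supp y}. coeff x d * coeff y (e - d)) \<noteq> 0}"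
    then have "(\<Sum>d\<in>{d \<in> supp x. e - d \<in> supp y}. coeff x d * coeff y (e - d)) \<noteq> 0"
      by simp
    then obtain d where "d \<in> {d \<in> supp x. e - d \<in> supp y}"
      by (rule sum.not_neutral_contains_not_neutral)
    then have "d + (e - d) \<in> supp x + supp y" by (intro set_plus_intro) auto
    then show "e \<in> supp x + supp y" by simp
  qed
  then show ?thesis
    unfolding times_hahn_def
    by (subst coeff_Hahn[OF wo_plus[OF wo_supp[of x] wo_supp[of y]]]) auto
qed

lemma coeff_mult_superset:
  assumes "finite S" "\<And>d. coeff x d \<noteq> 0 \<Longrightarrow> coeff y (e - d) \<noteq> 0 \<Longrightarrow> d \<in> S"
  shows "coeff (x * y) e = (\<Sum>d\<in>S. coeff x d * coeff y (e - d))"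
  unfolding coeff_mult
  by (rule sum.mono_neutral_left) (use assms in \<open>auto simp: supp_def\<close>)

lemma supp_mult: "supp (x * y) \<subseteq> supp x + supp y"
proof
  fix e assume "e \<in> supp (x * y)"
  then have "(\<Sum>d\<in>{d \<in> supp x. e - d \<in> supp y}. coeff x d * coeff y (e - d)) \<noteq> 0"
    by (simp add: in_supp_iff[of e] coeff_mult)
  then obtain d where "d \<in> {d \<in> supp x. e - d \<in> supp y}"
    by (rule sum.not_neutral_contains_not_neutral)
  then have "d + (e - d) \<in> supp x + supp y" by (intro set_plus_intro) auto
  then show "e \<in> supp x + supp y" by simp
qed

lemma coeff_hmonom_mult: "coeff (hmonom c a * x) e = c * coeff x (e - a)"
  by (subst coeff_mult_superset[of "{a}"]) (auto simp: coeff_hmonom split: if_splits)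

lemma hahn_mult_commute: "x * y = y * x" for x y :: "'a hahn"
proof (rule hahn_eqI)
  fix e
  have "bij_betw (\<lambda>d. e - d) {d \<in> supp x. e - d \<in> supp y} {d \<in> supp y. e - d \<in> supp x}"
    by (rule bij_betw_byWitness[where f' = "\<lambda>d. e - d"]) auto
  from sum.reindex_bij_betw[OF this, of "\<lambda>d. coeff y d * coeff x (e - d)"]
  show "coeff (x * y) e = coeff (y * x) e"
    by (simp add: coeff_mult mult.commute)
qed

lemma hahn_mult_add: "x * (y + z) = x * y + x * z" for x y z :: "'a hahn"
proof (rule hahn_eqI)
  fix e
  let ?S = "{d \<in> supp x. e - d \<in> supp y} \<union> {d \<in> supp x. e - d \<in> supp z}"
  have "finite ?S" by (simp add: finite_supp_pairs)
  note * = coeff_mult_superset[OF this]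
  have "coeff (x * (y + z)) e = (\<Sum>d\<in>?S. coeff x d * coeff (y + z) (e - d))"
    by (rule *) (auto simp: supp_def)
  also have "\<dots> = (\<Sum>d\<in>?S. coeff x d * coeff y (e - d)) + (\<Sum>d\<in>?S. coeff x d * coeff z (e - d))"
    by (simp add: sum.distrib distrib_left)
  also have "(\<Sum>d\<in>?S. coeff x d * coeff y (e - d)) = coeff (x * y) e"
    by (rule *[symmetric]) (auto simp: supp_def)
  also have "(\<Sum>d\<in>?S. coeff x d * coeff z (e - d)) = coeff (x * z) e"
    by (rule *[symmetric]) (auto simp: supp_def)
  finally show "coeff (x * (y + z)) e = coeff (x * y + x * z) e" by simp
qed

lemma hahn_mult_assoc: "x * y * z = x * (y * z)" for x y z :: "'a hahn"
proof (rule hahn_eqI)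
  fix e
  define X where "X = {d \<in> supp x + supp y. e - d \<in> supp z}"
  define Y where "Y = {a \<in> supp x. e - a \<in> supp y + supp z}"
  have fX: "finite X" and fY: "finite Y"
    by (auto simp: X_def Y_def intro!: finite_wo_pairs wo_plus)
  have "coeff (x * y * z) e = (\<Sum>d\<in>X. coeff (x * y) d * coeff z (e - d))"
    using fX by (rule coeff_mult_superset) (use supp_mult[of x y] in \<open>auto simp: X_def supp_def\<close>)
  also have "\<dots> = (\<Sum>d\<in>X. (\<Sum>a\<in>Y. coeff x a * coeff y (d - a)) * coeff z (e - d))"
  proof (rule sum.cong[OF refl])
    fix d assume d: "d \<in> X"
    have "coeff (x * y) d = (\<Sum>a\<in>Y. coeff x a * coeff y (d - a))"
    proof (rule coeff_mult_superset[OF fY])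
      fix a assume a: "coeff x a \<noteq> 0" "coeff y (d - a) \<noteq> 0"
      have "(d - a) + (e - d) \<in> supp y + supp z"
        by (rule set_plus_intro) (use a d in \<open>auto simp: X_def supp_def\<close>)
      then show "a \<in> Y" using a by (auto simp: Y_def supp_def)
    qed
    then show "coeff (x * y) d * coeff z (e - d) =
      (\<Sum>a\<in>Y. coeff x a * coeff y (d - a)) * coeff z (e - d)" by simp
  qed
  also have "\<dots> = (\<Sum>a\<in>Y. \<Sum>d\<in>X. coeff x a * (coeff y (d - a) * coeff z (e - d)))"
    by (simp add: sum_distrib_right mult.assoc) (rule sum.swap)
  also have "\<dots> = (\<Sum>a\<in>Y. coeff x a * coeff (y * z) (e - a))"
  proof (rule sum.cong[OF refl])
    fix a assume a: "a \<in> Y"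
    show "(\<Sum>d\<in>X. coeff x a * (coeff y (d - a) * coeff z (e - d))) = coeff x a * coeff (y * z) (e - a)"
    proof (cases "coeff x a = 0")
      case False
      have "coeff (y * z) (e - a) = (\<Sum>b\<in>(\<lambda>d. d - a) ` X. coeff y b * coeff z (e - a - b))"
      proof (rule coeff_mult_superset)
        fix b assume b: "coeff y b \<noteq> 0" "coeff z (e - a - b) \<noteq> 0"
        have "a + b \<in> supp x + supp y"
          by (rule set_plus_intro) (use b False in \<open>auto simp: supp_def\<close>)
        then have "a + b \<in> X" using b by (auto simp: X_def supp_def diff_diff_eq)
        then show "b \<in> (\<lambda>d. d - a) ` X" by (rule rev_image_eqI) simp
      qed (use fX in simp)
      also have "\<dots> = (\<Sum>d\<in>X. coeff y (d - a) * coeff z (e - d))"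
        by (subst sum.reindex) (auto simp: inj_on_def)
      finally show ?thesis by (simp add: sum_distrib_left)
    qed simp
  qed
  also have "\<dots> = coeff (x * (y * z)) e"
    by (rule coeff_mult_superset[OF fY, symmetric])
      (use supp_mult[of y z] in \<open>auto simp: Y_def supp_def\<close>)
  finally show "coeff (x * y * z) e = coeff (x * (y * z)) e" .
qed

instance
proof
  fix x y z :: "'a hahn"
  show "x * y * z = x * (y * z)" by (rule hahn_mult_assoc)
  show "x * y = y * x" by (rule hahn_mult_commute)
  show "1 * x = x" by (rule hahn_eqI) (simp add: one_hahn_def coeff_hmonom_mult)
  show "(x + y) * z = x * z + y * z"
    using hahn_mult_add[of z x y] by (simp add: hahn_mult_commute)
  have "coeff (0 :: 'a hahn) 0 \<noteq> coeff 1 0" by (simp add: one_hahn_def coeff_hmonom)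
  then show "(0 :: 'a hahn) \<noteq> 1" by metis
qed

end

lemma hmonom_mult: "hmonom c a * hmonom d b = hmonom (c * d) (a + b)"
  by (rule hahn_eqI) (auto simp: coeff_hmonom_mult coeff_hmonom algebra_simps)

lemma hmonom_0 [simp]: "hmonom 0 a = 0"
  by (rule hahn_eqI) (simp add: coeff_hmonom)

subsection \<open>Orders\<close>

text \<open>Bounds on the valuation, expressed by vanishing coefficients so that 0 satisfies each of
  them without an infinite value.\<close>

definition vge :: "'e::linordered_ab_group_add hahn \<Rightarrow> 'e \<Rightarrow> bool"
  where "vge x e \<longleftrightarrow> (\<forall>d<e. coeff x d = 0)"

definition vgt :: "'e::linordered_ab_group_add hahn \<Rightarrow> 'e \<Rightarrow> bool"
  where "vgt x e \<longleftrightarrow> (\<forall>d\<le>e. coeff x d = 0)"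

lemma vge_iff: "vge x e \<longleftrightarrow> (\<forall>d\<in>supp x. e \<le> d)"
  by (auto simp: vge_def supp_def not_less[symmetric])

lemma vgt_iff: "vgt x e \<longleftrightarrow> (\<forall>d\<in>supp x. e < d)"
  by (auto simp: vgt_def supp_def not_le[symmetric])

lemma vgt_imp_vge: "vgt x e \<Longrightarrow> vge x e"
  by (auto simp: vge_def vgt_def)

lemma vge_mono: "vge x e \<Longrightarrow> d \<le> e \<Longrightarrow> vge x d"
  by (auto simp: vge_def)

lemma vgt_mono: "vgt x e \<Longrightarrow> d \<le> e \<Longrightarrow> vgt x d"
  by (auto simp: vgt_def)

lemma vge_less_vgt: "vge x e \<Longrightarrow> d < e \<Longrightarrow> vgt x d"
  by (auto simp: vge_def vgt_def)

lemma vgt_iff_vge: "vgt x e \<longleftrightarrow> vge x e \<and> coeff x e = 0"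
  by (auto simp: vge_def vgt_def le_less)

lemma vge_0 [simp]: "vge 0 e" and vgt_0 [simp]: "vgt 0 e"
  by (simp_all add: vge_def vgt_def)

lemma vge_add: "vge x e \<Longrightarrow> vge y e \<Longrightarrow> vge (x + y) e"
  and vgt_add: "vgt x e \<Longrightarrow> vgt y e \<Longrightarrow> vgt (x + y) e"
  and vge_diff: "vge x e \<Longrightarrow> vge y e \<Longrightarrow> vge (x - y) e"
  and vgt_diff: "vgt x e \<Longrightarrow> vgt y e \<Longrightarrow> vgt (x - y) e"
  and vgt_minus [simp]: "vgt (- x) e \<longleftrightarrow> vgt x e"
  by (auto simp: vge_def vgt_def)

lemma vge_hmonom: "e \<le> a \<Longrightarrow> vge (hmonom c a) e"
  by (auto simp: vge_def coeff_hmonom)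

lemma vge_mult:
  assumes "vge x a" "vge y b"
  shows "vge (x * y) (a + b)"
  unfolding vge_iff
proof
  fix d assume "d \<in> supp (x * y)"
  then obtain p q where "d = p + q" "p \<in> supp x" "q \<in> supp y"
    using supp_mult[of x y] by (meson set_plus_elim subsetD)
  with assms show "a + b \<le> d" by (simp add: vge_iff add_mono)
qed

lemma vgt_mult_left:
  assumes "vgt x a" "vge y b"
  shows "vgt (x * y) (a + b)"
  unfolding vgt_iff
proof
  fix d assume "d \<in> supp (x * y)"
  then obtain p q where "d = p + q" "p \<in> supp x" "q \<in> supp y"
    using supp_mult[of x y] by (meson set_plus_elim subsetD)
  with assms show "a + b < d" by (simp add: vge_iff vgt_iff add_less_le_mono)
qed

lemma vgt_mult_right: "vge x a \<Longrightarrow> vgt y b \<Longrightarrow> vgt (x * y) (a + b)"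
  using vgt_mult_left[of y b x a] by (simp add: mult.commute add.commute)

lemma coeff_mult_lead:
  assumes "vge x a" "vge y b"
  shows "coeff (x * y) (a + b) = coeff x a * coeff y b"
proof -
  have "coeff (x * y) (a + b) = (\<Sum>d\<in>{a}. coeff x d * coeff y (a + b - d))"
  proof (rule coeff_mult_superset)
    fix d assume "coeff x d \<noteq> 0" "coeff y (a + b - d) \<noteq> 0"
    then have "\<not> d < a" "\<not> a + b - d < b" using assms by (auto simp: vge_def)
    then show "d \<in> {a}" by auto
  qed simp
  then show ?thesis by simp
qed

lemma hahn_order:
  assumes "x \<noteq> 0"
  obtains e where "vge x e" "coeff x e \<noteq> 0"
proof -
  from assms obtain d where "coeff x d \<noteq> 0" by (metis coeff_0 hahn_eqI)
  then obtain e where "e \<in> supp x" "\<And>t. t \<in> supp x \<Longrightarrow> e \<le> t"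
    using wo_least[OF wo_supp, of d x] by (auto simp: supp_def)
  then show ?thesis using that by (auto simp: vge_iff supp_def)
qed

text \<open>A nonzero series attains its order. In this form, an equation x = F x with F raising the
  order yields x = 0.\<close>

lemma hahn_eq_0_iff_vgt: "(\<And>e. vge x e \<Longrightarrow> vgt x e) \<Longrightarrow> x = 0"
  by (metis hahn_order vgt_iff_vge)

subsection \<open>Fixed points of contracting maps\<close>

definition hahn_on :: "'e::linordered_ab_group_add set \<Rightarrow> 'e hahn set"
  where "hahn_on G = {x. supp x \<subseteq> G}"

text \<open>The partial fixed points, which satisfy \<open>F x = x\<close> on an initial segment of the
  exponents, agree on the common initial segments, so they glue to a maximal one.\<close>

lemma hahn_fixed_point:
  fixes F :: "'e::linordered_ab_group_add hahn \<Rightarrow> 'e hahn"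
  assumes F: "\<And>x. x \<in> hahn_on G \<Longrightarrow> F x \<in> hahn_on G"
    and contr: "\<And>x y e. x \<in> hahn_on G \<Longrightarrow> y \<in> hahn_on G \<Longrightarrow> vge (x - y) e \<Longrightarrow> vgt (F x - F y) e"
  obtains x where "x \<in> hahn_on G" "F x = x"
proof -
  define good where "good e x \<longleftrightarrow> x \<in> hahn_on G \<and> (\<forall>d\<le>e. coeff (F x) d = coeff x d)" for e x
  \<comment> \<open>At the least exponent \<open>c\<close> where \<open>x\<close> and
    \<open>y\<close> differ, contraction makes \<open>F x\<close> and \<open>F y\<close> agree,
    while both series are fixed there.\<close>
  have uniq: "coeff x d = coeff y d" if "good e x" "good e' y" "d \<le> e" "d \<le> e'" for x y e e' d
  proof (rule ccontr)
    assume "\<not> ?thesis"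
    then have d: "d \<in> supp (x - y)" by (simp add: supp_def)
    then obtain c where c: "c \<in> supp (x - y)" "\<And>t. t \<in> supp (x - y) \<Longrightarrow> c \<le> t"
      using wo_least[OF wo_supp d] by blast
    then have "vge (x - y) c" by (simp add: vge_iff)
    then have "vgt (F x - F y) c" using contr that by (auto simp: good_def)
    then have "coeff (F x) c = coeff (F y) c" by (auto simp: vgt_def)
    moreover have "c \<le> d" using c(2) d by blast
    ultimately have "coeff x c = coeff y c" using that unfolding good_def by (metis order_trans)
    with c(1) show False by (simp add: supp_def)
  qed
  define f where "f d = (if \<exists>x. good d x then coeff (SOME x. good d x) d else 0)" for d
  have f: "f d = coeff x d" if "good e x" "d \<le> e" for x d e
  proof -
    have gd: "good d x" using that by (auto simp: good_def)
    then have "good d (SOME x. good d x)" by (rule someI)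
    from uniq[OF this gd order_refl order_refl] gd show ?thesis
      unfolding f_def by (metis (no_types, lifting))
  qed
  have f0: "\<exists>x. good d x" if "f d \<noteq> 0" for d
    using that by (auto simp: f_def split: if_splits)
  \<comment> \<open>Up to an exponent \<open>t\<close> with a partial solution, \<open>f\<close>
    coincides with that single series, so a least element can be sought in its support.\<close>
  have wo_f: "wo {d. f d \<noteq> 0}"
    unfolding wo_iff_least
  proof (intro allI impI)
    fix T assume T: "T \<subseteq> {d. f d \<noteq> 0}" "T \<noteq> {}"
    then obtain t where t: "t \<in> T" by blast
    with T obtain x where x: "good t x" using f0 by blast
    have "t \<in> supp x \<inter> T" using f[OF x, of t] t T by (auto simp: supp_def)
    moreover have "wo (supp x \<inter> T)" by (rule wo_subset[OF wo_supp]) blast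
    ultimately obtain m where m: "m \<in> supp x \<inter> T" "\<And>s. s \<in> supp x \<inter> T \<Longrightarrow> m \<le> s"
      using wo_least by metis
    have "m \<le> s" if s: "s \<in> T" for s
    proof (cases "s \<le> t")
      case True
      then have "s \<in> supp x" using f[OF x True] s T by (auto simp: supp_def)
      then show ?thesis using m s by blast
    next
      case False
      then show ?thesis using m(2)[of t] \<open>t \<in> supp x \<inter> T\<close> by simp
    qed
    then show "\<exists>m\<in>T. \<forall>s\<in>T. m \<le> s" using m(1) by blast
  qed
  define x where "x = Hahn f"
  have cx: "coeff x = f" unfolding x_def by (rule coeff_Hahn[OF wo_f]) simp
  have xG: "x \<in> hahn_on G"
    unfolding hahn_on_def
  proof (intro CollectI subsetI)
    fix d assume "d \<in> supp x"
    then have fd: "f d \<noteq> 0" by (simp add: supp_def cx)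
    then obtain y where y: "good d y" using f0 by blast
    then have "coeff y d \<noteq> 0" using f[OF y, of d] fd by simp
    then show "d \<in> G" using y by (auto simp: good_def hahn_on_def supp_def)
  qed
  have good_x: "coeff (F x) d = coeff x d" if y: "good d y" for d y
  proof -
    have "vge (x - y) d" using f[OF y] by (simp add: vge_def cx)
    then have "vgt (F x - F y) d" using contr xG y by (auto simp: good_def)
    then have "coeff (F x) d = coeff (F y) d" by (auto simp: vgt_def)
    also have "\<dots> = coeff y d" using y by (simp add: good_def)
    also have "\<dots> = coeff x d" using f[OF y] by (simp add: cx)
    finally show ?thesis .
  qed
  \<comment> \<open>If \<open>F x\<close> first differs from \<open>x\<close> at \<open>e\<close>,
    contraction makes \<open>F x\<close> a partial solution up to and including \<open>e\<close>,
    and \<open>x\<close> agrees with all of these.\<close>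
  have "F x = x"
  proof (rule ccontr)
    assume "F x \<noteq> x"
    then obtain e where e: "vge (F x - x) e" "coeff (F x - x) e \<noteq> 0"
      using hahn_order[of "F x - x"] by auto
    have "vgt (F (F x) - F x) e" using contr[OF F[OF xG] xG e(1)] .
    then have "good e (F x)" using F[OF xG] by (auto simp: good_def vgt_def)
    then show False using good_x e(2) by simp
  qed
  with xG show thesis using that by blast
qed

subsection \<open>The field structure\<close>

text \<open>Dividing by the leading term reduces to 1 - u with u of positive order, whose inverse is
  the fixed point of y = 1 + u y.\<close>

lemma hahn_inverse_exists:
  assumes "x \<noteq> (0 :: 'e::linordered_ab_group_add hahn)"
  shows "\<exists>y. x * y = 1"
proof -
  obtain e where e: "vge x e" "coeff x e \<noteq> 0" using hahn_order[OF assms] .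
  define m where "m = hmonom (1 / coeff x e) (- e)"
  define u where "u = 1 - m * x"
  have u: "vgt u 0"
    unfolding vgt_iff_vge
  proof
    have "vge m (- e)" by (simp add: m_def vge_hmonom)
    then show "vge u 0"
      using vge_mult[OF _ e(1), of m "- e"] by (auto simp: u_def one_hahn_def intro!: vge_diff vge_hmonom)
    show "coeff u 0 = 0"
      using e(2) by (simp add: u_def m_def coeff_hmonom_mult one_hahn_def coeff_hmonom)
  qed
  obtain y where "1 + u * y = y"
  proof (rule hahn_fixed_point[of UNIV "\<lambda>y. 1 + u * y"])
    fix y z :: "'e hahn" and e assume "vge (y - z) e"
    from vgt_mult_left[OF u this] show "vgt ((1 + u * y) - (1 + u * z)) e"
      by (simp add: right_diff_distrib)
  qed (auto simp: hahn_on_def)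
  then have "m * x * y = 1" by (simp add: u_def left_diff_distrib)
  then have "x * (m * y) = 1" by (metis mult.assoc mult.commute)
  then show ?thesis ..
qed

instantiation hahn :: (linordered_ab_group_add) field
begin

definition "inverse x = (if x = 0 then 0 else SOME y. x * y = 1)" for x :: "'a hahn"
definition "x div y = x * inverse y" for x y :: "'a hahn"

instance
proof
  fix x y :: "'a hahn"
  show "x \<noteq> 0 \<Longrightarrow> inverse x * x = 1"
    using someI_ex[OF hahn_inverse_exists[of x]] by (simp add: inverse_hahn_def mult.commute)
qed (simp_all add: divide_hahn_def inverse_hahn_def)

end

lemma of_nat_hahn: "(of_nat n :: 'e::linordered_ab_group_add hahn) = hmonom (of_nat n) 0"
proof (induction n)
  case (Suc n)
  then show ?case by (intro hahn_eqI) (simp add: one_hahn_def coeff_hmonom)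
qed simp

instance hahn :: (linordered_ab_group_add) field_char_0
proof
  show "inj (of_nat :: nat \<Rightarrow> 'a hahn)"
  proof (rule injI)
    fix m n :: nat assume "(of_nat m :: 'a hahn) = of_nat n"
    from arg_cong[OF this, of "\<lambda>x. coeff x 0"] show "m = n"
      by (simp add: of_nat_hahn coeff_hmonom)
  qed
qed

lemma inverse_hmonom: "c \<noteq> 0 \<Longrightarrow> inverse (hmonom c e) = hmonom (1 / c) (- e)"
  by (rule inverse_unique) (simp add: hmonom_mult one_hahn_def)

lemma hahn_inverse_order:
  assumes "vge x e" "coeff x e \<noteq> 0"
  shows "vge (inverse x) (- e)" "coeff (inverse x) (- e) = 1 / coeff x e"
proof -
  have x: "x \<noteq> 0" using assms(2) by auto
  then have "inverse x \<noteq> 0" by simp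
  then obtain d where d: "vge (inverse x) d" "coeff (inverse x) d \<noteq> 0" by (rule hahn_order)
  have "coeff (1 :: 'a hahn) (e + d) \<noteq> 0"
    using coeff_mult_lead[OF assms(1) d(1)] x assms(2) d(2) by simp
  then have "e + d = 0" by (simp add: one_hahn_def coeff_hmonom split: if_splits)
  then have d_eq: "d = - e" by (simp add: eq_neg_iff_add_eq_0 add.commute)
  show "vge (inverse x) (- e)" using d(1) d_eq by simp
  have "coeff x e * coeff (inverse x) (- e) = coeff (1 :: 'a hahn) 0"
    using coeff_mult_lead[OF assms(1) d(1)] x d_eq by simp
  then show "coeff (inverse x) (- e) = 1 / coeff x e"
    using assms(2) by (simp add: one_hahn_def coeff_hmonom field_simps)
qed

subsection \<open>Subfields given by subgroups of exponents\<close>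

lemma hahn_onI: "(\<And>e. coeff x e \<noteq> 0 \<Longrightarrow> e \<in> G) \<Longrightarrow> x \<in> hahn_on G"
  by (auto simp: hahn_on_def supp_def)

lemma hahn_onD: "x \<in> hahn_on G \<Longrightarrow> coeff x e \<noteq> 0 \<Longrightarrow> e \<in> G"
  by (auto simp: hahn_on_def supp_def)

lemma hahn_on_0 [simp]: "0 \<in> hahn_on G"
  by (simp add: hahn_on_def)

lemma hahn_on_add: "x \<in> hahn_on G \<Longrightarrow> y \<in> hahn_on G \<Longrightarrow> x + y \<in> hahn_on G"
  and hahn_on_diff: "x \<in> hahn_on G \<Longrightarrow> y \<in> hahn_on G \<Longrightarrow> x - y \<in> hahn_on G"
  and hahn_on_minus: "x \<in> hahn_on G \<Longrightarrow> - x \<in> hahn_on G"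
  using supp_add[of x y] supp_diff[of x y] by (auto simp: hahn_on_def)

lemma hahn_on_hmonom: "e \<in> G \<Longrightarrow> hmonom c e \<in> hahn_on G"
  using supp_hmonom[of c e] by (auto simp: hahn_on_def)

locale exponent_group =
  fixes G :: "'e::linordered_ab_group_add set"
  assumes zero_mem: "0 \<in> G"
    and add_mem: "a \<in> G \<Longrightarrow> b \<in> G \<Longrightarrow> a + b \<in> G"
    and minus_mem: "a \<in> G \<Longrightarrow> - a \<in> G"
begin

lemma hahn_on_mult:
  assumes "x \<in> hahn_on G" "y \<in> hahn_on G"
  shows "x * y \<in> hahn_on G"
proof -
  have "supp x + supp y \<subseteq> G"
    using assms add_mem by (auto simp: hahn_on_def elim!: set_plus_elim)
  then show ?thesis using supp_mult[of x y] by (auto simp: hahn_on_def)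
qed

lemma hahn_on_1: "1 \<in> hahn_on G"
  by (simp add: one_hahn_def hahn_on_hmonom zero_mem)

lemma hahn_on_power: "x \<in> hahn_on G \<Longrightarrow> x ^ n \<in> hahn_on G"
  by (induction n) (auto intro: hahn_on_mult hahn_on_1)

lemma hahn_on_of_nat: "of_nat n \<in> hahn_on G"
  by (simp add: of_nat_hahn hahn_on_hmonom zero_mem)

lemma hahn_on_inverse:
  assumes "x \<in> hahn_on G"
  shows "inverse x \<in> hahn_on G"
proof (cases "x = 0")
  case False
  define y where "y = Hahn (\<lambda>e. if e \<in> G then coeff (inverse x) e else 0)"
  have y: "coeff y e = (if e \<in> G then coeff (inverse x) e else 0)" for e
    unfolding y_def by (subst coeff_Hahn[OF wo_supp[of "inverse x"]]) (auto simp: supp_def)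
  \<comment> \<open>Since \<open>G\<close> is a subgroup, restriction of exponents to \<open>G\<close> commutes with multiplication by \<open>x\<close>.\<close>
  have "x * y = 1"
  proof (rule hahn_eqI)
    fix e
    have *: "e - d \<in> G \<longleftrightarrow> e \<in> G" if "d \<in> supp x" for d
    proof -
      have d: "d \<in> G" using that assms by (auto simp: hahn_on_def)
      show ?thesis using add_mem[OF _ d, of "e - d"] add_mem[OF _ minus_mem[OF d], of e] by auto
    qed
    have "coeff (x * y) e = (\<Sum>d\<in>{d \<in> supp x. e - d \<in> supp (inverse x)}. coeff x d * coeff y (e - d))"
      by (rule coeff_mult_superset[OF finite_supp_pairs]) (auto simp: supp_def y split: if_splits)
    also have "\<dots> = (if e \<in> G then coeff (x * inverse x) e else 0)"
      unfolding coeff_mult y by (auto intro!: sum.cong sum.neutral simp: *)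
    also have "\<dots> = coeff 1 e"
      using False zero_mem by (auto simp: one_hahn_def coeff_hmonom)
    finally show "coeff (x * y) e = coeff 1 e" .
  qed
  then have "inverse x = y" by (rule inverse_unique)
  then show ?thesis using y by (metis hahn_onI)
qed simp

lemma hahn_on_divide: "x \<in> hahn_on G \<Longrightarrow> y \<in> hahn_on G \<Longrightarrow> x / y \<in> hahn_on G"
  by (simp add: divide_hahn_def hahn_on_mult hahn_on_inverse)

end


section \<open>Summable families\<close>

lemma shift_Suc_eq: "shift V P (Suc n) = shift V P n + P"
proof
  show "shift V P (Suc n) \<subseteq> shift V P n + P"
  proof
    fix x assume "x \<in> shift V P (Suc n)"
    then obtain v p u where "x = v + sum_list (p # u)" "v \<in> V" "set (p # u) \<subseteq> P" "length u = n"
      unfolding shift_def by (auto simp: length_Suc_conv)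
    moreover from this have "(v + sum_list u) + p \<in> shift V P n + P"
      by (intro set_plus_intro) (auto simp: shift_def)
    ultimately show "x \<in> shift V P n + P" by (simp add: add_ac)
  qed
qed (rule shift_Suc)

lemma shift_plus_pairwise: "shift V P n + shift W Q n = shift (V + W) (P + Q) n"
  by (induction n) (auto simp: shift_Suc_eq add_ac)

lemma shift_shift: "shift (shift V P m) P n = shift V P (m + n)"
  by (induction n) (auto simp: shift_Suc_eq)

lemma shift_eq_plus: "shift V P n = V + shift {0} P n"
  by (induction n) (auto simp: shift_Suc_eq add_ac)

lemma shift_plus_left: "shift (V + W) P n = shift V P n + W"
  by (induction n) (auto simp: shift_Suc_eq add_ac)

lemma shift_commute: "shift (shift V P m) Q n = shift (shift V Q n) P m"
  by (induction n) (auto simp: shift_Suc_eq shift_plus_left)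

lemma shift_shift_same: "shift (shift V P n) Q n = shift V (P + Q) n"
proof (induction n)
  case (Suc n)
  then show ?case by (simp only: shift_Suc_eq shift_plus_left add.assoc)
qed simp

definition summ :: "(nat \<Rightarrow> 'e::linordered_ab_group_add hahn) \<Rightarrow> bool"
  where "summ F \<longleftrightarrow> wo (\<Union>i. supp (F i)) \<and> (\<forall>e. finite {i. coeff (F i) e \<noteq> 0})"

definition hsum :: "(nat \<Rightarrow> 'e::linordered_ab_group_add hahn) \<Rightarrow> 'e hahn"
  where "hsum F = Hahn (\<lambda>e. \<Sum>i\<in>{i. coeff (F i) e \<noteq> 0}. coeff (F i) e)"

lemma summ_finite: "summ F \<Longrightarrow> finite {i. coeff (F i) e \<noteq> 0}"
  by (simp add: summ_def)

lemma coeff_hsum: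
  assumes "summ F"
  shows "coeff (hsum F) e = (\<Sum>i\<in>{i. coeff (F i) e \<noteq> 0}. coeff (F i) e)"
proof -
  have "{e. (\<Sum>i\<in>{i. coeff (F i) e \<noteq> 0}. coeff (F i) e) \<noteq> 0} \<subseteq> (\<Union>i. supp (F i))"
  proof
    fix e assume "e \<in> {e. (\<Sum>i\<in>{i. coeff (F i) e \<noteq> 0}. coeff (F i) e) \<noteq> 0}"
    then have "(\<Sum>i\<in>{i. coeff (F i) e \<noteq> 0}. coeff (F i) e) \<noteq> 0" by simp
    then obtain i where "i \<in> {i. coeff (F i) e \<noteq> 0}"
      by (rule sum.not_neutral_contains_not_neutral)
    then show "e \<in> (\<Union>i. supp (F i))" by (auto simp: supp_def)
  qed
  with assms show ?thesis
    unfolding hsum_def summ_def by (subst coeff_Hahn) auto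
qed

lemma coeff_hsum_superset:
  assumes "summ F" "finite S" "\<And>i. coeff (F i) e \<noteq> 0 \<Longrightarrow> i \<in> S"
  shows "coeff (hsum F) e = (\<Sum>i\<in>S. coeff (F i) e)"
  unfolding coeff_hsum[OF assms(1)]
  by (rule sum.mono_neutral_left) (use assms in auto)

lemma coeff_hsum_nonzero:
  assumes "summ F" "coeff (hsum F) e \<noteq> 0"
  obtains i where "coeff (F i) e \<noteq> 0"
proof -
  from assms(2) have "(\<Sum>i\<in>{i. coeff (F i) e \<noteq> 0}. coeff (F i) e) \<noteq> 0"
    by (simp add: coeff_hsum[OF assms(1)])
  then obtain i where "i \<in> {i. coeff (F i) e \<noteq> 0}"
    by (rule sum.not_neutral_contains_not_neutral)
  then show ?thesis using that by simp
qed

lemma summ_shift: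
  assumes "wo V" "wo P" "\<And>p. p \<in> P \<Longrightarrow> 0 < p" "\<And>i. supp (F i) \<subseteq> shift V P i"
  shows "summ F"
  unfolding summ_def
proof (intro conjI allI)
  show "wo (\<Union>i. supp (F i))"
    by (rule wo_subset[OF wo_shift[OF assms(1-3)]]) (use assms(4) in auto)
  show "finite {i. coeff (F i) e \<noteq> 0}" for e
    by (rule finite_subset[OF _ finite_shift[OF assms(1-3), of e]])
      (use assms(4) in \<open>auto simp: supp_def\<close>)
qed

lemma summ_add:
  assumes "summ F" "summ G"
  shows "summ (\<lambda>i. F i + G i)"
  unfolding summ_def
proof (intro conjI allI)
  show "wo (\<Union>i. supp (F i + G i))"
    by (rule wo_subset[OF wo_Un[of "\<Union>i. supp (F i)" "\<Union>i. supp (G i)"]])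
      (use assms supp_add in \<open>fastforce simp: summ_def\<close>)+
  show "finite {i. coeff (F i + G i) e \<noteq> 0}" for e
    by (rule finite_subset[OF _ finite_UnI[OF summ_finite[OF assms(1), of e] summ_finite[OF assms(2), of e]]])
      auto
qed

lemma hsum_add:
  assumes "summ F" "summ G"
  shows "hsum (\<lambda>i. F i + G i) = hsum F + hsum G"
proof (rule hahn_eqI)
  fix e
  let ?S = "{i. coeff (F i) e \<noteq> 0} \<union> {i. coeff (G i) e \<noteq> 0}"
  have S: "finite ?S" using assms by (simp add: summ_finite)
  show "coeff (hsum (\<lambda>i. F i + G i)) e = coeff (hsum F + hsum G) e"
    using coeff_hsum_superset[OF assms(1) S] coeff_hsum_superset[OF assms(2) S]
      coeff_hsum_superset[OF summ_add[OF assms] S]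
    by (auto simp: sum.distrib)
qed

lemma summ_mult:
  assumes "summ F"
  shows "summ (\<lambda>i. c * F i)"
  unfolding summ_def
proof (intro conjI allI)
  let ?U = "\<Union>i. supp (F i)"
  have U: "wo ?U" using assms by (simp add: summ_def)
  show "wo (\<Union>i. supp (c * F i))"
  proof (rule wo_subset[OF wo_plus[OF wo_supp[of c] U]])
    show "(\<Union>i. supp (c * F i)) \<subseteq> supp c + ?U"
    proof
      fix e assume "e \<in> (\<Union>i. supp (c * F i))"
      then obtain i a b where "e = a + b" "a \<in> supp c" "b \<in> supp (F i)"
        using supp_mult[of c] by (blast elim!: set_plus_elim)
      then show "e \<in> supp c + ?U" by auto
    qed
  qed
  fix e
  have "finite (\<Union>d\<in>{d \<in> supp c. e - d \<in> ?U}. {i. coeff (F i) (e - d) \<noteq> 0})"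
    using finite_wo_pairs[OF wo_supp[of c] U] summ_finite[OF assms] by auto
  moreover have "{i. coeff (c * F i) e \<noteq> 0} \<subseteq> (\<Union>d\<in>{d \<in> supp c. e - d \<in> ?U}. {i. coeff (F i) (e - d) \<noteq> 0})"
  proof
    fix i assume "i \<in> {i. coeff (c * F i) e \<noteq> 0}"
    then have "e \<in> supp (c * F i)" by (simp add: supp_def)
    then obtain a b where "e = a + b" "a \<in> supp c" "b \<in> supp (F i)"
      using supp_mult[of c] by (blast elim!: set_plus_elim)
    then have "a \<in> {d \<in> supp c. e - d \<in> ?U}" "coeff (F i) (e - a) \<noteq> 0"
      by (auto simp: in_supp_iff[symmetric])
    then show "i \<in> (\<Union>d\<in>{d \<in> supp c. e - d \<in> ?U}. {i. coeff (F i) (e - d) \<noteq> 0})"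
      by blast
  qed
  ultimately show "finite {i. coeff (c * F i) e \<noteq> 0}" by (rule rev_finite_subset)
qed

lemma hsum_mult:
  assumes "summ F"
  shows "hsum (\<lambda>i. c * F i) = c * hsum F"
proof (rule hahn_eqI)
  fix e
  let ?U = "\<Union>i. supp (F i)"
  let ?D = "{d \<in> supp c. e - d \<in> ?U}"
  let ?S = "\<Union>d\<in>?D. {i. coeff (F i) (e - d) \<noteq> 0}"
  have U: "wo ?U" using assms by (simp add: summ_def)
  have D: "finite ?D" by (rule finite_wo_pairs[OF wo_supp U])
  have S: "finite ?S" using D summ_finite[OF assms] by auto
  have trm: "coeff (c * F i) e = (\<Sum>d\<in>?D. coeff c d * coeff (F i) (e - d))" for i
    by (rule coeff_mult_superset[OF D]) (auto simp: supp_def)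
  have "coeff (hsum (\<lambda>i. c * F i)) e = (\<Sum>i\<in>?S. coeff (c * F i) e)"
  proof (rule coeff_hsum_superset[OF summ_mult[OF assms] S])
    fix i assume "coeff (c * F i) e \<noteq> 0"
    then have "(\<Sum>d\<in>?D. coeff c d * coeff (F i) (e - d)) \<noteq> 0" unfolding trm .
    then obtain d where "d \<in> ?D" "coeff c d * coeff (F i) (e - d) \<noteq> 0"
      by (rule sum.not_neutral_contains_not_neutral)
    then show "i \<in> ?S" by auto
  qed
  also have "\<dots> = (\<Sum>d\<in>?D. coeff c d * (\<Sum>i\<in>?S. coeff (F i) (e - d)))"
    unfolding trm sum_distrib_left by (rule sum.swap)
  also have "\<dots> = (\<Sum>d\<in>?D. coeff c d * coeff (hsum F) (e - d))"
  proof (rule sum.cong[OF refl])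
    fix d assume "d \<in> ?D"
    then have "(\<Sum>i\<in>?S. coeff (F i) (e - d)) = coeff (hsum F) (e - d)"
      by (intro coeff_hsum_superset[OF assms S, symmetric]) auto
    then show "coeff c d * (\<Sum>i\<in>?S. coeff (F i) (e - d)) = coeff c d * coeff (hsum F) (e - d)"
      by simp
  qed
  also have "\<dots> = coeff (c * hsum F) e"
  proof (rule coeff_mult_superset[OF D, symmetric])
    fix d assume *: "coeff c d \<noteq> 0" "coeff (hsum F) (e - d) \<noteq> 0"
    from coeff_hsum_nonzero[OF assms *(2)] obtain i where "coeff (F i) (e - d) \<noteq> 0" .
    then show "d \<in> ?D" using * by (auto simp: supp_def)
  qed
  finally show "coeff (hsum (\<lambda>i. c * F i)) e = coeff (c * hsum F) e" .
qed

lemma summ_minus: "summ F \<Longrightarrow> summ (\<lambda>i. - F i)"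
  and hsum_minus: "summ F \<Longrightarrow> hsum (\<lambda>i. - F i) = - hsum F"
  using summ_mult[of F "- 1"] hsum_mult[of F "- 1"] by simp_all

lemma summ_diff: "summ F \<Longrightarrow> summ G \<Longrightarrow> summ (\<lambda>i. F i - G i)"
  using summ_add[OF _ summ_minus, of F G] by simp

lemma hsum_diff: "summ F \<Longrightarrow> summ G \<Longrightarrow> hsum (\<lambda>i. F i - G i) = hsum F - hsum G"
  using hsum_add[OF _ summ_minus, of F G] by (simp add: hsum_minus)

lemma summ_Suc: "summ F \<Longrightarrow> summ (\<lambda>i. F (Suc i))"
  unfolding summ_def
proof (intro conjI allI)
  assume *: "wo (\<Union>i. supp (F i)) \<and> (\<forall>e. finite {i. coeff (F i) e \<noteq> 0})"
  show "wo (\<Union>i. supp (F (Suc i)))"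
    by (rule wo_subset[of "\<Union>i. supp (F i)"]) (use * in auto)
  show "finite {i. coeff (F (Suc i)) e \<noteq> 0}" for e
    using finite_vimageI[of "{i. coeff (F i) e \<noteq> 0}" Suc] * by (simp add: vimage_def)
qed

lemma hsum_Suc:
  assumes "summ F"
  shows "hsum F = F 0 + hsum (\<lambda>i. F (Suc i))"
proof (rule hahn_eqI)
  fix e
  let ?S = "{i. coeff (F (Suc i)) e \<noteq> 0}"
  have S: "finite ?S" by (rule summ_finite[OF summ_Suc[OF assms]])
  have "coeff (hsum F) e = (\<Sum>i\<in>insert 0 (Suc ` ?S). coeff (F i) e)"
  proof (rule coeff_hsum_superset[OF assms])
    fix i assume "coeff (F i) e \<noteq> 0"
    then show "i \<in> insert 0 (Suc ` ?S)" by (cases i) auto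
  qed (use S in simp)
  also have "\<dots> = coeff (F 0) e + (\<Sum>i\<in>?S. coeff (F (Suc i)) e)"
    using S by (simp add: sum.reindex)
  finally show "coeff (hsum F) e = coeff (F 0 + hsum (\<lambda>i. F (Suc i))) e"
    by (simp add: coeff_hsum[OF summ_Suc[OF assms]])
qed

lemma vge_hsum: "summ F \<Longrightarrow> (\<And>i. vge (F i) e) \<Longrightarrow> vge (hsum F) e"
  unfolding vge_def by (metis coeff_hsum_nonzero)

lemma vgt_hsum: "summ F \<Longrightarrow> (\<And>i. vgt (F i) e) \<Longrightarrow> vgt (hsum F) e"
  unfolding vgt_def by (metis coeff_hsum_nonzero)

lemma hahn_on_hsum: "summ F \<Longrightarrow> (\<And>i. F i \<in> hahn_on G) \<Longrightarrow> hsum F \<in> hahn_on G"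
  by (metis coeff_hsum_nonzero hahn_onD hahn_onI)

lemma hsum_zero [simp]: "hsum (\<lambda>_. 0) = 0"
proof -
  have *: "summ (\<lambda>_. 0 :: 'e::linordered_ab_group_add hahn)" by (simp add: summ_def)
  show ?thesis by (rule hahn_eqI) (simp add: coeff_hsum[OF *])
qed

text \<open>The family is bounded by total degree \<open>i + j\<close>, and by Neumann's lemma only
  finitely many degrees reach a given exponent, so at each exponent a finite sum is
  rearranged.\<close>

lemma hsum_triangle:
  assumes V: "wo V" and P: "wo P" "\<And>p. p \<in> P \<Longrightarrow> 0 < p"
    and F: "\<And>i j. supp (F i j) \<subseteq> shift V P (i + j)"
  shows "hsum (\<lambda>i. hsum (F i)) = hsum (\<lambda>n. \<Sum>i\<le>n. F i (n - i))"
proof -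
  let ?U = "\<Union>n. shift V P n"
  have U: "wo ?U" using assms by (intro wo_shift)
  have nz: "e \<in> shift V P (i + j)" if "coeff (F i j) e \<noteq> 0" for i j e
    using F[of i j] that by (auto simp: supp_def)
  have bound: "\<exists>M. \<forall>n. e \<in> shift V P n \<longrightarrow> n \<le> M" for e
    using finite_shift[OF V P, of e] finite_nat_set_iff_bounded_le by auto
  have fin: "finite {(i, j). coeff (F i j) e \<noteq> 0}" for e
  proof -
    obtain M where M: "\<And>n. e \<in> shift V P n \<Longrightarrow> n \<le> M" using bound by blast
    have "{(i, j). coeff (F i j) e \<noteq> 0} \<subseteq> {..M} \<times> {..M}"
    proof
      fix p assume "p \<in> {(i, j). coeff (F i j) e \<noteq> 0}"
      then obtain i j where "p = (i, j)" "coeff (F i j) e \<noteq> 0" by blast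
      moreover from this(2) have "i + j \<le> M" by (intro M nz)
      ultimately show "p \<in> {..M} \<times> {..M}" by simp
    qed
    then show ?thesis by (rule finite_subset) auto
  qed
  have inner: "summ (F i)" for i
    unfolding summ_def
  proof (intro conjI allI)
    show "wo (\<Union>j. supp (F i j))" by (rule wo_subset[OF U]) (use F in blast)
    show "finite {j. coeff (F i j) e \<noteq> 0}" for e
      by (rule finite_subset[OF _ finite_imageI[OF fin[of e], of snd]]) (force simp: image_iff)
  qed
  have outer: "summ (\<lambda>i. hsum (F i))"
    unfolding summ_def
  proof (intro conjI allI)
    show "wo (\<Union>i. supp (hsum (F i)))"
    proof (rule wo_subset[OF U], rule)
      fix e assume "e \<in> (\<Union>i. supp (hsum (F i)))"
      then obtain i where "coeff (hsum (F i)) e \<noteq> 0" by (auto simp: supp_def)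
      from coeff_hsum_nonzero[OF inner this] obtain j where "coeff (F i j) e \<noteq> 0" .
      then show "e \<in> ?U" using nz by blast
    qed
    fix e
    have "{i. coeff (hsum (F i)) e \<noteq> 0} \<subseteq> fst ` {(i, j). coeff (F i j) e \<noteq> 0}"
    proof
      fix i assume "i \<in> {i. coeff (hsum (F i)) e \<noteq> 0}"
      then have "coeff (hsum (F i)) e \<noteq> 0" by simp
      from coeff_hsum_nonzero[OF inner this] obtain j where "coeff (F i j) e \<noteq> 0" .
      then show "i \<in> fst ` {(i, j). coeff (F i j) e \<noteq> 0}" by (force simp: image_iff)
    qed
    then show "finite {i. coeff (hsum (F i)) e \<noteq> 0}"
      using fin by (meson finite_imageI finite_subset)
  qed
  have diag: "supp (\<Sum>i\<le>n. F i (n - i)) \<subseteq> shift V P n" for n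
  proof
    fix e assume "e \<in> supp (\<Sum>i\<le>n. F i (n - i))"
    then have "(\<Sum>i\<le>n. coeff (F i (n - i)) e) \<noteq> 0" by (simp add: supp_def)
    then obtain i where "i \<in> {..n}" "coeff (F i (n - i)) e \<noteq> 0"
      by (rule sum.not_neutral_contains_not_neutral)
    then show "e \<in> shift V P n" using nz[of i "n - i" e] by simp
  qed
  have tri: "summ (\<lambda>n. \<Sum>i\<le>n. F i (n - i))"
    by (rule summ_shift[OF V P diag])
  show "hsum (\<lambda>i. hsum (F i)) = hsum (\<lambda>n. \<Sum>i\<le>n. F i (n - i))"
  proof (rule hahn_eqI)
    fix e
    obtain M where M: "\<And>n. e \<in> shift V P n \<Longrightarrow> n \<le> M" using bound by blast
    have M': "i + j \<le> M" if "coeff (F i j) e \<noteq> 0" for i j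
      using M[OF nz[OF that]] .
    have in_sum: "coeff (hsum (F i)) e = (\<Sum>j\<le>M. coeff (F i j) e)" for i
      by (rule coeff_hsum_superset[OF inner]) (auto dest: M')
    have "coeff (hsum (\<lambda>i. hsum (F i))) e = (\<Sum>i\<le>M. coeff (hsum (F i)) e)"
    proof (rule coeff_hsum_superset[OF outer])
      fix i assume "coeff (hsum (F i)) e \<noteq> 0"
      from coeff_hsum_nonzero[OF inner this] obtain j where "coeff (F i j) e \<noteq> 0" .
      then show "i \<in> {..M}" using M' by fastforce
    qed simp
    also have "\<dots> = (\<Sum>(i, j)\<in>{..M} \<times> {..M}. coeff (F i j) e)"
      by (simp add: in_sum sum.cartesian_product)
    also have "\<dots> = (\<Sum>(i, j)\<in>{(i, j). i + j \<le> M}. coeff (F i j) e)"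
      by (rule sum.mono_neutral_right) (use M' in fastforce)+
    also have "\<dots> = (\<Sum>n\<le>M. \<Sum>i\<le>n. coeff (F i (n - i)) e)"
      by (rule sum.triangle_reindex_eq)
    also have "\<dots> = coeff (hsum (\<lambda>n. \<Sum>i\<le>n. F i (n - i))) e"
    proof (subst coeff_hsum_superset[OF tri, of "{..M}"])
      fix n assume "coeff (\<Sum>i\<le>n. F i (n - i)) e \<noteq> 0"
      then have "e \<in> shift V P n" using diag[of n] by (auto simp: supp_def)
      then show "n \<in> {..M}" using M by simp
    qed simp_all
    finally show "coeff (hsum (\<lambda>i. hsum (F i))) e = coeff (hsum (\<lambda>n. \<Sum>i\<le>n. F i (n - i))) e" .
  qed
qed

lemma hsum_swap:
  assumes V: "wo V" and P: "wo P" "\<And>p. p \<in> P \<Longrightarrow> 0 < p"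
    and F: "\<And>i j. supp (F i j) \<subseteq> shift V P (i + j)"
  shows "hsum (\<lambda>i. hsum (F i)) = hsum (\<lambda>j. hsum (\<lambda>i. F i j))"
proof -
  have F': "supp (F j i) \<subseteq> shift V P (i + j)" for i j
    using F[of j i] by (simp add: add.commute)
  have "(\<Sum>i\<le>n. F i (n - i)) = (\<Sum>i\<le>n. F (n - i) i)" for n
    by (rule sum.reindex_bij_witness[of _ "\<lambda>i. n - i" "\<lambda>i. n - i"]) auto
  then show ?thesis
    using hsum_triangle[of V P F, OF V P F] hsum_triangle[of V P "\<lambda>j i. F i j", OF V P F'] by simp
qed


section \<open>Orders of powers and of differences of powers\<close>

primrec nmul :: "nat \<Rightarrow> 'e::linordered_ab_group_add \<Rightarrow> 'e" where
  "nmul 0 a = 0"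
| "nmul (Suc n) a = a + nmul n a"

lemma nmul_nonneg: "0 \<le> a \<Longrightarrow> 0 \<le> nmul n a"
  by (induction n) auto

lemma nmul_add: "nmul n (a + b) = nmul n a + nmul n b"
  by (induction n) (auto simp: algebra_simps)

lemma coeff_divide_of_nat: "coeff (x / of_nat n) e = coeff x e / of_nat n"
proof (cases "n = 0")
  case False
  then have "inverse (of_nat n :: 'a hahn) = hmonom (1 / of_nat n) 0"
    by (simp add: of_nat_hahn inverse_hmonom)
  then have "x / of_nat n = hmonom (1 / of_nat n) 0 * x"
    by (simp add: divide_hahn_def mult.commute)
  then show ?thesis by (simp add: coeff_hmonom_mult)
qed simp

lemma coeff_divide_fact: "coeff (x / fact n) e = coeff x e / fact n"
  using coeff_divide_of_nat[of x "fact n" e] by (simp add: of_nat_fact)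

lemma vge_divide_fact [simp]: "vge (x / fact n) e \<longleftrightarrow> vge x e"
  and vgt_divide_fact [simp]: "vgt (x / fact n) e \<longleftrightarrow> vgt x e"
  and supp_divide_fact [simp]: "supp (x / fact n) = supp x"
  by (auto simp: vge_def vgt_def supp_def coeff_divide_fact)

lemma vge_power: "vge u a \<Longrightarrow> vge (u ^ n) (nmul n a)"
  by (induction n) (auto simp: one_hahn_def intro: vge_hmonom vge_mult)

lemma vgt_power: "vgt u a \<Longrightarrow> vgt (u ^ Suc n) (nmul (Suc n) a)"
  using vgt_mult_left[OF _ vge_power[OF vgt_imp_vge], of u a u a n] by simp

lemma power_Suc_diff: "u ^ Suc n - w ^ Suc n = u * (u ^ n - w ^ n) + (u - w) * w ^ n"
  for u w :: "'a::comm_ring_1"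
  by (simp add: algebra_simps)

lemma vge_power_diff:
  assumes "vge u a" "vge w a" "vge (u - w) d"
  shows "vge (u ^ Suc n - w ^ Suc n) (d + nmul n a)"
proof (induction n)
  case (Suc n)
  have "vge (u * (u ^ Suc n - w ^ Suc n)) (d + nmul (Suc n) a)"
    using vge_mult[OF assms(1) Suc] by (simp add: algebra_simps)
  moreover have "vge ((u - w) * w ^ Suc n) (d + nmul (Suc n) a)"
    using vge_mult[OF assms(3) vge_power[OF assms(2)], of "Suc n"] by simp
  ultimately show ?case unfolding power_Suc_diff[of u "Suc n"] by (rule vge_add)
qed (use assms in simp)

lemma vgt_power_diff:
  assumes "vge u a" "vge w a" "vgt (u - w) d"
  shows "vgt (u ^ Suc n - w ^ Suc n) (d + nmul n a)"
proof (induction n)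
  case (Suc n)
  have "vgt (u * (u ^ Suc n - w ^ Suc n)) (d + nmul (Suc n) a)"
    using vgt_mult_right[OF assms(1) Suc] by (simp add: algebra_simps)
  moreover have "vgt ((u - w) * w ^ Suc n) (d + nmul (Suc n) a)"
    using vgt_mult_left[OF assms(3) vge_power[OF assms(2)], of "Suc n"] by simp
  ultimately show ?case unfolding power_Suc_diff[of u "Suc n"] by (rule vgt_add)
qed (use assms in simp)

text \<open>Every summand u^i (u - w) w^j of the difference keeps a factor of order above
  \<open>a\<close>, so the estimate is strict although the one on \<open>u - w\<close> is
  not.\<close>

lemma vgt_power_diff':
  assumes "vgt u a" "vgt w a" "vge (u - w) d"
  shows "vgt (u ^ Suc (Suc n) - w ^ Suc (Suc n)) (d + nmul (Suc n) a)"
proof -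
  have "vgt (u * (u ^ Suc n - w ^ Suc n)) (d + nmul (Suc n) a)"
    using vgt_mult_left[OF assms(1) vge_power_diff[OF assms(1,2)[THEN vgt_imp_vge] assms(3)], of n]
    by (simp add: algebra_simps)
  moreover have "vgt ((u - w) * w ^ Suc n) (d + nmul (Suc n) a)"
    using vgt_mult_right[OF assms(3) vgt_power[OF assms(2)], of n] by simp
  ultimately show ?thesis unfolding power_Suc_diff[of u "Suc n"] by (rule vgt_add)
qed

lemma supp_power: "supp (u ^ n) \<subseteq> shift {0} (supp u) n"
proof (induction n)
  case 0
  then show ?case using supp_hmonom[of 1 "0::'a"] by (simp add: one_hahn_def)
next
  case (Suc n)
  have "supp (u ^ Suc n) \<subseteq> supp (u ^ n) + supp u"
    using supp_mult[of "u ^ n" u] by (simp add: mult.commute)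
  also have "\<dots> \<subseteq> shift {0} (supp u) n + supp u"
    using Suc by (rule set_plus_mono2) simp
  finally show ?case by (simp add: shift_Suc_eq)
qed

section \<open>Composition with near-identity series\<close>

text \<open>Exponents in \<open>D\<close> are the possible changes of exponents under the derivation \<open>dd\<close>;
  \<open>one\<close> is the exponent of the variable \<open>z\<close>.\<close>

locale hahn_derivation =
  fixes dd :: "'e::linordered_ab_group_add hahn \<Rightarrow> 'e hahn" and D :: "'e set" and one :: 'e
  assumes dd_add: "dd (x + y) = dd x + dd y"
    and dd_mult: "dd (x * y) = dd x * y + x * dd y"
    and wo_D: "wo D" and D_ge: "d \<in> D \<Longrightarrow> - one \<le> d"
    and supp_dd: "supp (dd x) \<subseteq> supp x + D"
    and dd_hsum: "summ F \<Longrightarrow> dd (hsum F) = hsum (\<lambda>i. dd (F i))"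
    and dd_z: "dd (hmonom 1 one) = 1"
begin

definition z :: "'e hahn" where "z = hmonom 1 one"

lemma dd_0 [simp]: "dd 0 = 0"
  using dd_add[of 0 0] by simp

lemma dd_minus: "dd (- x) = - dd x"
  using dd_add[of x "- x"] by (simp add: eq_neg_iff_add_eq_0 add.commute)

lemma dd_diff: "dd (x - y) = dd x - dd y"
  using dd_add[of x "- y"] by (simp add: dd_minus)

lemma dd_sum: "dd (sum f A) = (\<Sum>i\<in>A. dd (f i))"
  by (induction A rule: infinite_finite_induct) (auto simp: dd_add)

lemma dd_1 [simp]: "dd 1 = 0"
  using dd_mult[of 1 1] by simp

lemma dd_of_nat [simp]: "dd (of_nat n) = 0"
  by (induction n) (auto simp: dd_add)

lemma dd_fact [simp]: "dd (fact n) = 0"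
  using dd_of_nat[of "fact n"] by (simp add: of_nat_fact)

lemma dd_divide_fact: "dd (x / fact n) = dd x / fact n"
proof -
  have "dd x = dd (x / fact n * fact n)" by simp
  also have "\<dots> = dd (x / fact n) * fact n" by (subst dd_mult) simp
  finally show ?thesis by simp
qed

lemma dd_inverse: "x \<noteq> 0 \<Longrightarrow> dd (inverse x) = - dd x / x ^ 2"
proof -
  assume x: "x \<noteq> 0"
  then have "dd x * inverse x + x * dd (inverse x) = 0"
    using dd_mult[of x "inverse x"] by simp
  then have "x * dd (inverse x) = - (dd x * inverse x)"
    by (simp only: eq_neg_iff_add_eq_0 add.commute)
  then have "inverse x * (x * dd (inverse x)) = - (dd x * inverse x) * inverse x" by simp
  then show ?thesis using x by (simp add: power2_eq_square divide_inverse mult.assoc[symmetric])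
qed

lemma ddn_0 [simp]: "(dd ^^ n) 0 = 0"
  by (induction n) auto

lemma ddn_add: "(dd ^^ n) (x + y) = (dd ^^ n) x + (dd ^^ n) y"
  by (induction n) (auto simp: dd_add)

lemma ddn_diff: "(dd ^^ n) (x - y) = (dd ^^ n) x - (dd ^^ n) y"
  by (induction n) (auto simp: dd_diff)

lemma ddn_divide_fact: "(dd ^^ n) (x / fact m) = (dd ^^ n) x / fact m"
  by (induction n) (auto simp: dd_divide_fact)

lemma supp_ddn: "supp ((dd ^^ n) x) \<subseteq> shift (supp x) D n"
proof (induction n)
  case (Suc n)
  have "supp ((dd ^^ Suc n) x) \<subseteq> supp ((dd ^^ n) x) + D" using supp_dd by simp
  also have "\<dots> \<subseteq> shift (supp x) D n + D" using Suc by (rule set_plus_mono2) simp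
  finally show ?case by (simp add: shift_Suc_eq)
qed simp

lemma vge_dd: "vge x e \<Longrightarrow> vge (dd x) (e - one)"
  unfolding vge_iff
proof
  fix d assume x: "\<forall>d\<in>supp x. e \<le> d" and "d \<in> supp (dd x)"
  then obtain p q where "d = p + q" "p \<in> supp x" "q \<in> D"
    using supp_dd[of x] by (meson set_plus_elim subsetD)
  then show "e - one \<le> d" using add_mono[of e p "- one" q] x D_ge by simp
qed

lemma vgt_dd: "vgt x e \<Longrightarrow> vgt (dd x) (e - one)"
  unfolding vgt_iff
proof
  fix d assume x: "\<forall>d\<in>supp x. e < d" and "d \<in> supp (dd x)"
  then obtain p q where "d = p + q" "p \<in> supp x" "q \<in> D"
    using supp_dd[of x] by (meson set_plus_elim subsetD)
  then show "e - one < d" using add_less_le_mono[of e p "- one" q] x D_ge by simp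
qed

lemma vge_ddn: "vge x e \<Longrightarrow> vge ((dd ^^ n) x) (e - nmul n one)"
proof (induction n)
  case (Suc n)
  then show ?case using vge_dd[of "(dd ^^ n) x" "e - nmul n one"] by (simp add: algebra_simps)
qed simp

lemma vgt_ddn: "vgt x e \<Longrightarrow> vgt ((dd ^^ n) x) (e - nmul n one)"
proof (induction n)
  case (Suc n)
  then show ?case using vgt_dd[of "(dd ^^ n) x" "e - nmul n one"] by (simp add: algebra_simps)
qed simp

subsection \<open>Taylor series\<close>

text \<open>Divided powers of the derivation: Leibniz' rule loses its binomial coefficients
  (\<open>dv_mult\<close>), and they appear instead in iterates (\<open>dv_dv\<close>).\<close>

definition dv :: "nat \<Rightarrow> 'e hahn \<Rightarrow> 'e hahn"
  where "dv n x = (dd ^^ n) x / fact n"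

lemma dv_0 [simp]: "dv 0 x = x"
  by (simp add: dv_def)

lemma of_nat_dv_Suc: "of_nat (Suc n) * dv (Suc n) x = dd (dv n x)"
  by (simp add: dv_def dd_divide_fact del: of_nat_Suc)

lemma dv_mult: "dv n (x * y) = (\<Sum>i\<le>n. dv i x * dv (n - i) y)"
proof (induction n)
  case (Suc n)
  let ?a = "\<lambda>i. dv i x" and ?b = "\<lambda>i. dv i y"
  \<comment> \<open>The identity is proved after multiplication by n + 1, which splits as i + (n + 1
    - i) between the two sums and can be cancelled in characteristic 0.\<close>
  have "of_nat (Suc n) * dv (Suc n) (x * y) = dd (\<Sum>i\<le>n. ?a i * ?b (n - i))"
    by (simp only: of_nat_dv_Suc Suc)
  also have "\<dots> = (\<Sum>i\<le>n. of_nat (Suc i) * ?a (Suc i) * ?b (n - i)) +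
      (\<Sum>i\<le>n. of_nat (Suc (n - i)) * ?a i * ?b (Suc (n - i)))"
    unfolding dd_sum dd_mult of_nat_dv_Suc[symmetric]
    by (simp only: sum.distrib mult_ac)
  also have "(\<Sum>i\<le>n. of_nat (Suc i) * ?a (Suc i) * ?b (n - i)) =
      (\<Sum>i\<le>Suc n. of_nat i * ?a i * ?b (Suc n - i))"
    by (simp add: sum.atMost_Suc_shift del: sum.atMost_Suc of_nat_Suc)
  also have "(\<Sum>i\<le>n. of_nat (Suc (n - i)) * ?a i * ?b (Suc (n - i))) =
      (\<Sum>i\<le>Suc n. of_nat (Suc n - i) * ?a i * ?b (Suc n - i))"
    by (simp add: Suc_diff_le del: of_nat_Suc of_nat_diff)
  also have "(\<Sum>i\<le>Suc n. of_nat i * ?a i * ?b (Suc n - i)) +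
      (\<Sum>i\<le>Suc n. of_nat (Suc n - i) * ?a i * ?b (Suc n - i)) =
      (\<Sum>i\<le>Suc n. of_nat (Suc n) * (?a i * ?b (Suc n - i)))"
    unfolding sum.distrib[symmetric]
  proof (rule sum.cong[OF refl])
    fix i assume "i \<in> {..Suc n}"
    then have "(of_nat (Suc n) :: 'e hahn) = of_nat i + of_nat (Suc n - i)"
      by (simp only: of_nat_add[symmetric]) simp
    then show "of_nat i * ?a i * ?b (Suc n - i) + of_nat (Suc n - i) * ?a i * ?b (Suc n - i) =
        of_nat (Suc n) * (?a i * ?b (Suc n - i))"
      by (simp only: distrib_right mult.assoc)
  qed
  also have "\<dots> = of_nat (Suc n) * (\<Sum>i\<le>Suc n. ?a i * ?b (Suc n - i))"
    by (simp only: sum_distrib_left)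
  finally show ?case by (simp only: mult_cancel_left of_nat_eq_0_iff) simp
qed simp

lemma dv_dv: "dv j (dv i x) = of_nat ((i + j) choose i) * dv (i + j) x"
proof -
  have "(dd ^^ j) ((dd ^^ i) x) = (dd ^^ (i + j)) x"
    by (simp add: funpow_add add.commute[of i j])
  moreover have "(of_nat ((i + j) choose i) :: 'e hahn) = fact (i + j) / (fact i * fact j)"
    using binomial_fact[of i "i + j", where 'a = "'e hahn"] by simp
  ultimately show ?thesis by (simp add: dv_def ddn_divide_fact)
qed

definition tay :: "'e hahn \<Rightarrow> 'e hahn \<Rightarrow> nat \<Rightarrow> 'e hahn"
  where "tay u f i = dv i f * u ^ i"

definition comp :: "'e hahn \<Rightarrow> 'e hahn \<Rightarrow> 'e hahn"
  where "comp u f = hsum (tay u f)"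

text \<open>If \<open>A\<close> is the derivative of f, then \<open>u * (A + taylor_rem u A)\<close>
  is f \<circ> (z + u) - f, see \<open>comp_decomp\<close>. Only \<open>A\<close> and its
  derivatives occur, so it makes sense in a field that contains \<open>A\<close> but not f.\<close>

definition taylor_rem :: "'e hahn \<Rightarrow> 'e hahn \<Rightarrow> 'e hahn"
  where "taylor_rem u A = hsum (\<lambda>i. (dd ^^ Suc i) A * u ^ Suc i / fact (Suc (Suc i)))"

text \<open>One differentiation together with one factor \<open>u\<close>. The derivation lowers
  exponents by at most \<open>one\<close> and \<open>u\<close> has order above \<open>one\<close>,
  so the combined increments are positive, as Neumann's lemma demands.\<close>

definition incr :: "'e hahn \<Rightarrow> 'e set"
  where "incr u = D + supp u"

lemma wo_incr: "wo (incr u)"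
  by (simp add: incr_def wo_plus wo_D)

lemma incr_pos: "vgt u one \<Longrightarrow> p \<in> incr u \<Longrightarrow> 0 < p"
  unfolding incr_def vgt_iff
  using D_ge add_le_less_mono[of "- one" _ one] by (auto elim!: set_plus_elim)

lemma supp_ddn_power: "supp ((dd ^^ i) f * u ^ i) \<subseteq> shift (supp f) (incr u) i"
proof -
  have "supp ((dd ^^ i) f * u ^ i) \<subseteq> supp ((dd ^^ i) f) + supp (u ^ i)" by (rule supp_mult)
  also have "\<dots> \<subseteq> shift (supp f) D i + shift {0} (supp u) i"
    by (rule set_plus_mono2[OF supp_ddn supp_power])
  finally show ?thesis by (simp add: shift_plus_pairwise incr_def)
qed

lemma supp_tay: "supp (tay u f i) \<subseteq> shift (supp f) (incr u) i"
  using supp_ddn_power[of i f u] by (simp add: tay_def dv_def)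

context
  fixes u assumes u: "vgt u one"
begin

lemma summ_of_supp: "(\<And>i. supp (F i) \<subseteq> shift (supp f) (incr u) i) \<Longrightarrow> summ F"
  by (rule summ_shift[OF wo_supp wo_incr incr_pos[OF u]])

lemma summ_tay: "summ (tay u f)"
  by (rule summ_of_supp[OF supp_tay])

lemma comp_add: "comp u (f + g) = comp u f + comp u g"
  unfolding comp_def hsum_add[OF summ_tay summ_tay, symmetric]
  by (rule arg_cong[where f = hsum]) (simp add: fun_eq_iff tay_def dv_def ddn_add add_divide_distrib distrib_right)

lemma comp_diff: "comp u (f - g) = comp u f - comp u g"
  unfolding comp_def hsum_diff[OF summ_tay summ_tay, symmetric]
  by (rule arg_cong[where f = hsum]) (simp add: fun_eq_iff tay_def dv_def ddn_diff diff_divide_distrib left_diff_distrib)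

lemma comp_mult: "comp u (f * g) = comp u f * comp u g"
proof -
  let ?F = "\<lambda>i j. tay u f i * tay u g j"
  have supp: "supp (?F i j) \<subseteq> shift (supp f + supp g) (incr u) (i + j)" for i j
  proof -
    have "supp (?F i j) \<subseteq> supp (tay u f i) + supp (tay u g j)" by (rule supp_mult)
    also have "\<dots> \<subseteq> shift (supp f) (incr u) i + shift (supp g) (incr u) j"
      by (rule set_plus_mono2[OF supp_tay supp_tay])
    finally show ?thesis using shift_plus by blast
  qed
  have "comp u (f * g) = hsum (\<lambda>n. \<Sum>i\<le>n. ?F i (n - i))"
    unfolding comp_def
  proof (rule arg_cong[where f = hsum], rule ext)
    fix n
    have "u ^ n = u ^ i * u ^ (n - i)" if "i \<le> n" for i
      using that by (simp add: power_add[symmetric])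
    then show "tay u (f * g) n = (\<Sum>i\<le>n. ?F i (n - i))"
      unfolding tay_def dv_mult sum_distrib_right by (intro sum.cong) (auto simp: mult_ac)
  qed
  also have "\<dots> = hsum (\<lambda>i. hsum (?F i))"
    by (rule hsum_triangle[symmetric, OF _ wo_incr incr_pos[OF u] supp]) (simp add: wo_plus)
  also have "\<dots> = hsum (\<lambda>i. comp u g * tay u f i)"
    by (simp add: hsum_mult[OF summ_tay] comp_def mult.commute)
  also have "\<dots> = comp u g * comp u f"
    unfolding comp_def[of u f] by (rule hsum_mult[OF summ_tay])
  also have "\<dots> = comp u f * comp u g" by (rule mult.commute)
  finally show ?thesis .
qed

lemma supp_rem_term:
  "supp ((dd ^^ i) A * u ^ i / fact m) \<subseteq> shift (supp A) (incr u) i"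
  using supp_ddn_power[of i A u] by simp

lemma summ_rem: "summ (\<lambda>i. (dd ^^ Suc i) A * u ^ Suc i / fact (Suc (Suc i)))"
  by (rule summ_Suc[of "\<lambda>i. (dd ^^ i) A * u ^ i / fact (Suc i)", OF summ_of_supp])
    (rule supp_rem_term)

lemma comp_decomp: "comp u f = f + u * (dd f + taylor_rem u (dd f))"
proof -
  let ?G = "\<lambda>i. (dd ^^ i) (dd f) * u ^ i / fact (Suc i)"
  have G: "summ ?G" by (rule summ_of_supp) (rule supp_rem_term)
  have "comp u f = f + hsum (\<lambda>i. tay u f (Suc i))"
    unfolding comp_def by (subst hsum_Suc[OF summ_tay]) (simp add: tay_def)
  also have "(\<lambda>i. tay u f (Suc i)) = (\<lambda>i. u * ?G i)"
    by (rule ext) (simp add: tay_def dv_def funpow_swap1 mult_ac)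
  also have "hsum \<dots> = u * hsum ?G" by (rule hsum_mult[OF G])
  also have "hsum ?G = dd f + taylor_rem u (dd f)"
    unfolding taylor_rem_def by (subst hsum_Suc[OF G]) simp
  finally show ?thesis .
qed

lemma taylor_rem_0 [simp]: "taylor_rem u 0 = 0"
  unfolding taylor_rem_def ddn_0 by simp

lemma taylor_rem_diff: "taylor_rem u (A - B) = taylor_rem u A - taylor_rem u B"
  unfolding taylor_rem_def hsum_diff[OF summ_rem summ_rem, symmetric]
  by (simp only: ddn_diff left_diff_distrib diff_divide_distrib)

lemma comp_const: "dd c = 0 \<Longrightarrow> comp u c = c"
  by (simp add: comp_decomp)

lemma comp_power: "comp u (f ^ n) = comp u f ^ n"
  by (induction n) (auto simp: comp_mult comp_const)

lemma comp_z: "comp u z = z + u"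
  by (simp add: comp_decomp z_def dd_z) (simp add: taylor_rem_def funpow_Suc_right del: funpow.simps)

text \<open>In each term \<open>i + 1\<close> differentiations are outweighed by
  \<open>i + 1\<close> factors \<open>u\<close>. This gain of order makes the maps used for inverses
  and for Abel's equation contracting.\<close>

lemma vgt_taylor_rem:
  assumes "vge A e"
  shows "vgt (taylor_rem u A) e"
  unfolding taylor_rem_def
proof (rule vgt_hsum[OF summ_rem])
  fix i
  show "vgt ((dd ^^ Suc i) A * u ^ Suc i / fact (Suc (Suc i))) e"
    using vgt_mult_right[OF vge_ddn[OF assms, of "Suc i"] vgt_power[OF u, of i]]
    by (simp del: funpow.simps power_Suc nmul.simps fact_Suc)
qed

lemma vgt_comp_diff:
  assumes "vge f e"
  shows "vgt (comp u f - f) e"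
proof -
  have "vge (dd f + taylor_rem u (dd f)) (e - one)"
    using vge_dd[OF assms] by (intro vge_add vgt_imp_vge[OF vgt_taylor_rem])
  from vgt_mult_left[OF u this] show ?thesis by (simp add: comp_decomp)
qed

end

text \<open>The bound by \<open>shift V P i\<close> controls the double family of Taylor terms by
  total degree, so that the two sums can be exchanged.\<close>

lemma comp_hsum:
  assumes u: "vgt u one" and V: "wo V" and P: "wo P" "\<And>p. p \<in> P \<Longrightarrow> 0 < p"
    and F: "\<And>i. supp (F i) \<subseteq> shift V P i"
  shows "comp u (hsum F) = hsum (\<lambda>i. comp u (F i))"
proof -
  let ?Q = "P \<union> incr u"
  have Q: "wo ?Q" "\<And>p. p \<in> ?Q \<Longrightarrow> 0 < p"
    using P wo_incr incr_pos[OF u] by (auto intro: wo_Un)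
  have F': "summ F" by (rule summ_shift[OF V P F])
  have inner: "summ (\<lambda>i. (dd ^^ j) (F i)) \<and> hsum (\<lambda>i. (dd ^^ j) (F i)) = (dd ^^ j) (hsum F)" for j
  proof (induction j)
    case (Suc j)
    have *: "supp (dd ((dd ^^ j) (F i))) \<subseteq> shift (shift V D (Suc j)) P i" for i
    proof -
      have "supp ((dd ^^ Suc j) (F i)) \<subseteq> shift (supp (F i)) D (Suc j)" by (rule supp_ddn)
      also have "\<dots> \<subseteq> shift (shift V P i) D (Suc j)" by (rule shift_mono[OF F]) simp
      also have "\<dots> = shift (shift V D (Suc j)) P i"
        by (rule shift_commute)
      finally show ?thesis by simp
    qed
    have "wo (shift V D n)" for n
      by (induction n) (auto simp: V shift_Suc_eq wo_plus wo_D)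
    from summ_shift[OF this P *] Suc show ?case
      using dd_hsum[of "\<lambda>i. (dd ^^ j) (F i)"] by simp
  qed (use F' in simp)
  have supp: "supp (tay u (F i) j) \<subseteq> shift V ?Q (i + j)" for i j
  proof -
    have "supp (tay u (F i) j) \<subseteq> shift (supp (F i)) (incr u) j" by (rule supp_tay)
    also have "\<dots> \<subseteq> shift (shift V P i) (incr u) j" by (rule shift_mono[OF F]) simp
    also have "\<dots> \<subseteq> shift (shift V ?Q i) ?Q j" by (intro shift_mono) auto
    finally show ?thesis by (simp add: shift_shift)
  qed
  have "comp u (hsum F) = hsum (\<lambda>j. hsum (\<lambda>i. tay u (F i) j))"
    unfolding comp_def
  proof (rule arg_cong[where f = hsum], rule ext)
    fix j
    have "tay u (hsum F) j = (u ^ j / fact j) * hsum (\<lambda>i. (dd ^^ j) (F i))"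
      using inner[of j] by (simp add: tay_def dv_def)
    also have "\<dots> = hsum (\<lambda>i. (u ^ j / fact j) * (dd ^^ j) (F i))"
      by (rule hsum_mult[symmetric]) (use inner in blast)
    finally show "tay u (hsum F) j = hsum (\<lambda>i. tay u (F i) j)"
      by (simp add: tay_def dv_def mult_ac)
  qed
  also have "\<dots> = hsum (\<lambda>i. comp u (F i))"
    unfolding comp_def by (rule hsum_swap[symmetric, OF V Q supp])
  finally show ?thesis .
qed

lemma vgt_comp: "vgt u one \<Longrightarrow> vgt w e \<Longrightarrow> vgt (comp u w) e"
  using vgt_add[OF vgt_comp_diff[of u w e], of w] by (simp add: vgt_imp_vge)

text \<open>With v = \<open>comp u w\<close>, multiplicativity of composition turns the left side
  into the double sum of f^(i+j) u^j v^i / (i! j!); by the binomial theorem its diagonals are the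
  Taylor terms for u + v.\<close>

lemma comp_comp:
  assumes u: "vgt u one" and w: "vgt w one"
  shows "comp u (comp w f) = comp (u + comp u w) f"
proof -
  let ?v = "comp u w"
  let ?F = "\<lambda>i j. dv j (dv i f) * u ^ j * ?v ^ i"
  let ?P = "incr u \<union> incr ?v"
  have v: "vgt ?v one" by (rule vgt_comp[OF u w])
  have P: "wo ?P" "\<And>p. p \<in> ?P \<Longrightarrow> 0 < p"
    using wo_incr incr_pos[OF u] incr_pos[OF v] by (auto intro: wo_Un)
  have supp: "supp (?F i j) \<subseteq> shift (supp f) ?P (i + j)" for i j
  proof -
    have "supp (dv j (dv i f) * u ^ j * ?v ^ i) \<subseteq>
        supp (dv j (dv i f)) + supp (u ^ j) + supp (?v ^ i)"
      using supp_mult set_plus_mono2[OF supp_mult subset_refl] by blast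
    also have "\<dots> \<subseteq> shift (shift (supp f) D i) D j + shift {0} (supp u) j + shift {0} (supp ?v) i"
    proof (intro set_plus_mono2 supp_power)
      have "supp (dv j (dv i f)) \<subseteq> shift (supp (dv i f)) D j"
        using supp_ddn[of j "dv i f"] by (simp add: dv_def)
      also have "\<dots> \<subseteq> shift (shift (supp f) D i) D j"
        using supp_ddn[of i f] by (intro shift_mono) (simp_all add: dv_def)
      finally show "supp (dv j (dv i f)) \<subseteq> shift (shift (supp f) D i) D j" .
    qed
    \<comment> \<open>The first \<open>i\<close> differentiations are paired with the factors
      \<open>?v\<close> and the other \<open>j\<close> with the factors \<open>u\<close>, which
      leaves positive increments only.\<close>
    also have "\<dots> = shift (shift (supp f) (incr ?v) i) (incr u) j"
    proof -
      have "shift (shift (supp f) D i) D j + shift {0} (supp u) j + shift {0} (supp ?v) i =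
        shift (shift (shift (shift (supp f) D i) D j) (supp u) j) (supp ?v) i"
        using shift_eq_plus[of "shift (shift (supp f) D i) D j" "supp u" j]
          shift_eq_plus[of "shift (shift (shift (supp f) D i) D j) (supp u) j" "supp ?v" i] by simp
      also have "\<dots> = shift (shift (shift (supp f) D i) (D + supp u) j) (supp ?v) i"
        by (simp only: shift_shift_same)
      also have "\<dots> = shift (shift (shift (supp f) D i) (supp ?v) i) (D + supp u) j"
        by (rule shift_commute)
      also have "\<dots> = shift (shift (supp f) (incr ?v) i) (incr u) j"
        by (simp only: shift_shift_same incr_def)
      finally show ?thesis .
    qed
    also have "\<dots> \<subseteq> shift (shift (supp f) ?P i) ?P j" by (intro shift_mono) auto
    finally show ?thesis by (simp add: shift_shift)
  qed
  have "comp u (comp w f) = hsum (\<lambda>i. comp u (tay w f i))"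
    unfolding comp_def[of w] by (rule comp_hsum[OF u wo_supp wo_incr incr_pos[OF w] supp_tay])
  also have "(\<lambda>i. comp u (tay w f i)) = (\<lambda>i. hsum (?F i))"
  proof
    fix i
    have "comp u (tay w f i) = ?v ^ i * comp u (dv i f)"
      by (simp add: tay_def comp_mult[OF u] comp_power[OF u])
    also have "\<dots> = hsum (\<lambda>j. ?v ^ i * tay u (dv i f) j)"
      unfolding comp_def[of u "dv i f"] by (rule hsum_mult[symmetric, OF summ_tay[OF u]])
    finally show "comp u (tay w f i) = hsum (?F i)" by (simp add: tay_def mult_ac)
  qed
  also have "hsum (\<lambda>i. hsum (?F i)) = hsum (\<lambda>n. \<Sum>i\<le>n. ?F i (n - i))"
    by (rule hsum_triangle[OF wo_supp P supp])
  also have "(\<lambda>n. \<Sum>i\<le>n. ?F i (n - i)) = tay (u + ?v) f"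
  proof
    fix n
    have "(\<Sum>i\<le>n. ?F i (n - i)) = (\<Sum>i\<le>n. dv n f * (of_nat (n choose i) * ?v ^ i * u ^ (n - i)))"
      by (rule sum.cong) (auto simp: dv_dv mult_ac)
    also have "\<dots> = dv n f * (?v + u) ^ n"
      by (simp only: binomial_ring sum_distrib_left)
    finally show "(\<Sum>i\<le>n. ?F i (n - i)) = tay (u + ?v) f n"
      by (simp add: tay_def add.commute)
  qed
  finally show ?thesis by (simp add: comp_def)
qed

end


text \<open>The antiderivative is allowed to leave the subfield, because integration may create a
  new logarithm; the derivation \<open>dd\<close> is defined there too.\<close>

locale derivation_subfield = hahn_derivation dd D one + exponent_group G
  for dd :: "'e::linordered_ab_group_add hahn \<Rightarrow> 'e hahn" and D one G +
  assumes dd_on: "x \<in> hahn_on G \<Longrightarrow> dd x \<in> hahn_on G"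
    and antiderivative: "x \<in> hahn_on G \<Longrightarrow> \<exists>y. dd y = x"
begin

lemma ddn_on: "x \<in> hahn_on G \<Longrightarrow> (dd ^^ n) x \<in> hahn_on G"
  by (induction n) (auto intro: dd_on)

lemma divide_fact_on: "x \<in> hahn_on G \<Longrightarrow> x / fact n \<in> hahn_on G"
  using hahn_on_divide[of x "fact n"] hahn_on_of_nat[of "fact n"] by (simp add: of_nat_fact)

lemma taylor_rem_on:
  "vgt u one \<Longrightarrow> u \<in> hahn_on G \<Longrightarrow> A \<in> hahn_on G \<Longrightarrow> taylor_rem u A \<in> hahn_on G"
  unfolding taylor_rem_def
  by (intro hahn_on_hsum summ_rem divide_fact_on hahn_on_mult hahn_on_power ddn_on)

lemma comp_diff_on:
  "vgt u one \<Longrightarrow> u \<in> hahn_on G \<Longrightarrow> dd f \<in> hahn_on G \<Longrightarrow> comp u f - f \<in> hahn_on G"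
  by (simp add: comp_decomp hahn_on_mult hahn_on_add taylor_rem_on)

lemma comp_on: "vgt u one \<Longrightarrow> u \<in> hahn_on G \<Longrightarrow> f \<in> hahn_on G \<Longrightarrow> comp u f \<in> hahn_on G"
  using hahn_on_add[OF comp_diff_on[of u f], of f] by (simp add: dd_on)

subsection \<open>The group of near-identity series\<close>

text \<open>(z + w) \<circ> (z + u) is z + u + \<open>comp u w\<close>. Since \<open>comp u\<close>
  changes a series only at higher order, w - u - \<open>comp u w\<close> contracts in w; restricting
  exponents to those above \<open>one\<close> keeps the fixed point near the identity.\<close>

lemma left_inverse_exists:
  assumes u: "vgt u one" "u \<in> hahn_on G"
  shows "\<exists>w\<in>hahn_on G. vgt w one \<and> u + comp u w = 0"
proof -
  let ?G = "{e \<in> G. one < e}"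
  have on: "w \<in> hahn_on ?G \<longleftrightarrow> w \<in> hahn_on G \<and> vgt w one" for w
    by (auto simp: hahn_on_def vgt_iff)
  obtain w where "w \<in> hahn_on ?G" "w - u - comp u w = w"
  proof (rule hahn_fixed_point[of ?G "\<lambda>w. w - u - comp u w"])
    fix w assume "w \<in> hahn_on ?G"
    then show "w - u - comp u w \<in> hahn_on ?G"
      using u by (auto simp: on intro!: hahn_on_diff vgt_diff comp_on vgt_comp)
  next
    fix x y :: "'e hahn" and e assume "vge (x - y) e"
    then have "vgt (- (comp u (x - y) - (x - y))) e"
      using vgt_comp_diff[OF u(1)] by (subst vgt_minus)
    then show "vgt (x - u - comp u x - (y - u - comp u y)) e"
      by (simp add: comp_diff[OF u(1)] algebra_simps)
  qed
  then show ?thesis by (auto simp: on algebra_simps)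
qed

lemma inverse_exists:
  assumes u: "vgt u one" "u \<in> hahn_on G"
  obtains w where "w \<in> hahn_on G" "vgt w one" "u + comp u w = 0" "w + comp w u = 0"
proof -
  obtain w where w: "w \<in> hahn_on G" "vgt w one" "u + comp u w = 0"
    using left_inverse_exists[OF u] by blast
  obtain v where v: "vgt v one" "w + comp w v = 0"
    using left_inverse_exists[OF w(2,1)] by blast
  have c0: "comp 0 f = f" for f by (simp add: comp_decomp)
  have uw: "comp u (comp w f) = f" for f
    using comp_comp[OF u(1) w(2), of f] w(3) by (simp add: c0)
  have wv: "comp w (comp v f) = f" for f
    using comp_comp[OF w(2) v(1), of f] v(2) by (simp add: c0)
  \<comment> \<open>The left inverse \<open>v\<close> of the left inverse \<open>w\<close> gives
    back the original series, so \<open>w\<close> is two-sided.\<close>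
  have "comp u z = comp u (comp w (comp v z))"
    by (simp only: wv)
  also have "\<dots> = comp v z" by (rule uw)
  finally have "comp w (comp u z) = z" by (simp only: wv)
  then have "w + comp w u = 0"
    by (simp add: comp_z[OF u(1)] comp_add[OF w(2)] comp_z[OF w(2)] add.assoc)
  with w show ?thesis using that by blast
qed

subsection \<open>Abel's equation\<close>

definition abel :: "'e hahn \<Rightarrow> 'e hahn \<Rightarrow> bool"
  where "abel u A \<longleftrightarrow> A \<in> hahn_on G \<and> A + taylor_rem u A = 1 / u"

lemma abel_exists:
  assumes u: "vgt u one" "u \<in> hahn_on G"
  obtains A where "abel u A"
proof -
  obtain A where "A \<in> hahn_on G" "1 / u - taylor_rem u A = A"
  proof (rule hahn_fixed_point[of G "\<lambda>A. 1 / u - taylor_rem u A"])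
    fix A assume "A \<in> hahn_on G"
    then show "1 / u - taylor_rem u A \<in> hahn_on G"
      using u by (intro hahn_on_diff hahn_on_divide hahn_on_1 taylor_rem_on)
  next
    fix x y :: "'e hahn" and e assume "vge (x - y) e"
    then have "vgt (- taylor_rem u (x - y)) e"
      using vgt_taylor_rem[OF u(1)] by (subst vgt_minus)
    then show "vgt (1 / u - taylor_rem u x - (1 / u - taylor_rem u y)) e"
      by (simp add: taylor_rem_diff[OF u(1)])
  qed
  then have "abel u A" by (simp add: abel_def algebra_simps)
  then show ?thesis using that by blast
qed

lemma comp_abel:
  assumes "vgt u one" "u \<noteq> 0" "abel u (dd f)"
  shows "comp u f = f + 1"
  using assms by (simp add: comp_decomp abel_def)

text \<open>Invariance equates f' with minus its own Taylor remainder, which has larger order than a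
  nonzero f'.\<close>

lemma comp_fixed_imp_const:
  assumes u: "vgt u one" "u \<noteq> 0" and f: "comp u f = f"
  shows "dd f = 0"
proof (rule hahn_eq_0_iff_vgt)
  fix e assume "vge (dd f) e"
  then have "vgt (- taylor_rem u (dd f)) e" using vgt_taylor_rem[OF u(1)] by simp
  moreover have "dd f = - taylor_rem u (dd f)"
    using f u by (simp add: comp_decomp eq_neg_iff_add_eq_0)
  ultimately show "vgt (dd f) e" by simp
qed

text \<open>After \<open>h - k\<close> is split off, \<open>i + 1\<close> factors of order above
  \<open>one\<close> outweigh the \<open>i + 1\<close> differentiations of \<open>A\<close>. So the
  linear term \<open>(h - k) * A\<close> governs a change of argument.\<close>

lemma vgt_taylor_diff:
  assumes h: "vgt h one" and k: "vgt k one" and A: "vge A a" and hk: "vge (h - k) d"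
  shows "vgt (h * taylor_rem h A - k * taylor_rem k A) (d + a)"
proof -
  let ?T = "\<lambda>h i. (dd ^^ Suc i) A * h ^ Suc i / fact (Suc (Suc i))"
  have "vgt (h * ?T h i - k * ?T k i) (d + a)" for i
  proof -
    have "vgt ((dd ^^ Suc i) A * (h ^ Suc (Suc i) - k ^ Suc (Suc i))) (a - nmul (Suc i) one + (d + nmul (Suc i) one))"
      by (rule vgt_mult_right[OF vge_ddn[OF A] vgt_power_diff'[OF h k hk]])
    then have "vgt ((dd ^^ Suc i) A * (h ^ Suc (Suc i) - k ^ Suc (Suc i)) / fact (Suc (Suc i))) (d + a)"
      by (simp only: vgt_divide_fact) (simp add: algebra_simps del: funpow.simps nmul.simps)
    moreover have "h * ?T h i - k * ?T k i =
        (dd ^^ Suc i) A * (h ^ Suc (Suc i) - k ^ Suc (Suc i)) / fact (Suc (Suc i))"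
      by (simp only: power_Suc[of _ "Suc i"] diff_divide_distrib right_diff_distrib
          times_divide_eq_right mult_ac)
    ultimately show ?thesis by simp
  qed
  then show ?thesis
    unfolding taylor_rem_def hsum_mult[OF summ_rem[OF h], symmetric] hsum_mult[OF summ_rem[OF k], symmetric]
      hsum_diff[OF summ_mult[OF summ_rem[OF h]] summ_mult[OF summ_rem[OF k]], symmetric]
    by (intro vgt_hsum summ_diff summ_mult summ_rem h k)
qed

lemma comp_inj:
  assumes h: "vgt h one" and k: "vgt k one" and f: "dd f \<noteq> 0" and eq: "comp h f = comp k f"
  shows "h = k"
proof (rule ccontr)
  assume "h \<noteq> k"
  then obtain d where d: "vge (h - k) d" "coeff (h - k) d \<noteq> 0"
    using hahn_order[of "h - k"] by auto
  obtain a where a: "vge (dd f) a" "coeff (dd f) a \<noteq> 0" using hahn_order[OF f] .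
  have "(h - k) * dd f = - (h * taylor_rem h (dd f) - k * taylor_rem k (dd f))"
    using eq by (simp add: comp_decomp[OF h] comp_decomp[OF k] algebra_simps)
  moreover have "vgt \<dots> (d + a)"
    using vgt_taylor_diff[OF h k a(1) d(1)] by (subst vgt_minus)
  ultimately have "coeff ((h - k) * dd f) (d + a) = 0" by (simp add: vgt_iff_vge)
  then show False using coeff_mult_lead[OF d(1) a(1)] d(2) a(2) by simp
qed

text \<open>Dividing h (f' + remainder) = r by f' gives a contracting map for h. The bound on
  \<open>r\<close> says that r / f' has order above \<open>one\<close>.\<close>

lemma comp_shift_solve:
  assumes f: "dd f \<in> hahn_on G" "vge (dd f) a" "coeff (dd f) a \<noteq> 0"
    and r: "r \<in> hahn_on G" "vgt r (one + a)"
  obtains h where "h \<in> hahn_on G" "vgt h one" "comp h f = f + r"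
proof -
  let ?G = "{e \<in> G. one < e}"
  have on: "w \<in> hahn_on ?G \<longleftrightarrow> w \<in> hahn_on G \<and> vgt w one" for w
    by (auto simp: hahn_on_def vgt_iff)
  let ?A = "dd f"
  have A: "?A \<noteq> 0" using f(3) by auto
  have inv: "vge (inverse ?A) (- a)" by (rule hahn_inverse_order[OF f(2,3)])
  obtain h where h: "h \<in> hahn_on ?G" "(r - h * taylor_rem h ?A) / ?A = h"
  proof (rule hahn_fixed_point[of ?G "\<lambda>h. (r - h * taylor_rem h ?A) / ?A"])
    fix h assume "h \<in> hahn_on ?G"
    then have h: "h \<in> hahn_on G" "vgt h one" by (simp_all add: on)
    have "vgt (r - h * taylor_rem h ?A) (one + a)"
      using vgt_taylor_diff[OF h(2) _ f(2), of 0 one] h(2) r(2)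
      by (intro vgt_diff) (auto simp: vgt_imp_vge)
    then have "vgt ((r - h * taylor_rem h ?A) * inverse ?A) (one + a + - a)"
      using inv by (rule vgt_mult_left)
    then show "(r - h * taylor_rem h ?A) / ?A \<in> hahn_on ?G"
      unfolding on using h f(1) r(1)
      by (auto simp: divide_inverse intro!: hahn_on_mult hahn_on_inverse hahn_on_diff taylor_rem_on)
  next
    fix h k e assume "h \<in> hahn_on ?G" "k \<in> hahn_on ?G" and e: "vge (h - k) e"
    then have "vgt h one" "vgt k one" by (simp_all add: on)
    from vgt_mult_left[OF vgt_taylor_diff[OF this f(2) e] inv]
    have "vgt (- ((h * taylor_rem h ?A - k * taylor_rem k ?A) * inverse ?A)) e"
      by (simp only: vgt_minus) simp
    moreover have "(r - h * taylor_rem h ?A) / ?A - (r - k * taylor_rem k ?A) / ?A =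
      - ((h * taylor_rem h ?A - k * taylor_rem k ?A) * inverse ?A)"
      by (simp add: divide_inverse algebra_simps)
    ultimately show "vgt ((r - h * taylor_rem h ?A) / ?A - (r - k * taylor_rem k ?A) / ?A) e"
      by simp
  qed
  have "r = h * (?A + taylor_rem h ?A)"
    using h(2) A by (simp add: divide_eq_eq algebra_simps)
  then have "comp h f = f + r" using h(1) by (simp add: on comp_decomp)
  then show ?thesis by (rule that[rotated 2]) (use h(1) in \<open>simp_all add: on\<close>)
qed

lemma abel_order:
  assumes u: "vgt u one" and e: "vge u e" "coeff u e \<noteq> 0" and A: "abel u A"
  shows "vge A (- e)" "coeff A (- e) = 1 / coeff u e"
proof -
  have eq: "A = inverse u - taylor_rem u A"
    using A by (simp add: abel_def divide_inverse algebra_simps)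
  note inv = hahn_inverse_order[OF e]
  have "inverse u \<noteq> 0" using e(2) by auto
  then have "A \<noteq> 0" using eq by (auto simp: taylor_rem_0[OF u])
  then obtain a where a: "vge A a" "coeff A a \<noteq> 0" by (rule hahn_order)
  have "coeff (taylor_rem u A) a = 0"
    using vgt_taylor_rem[OF u a(1)] by (simp add: vgt_iff_vge)
  then have "coeff (inverse u) a \<noteq> 0"
    using a(2) arg_cong[OF eq, of "\<lambda>x. coeff x a"] by simp
  then have "- e \<le> a" using inv(1) by (auto simp: vge_def not_less[symmetric])
  then show "vge A (- e)" using a(1) by (rule vge_mono[rotated])
  then have "coeff (taylor_rem u A) (- e) = 0"
    using vgt_taylor_rem[OF u] by (simp add: vgt_iff_vge)
  then show "coeff A (- e) = 1 / coeff u e"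
    using inv(2) arg_cong[OF eq, of "\<lambda>x. coeff x (- e)"] by simp
qed

subsection \<open>Conjugacy\<close>

text \<open>\<open>conjby h u w\<close> says that \<open>z + h\<close> conjugates \<open>z + u\<close> to \<open>z + w\<close>.\<close>

definition conjby :: "'e hahn \<Rightarrow> 'e hahn \<Rightarrow> 'e hahn \<Rightarrow> bool"
  where "conjby h u w \<longleftrightarrow> u + comp u h = h + comp h w"

text \<open>\<alpha> and \<beta> \<circ> (z + h) both solve Abel's equation for \<open>u\<close>, so
  their difference is invariant and hence constant. The witness \<beta> \<circ> (z + h) - \<beta>
  lies in the subfield even if \<beta> does not, as it involves only derivatives of \<beta>.\<close>

lemma conjby_imp_abel:
  assumes h: "vgt h one" "h \<in> hahn_on G" and u: "vgt u one" "u \<noteq> 0" and w: "vgt w one" "w \<noteq> 0"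
    and A: "abel u A" and B: "abel w B" "vge B b" and conj: "conjby h u w"
  obtains r where "r \<in> hahn_on G" "vgt r (one + b)" "A - B = dd r"
proof -
  have AB: "A \<in> hahn_on G" "B \<in> hahn_on G" using A B by (auto simp: abel_def)
  obtain \<alpha> \<beta> where dd: "dd \<alpha> = A" "dd \<beta> = B"
    using antiderivative AB by metis
  have ab: "comp u \<alpha> = \<alpha> + 1" "comp w \<beta> = \<beta> + 1"
    using A B u w dd by (auto intro: comp_abel)
  have "comp u (comp h \<beta>) = comp h (comp w \<beta>)"
    using conj by (simp add: comp_comp h u w conjby_def)
  also have "\<dots> = comp h \<beta> + 1"
    by (simp add: ab comp_add[OF h(1)] comp_const[OF h(1)])
  finally have "comp u (\<alpha> - comp h \<beta>) = \<alpha> - comp h \<beta>"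
    by (simp add: comp_diff[OF u(1)] ab)
  then have "dd (\<alpha> - comp h \<beta>) = 0" by (rule comp_fixed_imp_const[OF u])
  then have "A - B = dd (comp h \<beta> - \<beta>)" by (simp add: dd_diff dd)
  moreover have "comp h \<beta> - \<beta> \<in> hahn_on G"
    using h AB(2) by (intro comp_diff_on) (simp_all add: dd)
  moreover have "vgt (comp h \<beta> - \<beta>) (one + b)"
    using vgt_mult_left[OF h(1), of "B + taylor_rem h B" b] B(2) vgt_taylor_rem[OF h(1) B(2)]
    by (simp add: comp_decomp[OF h(1)] dd vge_add vgt_imp_vge)
  ultimately show ?thesis using that by blast
qed

text \<open>Choosing h with \<beta> \<circ> (z + h) = \<beta> + r makes \<beta> \<circ> (z + h)
  equal to \<alpha> up to a constant. Then \<beta> composed with either side of the conjugacy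
  equation gives the same series, and \<open>comp_inj\<close> removes \<beta>.\<close>

lemma abel_imp_conjby:
  assumes u: "vgt u one" "u \<noteq> 0" and w: "vgt w one" "w \<noteq> 0"
    and A: "abel u A" and B: "abel w B" "vge B b" "coeff B b \<noteq> 0"
    and r: "r \<in> hahn_on G" "vgt r (one + b)" "A - B = dd r"
  obtains h where "h \<in> hahn_on G" "vgt h one" "conjby h u w"
proof -
  have AB: "A \<in> hahn_on G" "B \<in> hahn_on G" using A B by (auto simp: abel_def)
  obtain \<alpha> \<beta> where dd: "dd \<alpha> = A" "dd \<beta> = B"
    using antiderivative AB by metis
  have ab: "comp u \<alpha> = \<alpha> + 1" "comp w \<beta> = \<beta> + 1"
    using A B u w dd by (auto intro: comp_abel)
  obtain h where h: "h \<in> hahn_on G" "vgt h one" "comp h \<beta> = \<beta> + r"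
    using comp_shift_solve[of \<beta> b r] AB(2) B r dd by auto
  define c where "c = \<beta> + r - \<alpha>"
  have "dd c = 0" by (simp add: c_def dd_add dd_diff dd r(3)[symmetric])
  then have "comp u c = c" by (rule comp_const[OF u(1)])
  moreover have "comp h \<beta> = \<alpha> + c" by (simp add: h(3) c_def)
  ultimately have "comp u (comp h \<beta>) = comp h \<beta> + 1"
    by (simp add: comp_add[OF u(1)] ab)
  also have "\<dots> = comp h (comp w \<beta>)"
    by (simp add: ab comp_add[OF h(2)] comp_const[OF h(2)])
  finally have "comp (u + comp u h) \<beta> = comp (h + comp h w) \<beta>"
    unfolding comp_comp[OF u(1) h(2)] comp_comp[OF h(2) w(1)] .
  moreover have "dd \<beta> \<noteq> 0" using dd B(3) by auto
  ultimately have "u + comp u h = h + comp h w"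
    using comp_inj[of "u + comp u h" "h + comp h w" \<beta>] h u w by (auto intro: vgt_add vgt_comp)
  then show ?thesis using that h by (simp add: conjby_def)
qed

subsection \<open>Residues\<close>

lemma dd_power: "dd (x ^ Suc n) = of_nat (Suc n) * (dd x * x ^ n)"
proof (induction n)
  case (Suc n)
  have "dd (x ^ Suc (Suc n)) = dd x * x ^ Suc n + x * dd (x ^ Suc n)"
    by (simp only: power_Suc[of x "Suc n"] dd_mult)
  also have "\<dots> = of_nat (Suc (Suc n)) * (dd x * x ^ Suc n)"
    unfolding Suc by (simp add: algebra_simps)
  finally show ?case .
qed simp

lemma coeff_of_nat_mult: "coeff (of_nat n * x) e = of_nat n * coeff x e"
  by (simp add: of_nat_hahn coeff_hmonom_mult)

text \<open>The quotient is the derivative of log (1 + y): it expands into the terms y' (-y)^m, each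
  a rational multiple of the derivative of a power.\<close>

lemma coeff_log_deriv:
  assumes res: "\<And>x. x \<in> hahn_on G \<Longrightarrow> coeff (dd x) r = 0"
    and y: "y \<in> hahn_on G" "vgt y 0"
  shows "coeff (dd y / (1 + y)) r = 0"
proof -
  have S: "summ (\<lambda>m. (- y) ^ m)"
  proof (rule summ_shift[of "{0}" "supp (- y)"])
    show "0 < p" if "p \<in> supp (- y)" for p using y(2) that by (simp add: vgt_iff)
    show "supp ((- y) ^ i) \<subseteq> shift {0} (supp (- y)) i" for i by (rule supp_power)
  qed (auto intro: wo_finite)
  have "hsum (\<lambda>m. (- y) ^ m) = 1 + hsum (\<lambda>m. (- y) * (- y) ^ m)"
    by (subst hsum_Suc[OF S]) simp
  also have "\<dots> = 1 + (- y) * hsum (\<lambda>m. (- y) ^ m)"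
    by (simp only: hsum_mult[OF S])
  finally have "(1 + y) * hsum (\<lambda>m. (- y) ^ m) = 1"
    by (simp add: algebra_simps)
  then have "inverse (1 + y) = hsum (\<lambda>m. (- y) ^ m)" by (rule inverse_unique)
  then have eq: "dd y / (1 + y) = hsum (\<lambda>m. dd y * (- y) ^ m)"
    by (simp add: divide_inverse hsum_mult[OF S])
  have "coeff (dd y * (- y) ^ m) r = 0" for m
  proof -
    have "of_nat (Suc m) * (dd y * (- y) ^ m) = - dd ((- y) ^ Suc m)"
      unfolding dd_power by (simp add: dd_minus)
    then have "of_nat (Suc m) * coeff (dd y * (- y) ^ m) r = coeff (- dd ((- y) ^ Suc m)) r"
      by (simp only: coeff_of_nat_mult[symmetric])
    also have "\<dots> = 0"
      using res[of "(- y) ^ Suc m"] hahn_on_power[OF hahn_on_minus[OF y(1)], of "Suc m"] by simp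
    finally show ?thesis by simp
  qed
  then show ?thesis
    unfolding eq using coeff_hsum_nonzero[OF summ_mult[OF S]] by metis
qed

section \<open>Quantitative estimates of Taylor remainders\<close>

definition taylor_rem2 :: "'e hahn \<Rightarrow> 'e hahn \<Rightarrow> 'e hahn"
  where "taylor_rem2 u A =
    hsum (\<lambda>i. (dd ^^ Suc (Suc i)) A * u ^ Suc (Suc i) / fact (Suc (Suc (Suc i))))"

text \<open>The first term is not small enough for order estimates to remove its residue; it will be
  treated as a logarithmic derivative, whereas \<open>taylor_rem2\<close> drops out by its
  order.\<close>

lemma taylor_rem_split:
  "vgt u one \<Longrightarrow> taylor_rem u A = u * dd A / 2 + taylor_rem2 u A"
  unfolding taylor_rem_def taylor_rem2_def
  by (subst hsum_Suc[OF summ_rem]) (simp_all add: mult.commute)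

lemma taylor_rem2_diff:
  assumes "vgt u one"
  shows "taylor_rem2 u (A - B) = taylor_rem2 u A - taylor_rem2 u B"
  using taylor_rem_diff[OF assms, of A B]
  by (simp add: taylor_rem_split[OF assms] dd_diff right_diff_distrib diff_divide_distrib)

lemma vgt_taylor_term:
  assumes "vge u (one + p)" "vgt A e"
  shows "vgt ((dd ^^ n) A * u ^ n / fact m) (e + nmul n p)"
  using vgt_mult_left[OF vgt_ddn[OF assms(2), of n] vge_power[OF assms(1), of n]]
  by (simp add: nmul_add algebra_simps)

lemma vge_taylor_term:
  assumes "vge u (one + p)" "vge A e"
  shows "vge ((dd ^^ n) A * u ^ n / fact m) (e + nmul n p)"
  using vge_mult[OF vge_ddn[OF assms(2), of n] vge_power[OF assms(1), of n]]
  by (simp add: nmul_add algebra_simps)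

lemma vgt_taylor_term_diff:
  assumes "vge u (one + p)" "vge w (one + p)" "vgt (u - w) (one + p + s)" "vge A e"
  shows "vgt ((dd ^^ Suc n) A * u ^ Suc n / fact m - (dd ^^ Suc n) A * w ^ Suc n / fact m)
    (e + p + s + nmul n p)"
proof -
  have "vgt ((dd ^^ Suc n) A * (u ^ Suc n - w ^ Suc n))
      (e - nmul (Suc n) one + (one + p + s + nmul n (one + p)))"
    by (rule vgt_mult_right[OF vge_ddn[OF assms(4)] vgt_power_diff[OF assms(1-3)]])
  also have "e - nmul (Suc n) one + (one + p + s + nmul n (one + p)) = e + p + s + nmul n p"
    by (simp add: nmul_add algebra_simps)
  finally show ?thesis
    by (simp only: diff_divide_distrib[symmetric] right_diff_distrib[symmetric] vgt_divide_fact)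
qed

lemma vge_taylor_term_diff:
  assumes "vge u (one + p)" "vge w (one + p)" "vge (u - w) (one + p + s)" "vge A e"
  shows "vge ((dd ^^ Suc n) A * u ^ Suc n / fact m - (dd ^^ Suc n) A * w ^ Suc n / fact m)
    (e + p + s + nmul n p)"
proof -
  have "vge ((dd ^^ Suc n) A * (u ^ Suc n - w ^ Suc n))
      (e - nmul (Suc n) one + (one + p + s + nmul n (one + p)))"
    by (rule vge_mult[OF vge_ddn[OF assms(4)] vge_power_diff[OF assms(1-3)]])
  also have "e - nmul (Suc n) one + (one + p + s + nmul n (one + p)) = e + p + s + nmul n p"
    by (simp add: nmul_add algebra_simps)
  finally show ?thesis
    by (simp only: diff_divide_distrib[symmetric] right_diff_distrib[symmetric] vge_divide_fact)
qed

context
  fixes u p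
  assumes u: "vgt u one" and up: "vge u (one + p)" and p: "0 \<le> p"
begin

lemma nmul_ge: "p \<le> nmul (Suc n) p" "p + p \<le> nmul (Suc (Suc n)) p"
  using nmul_nonneg[OF p, of n] by (simp_all add: add_increasing2 add.assoc[symmetric])

text \<open>Each factor \<open>u\<close> paired with a differentiation contributes the excess
  \<open>p\<close> of its order over \<open>one\<close>: at least once in \<open>taylor_rem\<close>
  and at least twice in \<open>taylor_rem2\<close>.\<close>

lemma vgt_taylor_rem_plus: "vgt A e \<Longrightarrow> vgt (taylor_rem u A) (e + p)"
  unfolding taylor_rem_def
  by (rule vgt_hsum[OF summ_rem[OF u]], rule vgt_mono[OF vgt_taylor_term[OF up]])
    (use nmul_ge in auto)

lemma vge_taylor_rem_arg_diff:
  assumes w: "vgt w one" "vge w (one + p)" "vge (u - w) (one + p + s)" and A: "vge A e"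
  shows "vge (taylor_rem u A - taylor_rem w A) (e + p + s)"
  unfolding taylor_rem_def hsum_diff[OF summ_rem[OF u] summ_rem[OF w(1)], symmetric]
  by (rule vge_hsum[OF summ_diff[OF summ_rem[OF u] summ_rem[OF w(1)]]],
      rule vge_mono[OF vge_taylor_term_diff[OF up w(2,3) A]]) (simp add: nmul_nonneg p)

lemma vge_taylor_rem_plus: "vge A e \<Longrightarrow> vge (taylor_rem u A) (e + p)"
  unfolding taylor_rem_def
  by (rule vge_hsum[OF summ_rem[OF u]], rule vge_mono[OF vge_taylor_term[OF up]])
    (use nmul_ge in auto)

lemma vgt_taylor_rem2_plus: "vgt A e \<Longrightarrow> vgt (taylor_rem2 u A) (e + p + p)"
  unfolding taylor_rem2_def
  by (rule vgt_hsum[OF summ_Suc[OF summ_rem[OF u]]], rule vgt_mono[OF vgt_taylor_term[OF up]])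
    (use nmul_ge(2) in \<open>auto simp: add.assoc\<close>)

lemma
  assumes w: "vgt w one" "vge w (one + p)" "vgt (u - w) (one + p + s)" and A: "vge A e"
  shows vgt_taylor_rem_arg_diff: "vgt (taylor_rem u A - taylor_rem w A) (e + p + s)"
    and vgt_taylor_rem2_arg_diff: "vgt (taylor_rem2 u A - taylor_rem2 w A) (e + p + p + s)"
proof -
  show "vgt (taylor_rem u A - taylor_rem w A) (e + p + s)"
    unfolding taylor_rem_def hsum_diff[OF summ_rem[OF u] summ_rem[OF w(1)], symmetric]
    by (rule vgt_hsum[OF summ_diff[OF summ_rem[OF u] summ_rem[OF w(1)]]],
        rule vgt_mono[OF vgt_taylor_term_diff[OF up w(2,3) A]]) (simp add: nmul_nonneg p)
  note S = summ_Suc[OF summ_rem[OF u]] summ_Suc[OF summ_rem[OF w(1)]]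
  show "vgt (taylor_rem2 u A - taylor_rem2 w A) (e + p + p + s)"
    unfolding taylor_rem2_def hsum_diff[OF S, symmetric]
    by (rule vgt_hsum[OF summ_diff[OF S]], rule vgt_mono[OF vgt_taylor_term_diff[OF up w(2,3) A]])
      (use nmul_nonneg[OF p] in \<open>simp add: algebra_simps\<close>)
qed

end

section \<open>Comparison of the Abel solutions of two perturbations\<close>

context
  fixes u w A B p
  assumes u: "vgt u one" "vge u (one + p)" "coeff u (one + p) \<noteq> 0" "u \<in> hahn_on G"
    and w: "vgt w one" "vge w (one + p)" "coeff w (one + p) \<noteq> 0" "w \<in> hahn_on G"
    and p: "0 < p" and A: "abel u A" and B: "abel w B"
begin

lemma abel_eq: "A = inverse u - taylor_rem u A" "B = inverse w - taylor_rem w B"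
  using A B by (simp_all add: abel_def divide_inverse algebra_simps)

lemma abel_diff_eq:
  "A - B = (inverse u - inverse w) - (taylor_rem u B - taylor_rem w B) - taylor_rem u (A - B)"
  by (subst (1) abel_eq(1), subst (1) abel_eq(2)) (simp add: taylor_rem_diff[OF u(1)] algebra_simps)

lemma inverse_diff_eq: "inverse u - inverse w = - ((u - w) * (inverse u * inverse w))"
proof -
  have "u \<noteq> 0" "w \<noteq> 0" using u(3) w(3) by auto
  then show ?thesis by (simp add: field_simps)
qed

lemma inverse_orders: "vge (inverse u) (- (one + p))" "vge (inverse w) (- (one + p))"
  using hahn_inverse_order[OF u(2,3)] hahn_inverse_order[OF w(2,3)] by simp_all

lemma abel_orders: "vge A (- (one + p))" "vge B (- (one + p))"
  using abel_order[OF u(1-3) A] abel_order[OF w(1-3) B] by simp_all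

text \<open>At the leading exponent of \<open>A - B\<close> its own remainder contributes nothing.
  So the leading term stems from 1/u - 1/w or from the change of argument in the remainder, and both
  exceed the bound.\<close>

lemma vgt_abel_diff:
  assumes uw: "vgt (u - w) (one + p + s)"
  shows "vgt (A - B) (- (one + p) + s)"
proof (cases "A - B = 0")
  case False
  let ?N = "- (one + p)"
  obtain e where e: "vge (A - B) e" "coeff (A - B) e \<noteq> 0" using False by (rule hahn_order)
  have "coeff (A - B) e = coeff (inverse u - inverse w) e
      - coeff (taylor_rem u B - taylor_rem w B) e - coeff (taylor_rem u (A - B)) e"
    by (metis abel_diff_eq coeff_diff)
  moreover have "coeff (taylor_rem u (A - B)) e = 0"
    using vgt_taylor_rem[OF u(1) e(1)] by (simp add: vgt_iff_vge)
  moreover have "vgt (taylor_rem u B - taylor_rem w B) (?N + s)"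
    by (rule vgt_mono[OF vgt_taylor_rem_arg_diff[OF u(1,2) less_imp_le[OF p] w(1,2) uw abel_orders(2)]])
      (use p in \<open>simp add: less_imp_le\<close>)
  moreover have "vgt (inverse u - inverse w) (?N + s)"
  proof -
    have "vgt ((u - w) * (inverse u * inverse w)) (one + p + s + (?N + ?N))"
      by (intro vgt_mult_left vge_mult uw inverse_orders)
    moreover have "one + p + s + (?N + ?N) = ?N + s" by (simp add: algebra_simps)
    ultimately show ?thesis unfolding inverse_diff_eq vgt_minus by (simp only:)
  qed
  ultimately have "\<not> e \<le> ?N + s"
    using e(2) unfolding vgt_def by auto
  then show ?thesis by (intro vge_less_vgt[OF e(1)]) simp
qed simp

text \<open>If \<open>u - w\<close> has order t, then 1/u - 1/w has order t - 2 (one + p), too low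
  to be cancelled by the change of argument. It must show in \<open>A - B\<close> or in the
  remainder of \<open>A - B\<close>, whose orders are bounded below.\<close>

lemma vgt_diff_of_abel:
  assumes AB: "vgt (A - B) (- (one + p) + s)"
  shows "vgt (u - w) (one + p + s)"
proof (cases "u - w = 0")
  case False
  let ?N = "- (one + p)"
  obtain t where t: "vge (u - w) t" "coeff (u - w) t \<noteq> 0" using False by (rule hahn_order)
  have "t = one + p + (t + ?N)" by simp
  then have "vge (u - w) (one + p + (t + ?N))" using t(1) by simp
  from vge_taylor_rem_arg_diff[OF u(1,2) less_imp_le[OF p] w(1,2) this abel_orders(2)]
  have "vgt (taylor_rem u B - taylor_rem w B) (t + (?N + ?N))"
    by (rule vge_less_vgt) (use p in \<open>simp add: algebra_simps\<close>)
  then have 1: "coeff (taylor_rem u B - taylor_rem w B) (t + (?N + ?N)) = 0"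
    by (simp add: vgt_iff_vge)
  have "coeff (inverse u - inverse w) (t + (?N + ?N)) \<noteq> 0"
    unfolding inverse_diff_eq coeff_minus
    using coeff_mult_lead[OF t(1) vge_mult[OF inverse_orders]] coeff_mult_lead[OF inverse_orders] t(2)
      hahn_inverse_order(2)[OF u(2,3)] hahn_inverse_order(2)[OF w(2,3)] u(3) w(3) by simp
  moreover have "coeff (A - B) e = coeff (inverse u - inverse w) e
      - coeff (taylor_rem u B - taylor_rem w B) e - coeff (taylor_rem u (A - B)) e" for e
    by (metis abel_diff_eq coeff_diff)
  ultimately have "coeff (A - B) (t + (?N + ?N)) \<noteq> 0 \<or> coeff (taylor_rem u (A - B)) (t + (?N + ?N)) \<noteq> 0"
    using 1 by (metis diff_0_right)
  moreover have "vgt (taylor_rem u (A - B)) (?N + s)"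
    using vgt_mono[OF vgt_taylor_rem_plus[OF u(1,2) less_imp_le[OF p] AB]] p by (simp add: less_imp_le)
  ultimately have "\<not> t + (?N + ?N) \<le> ?N + s"
    using AB unfolding vgt_def by blast
  then have "one + p + s < t" by (simp add: not_le algebra_simps)
  then show ?thesis by (rule vge_less_vgt[OF t(1)])
qed simp

text \<open>The difference \<open>K\<close> of the two remainders contributes nothing at
  \<open>r\<close>: apart from a logarithmic derivative, all its parts have order above
  \<open>s + p - one\<close>.\<close>

lemma coeff_abel_diff:
  assumes s: "0 \<le> s" and uw: "vgt (u - w) (one + p + s)" and r: "r \<le> s + p - one"
    and res: "\<And>x. x \<in> hahn_on G \<Longrightarrow> coeff (dd x) r = 0"
  shows "coeff (A - B) r = coeff (1 / u - 1 / w) r"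
proof -
  define N where "N = - (one + p)"
  have nz: "u \<noteq> 0" "w \<noteq> 0" using u(3) w(3) by auto
  note p = less_imp_le[OF p]
  note iw = inverse_orders(2)[folded N_def]
  note AN = abel_orders(1)[folded N_def] and BN = abel_orders(2)[folded N_def]
  note eqA = abel_eq(1) and eqB = abel_eq(2)
  note rem_diff = vgt_taylor_rem_arg_diff[OF u(1,2) p w(1,2) uw BN]
  note AB = vgt_abel_diff[OF uw, folded N_def]
  define K where "K = taylor_rem u A - taylor_rem w B"
  have K: "vgt K (N + s + p)"
  proof -
    have "K = taylor_rem u (A - B) + (taylor_rem u B - taylor_rem w B)"
      by (simp add: K_def taylor_rem_diff[OF u(1)])
    moreover have "vgt (taylor_rem u B - taylor_rem w B) (N + s + p)"
      using rem_diff by (simp add: add_ac)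
    ultimately show ?thesis
      using vgt_add[OF vgt_taylor_rem_plus[OF u(1,2) p AB]] by simp
  qed
  have "coeff (taylor_rem2 u A - taylor_rem2 w B) r = 0"
  proof -
    have "vgt (taylor_rem2 u (A - B) + (taylor_rem2 u B - taylor_rem2 w B)) (N + s + p + p)"
      using vgt_taylor_rem2_arg_diff[OF u(1,2) p w(1,2) uw BN]
      by (intro vgt_add[OF vgt_taylor_rem2_plus[OF u(1,2) p AB]]) (simp add: add_ac)
    moreover have "N + s + p + p = s + p - one" by (simp add: N_def algebra_simps)
    ultimately show ?thesis using r by (simp add: taylor_rem2_diff[OF u(1)] vgt_def)
  qed
  moreover have "coeff (u * dd A - w * dd B) r = 0"
  proof -
    have "vge (dd (taylor_rem u A)) (N + p - one)"
      by (rule vge_dd[OF vge_taylor_rem_plus[OF u(1,2) p AN]])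
    from vgt_mult_left[OF uw this]
    have "coeff ((u - w) * dd (taylor_rem u A)) r = 0"
      using r by (simp add: vgt_def N_def algebra_simps)
    moreover from vgt_mult_right[OF w(2) vgt_dd[OF K]]
    have "coeff (w * dd K) r = 0"
      using r by (simp add: vgt_def N_def algebra_simps)
    moreover have "coeff (u * dd (inverse u) - w * dd (inverse w)) r = 0"
    proof -
      \<comment> \<open>\<open>1 + y\<close> is u / w, so u (1/u)' - w (1/w)' = w'/w - u'/u is minus
        the logarithmic derivative of \<open>1 + y\<close>.\<close>
      define y where "y = (u - w) / w"
      have uy: "u = w * (1 + y)" using nz by (simp add: y_def field_simps)
      have "vgt ((u - w) * inverse w) (one + p + s + N)" by (rule vgt_mult_left[OF uw iw])
      then have "vgt y s" by (simp add: y_def N_def divide_inverse)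
      then have "vgt y 0" using s by (rule vgt_mono)
      moreover have "y \<in> hahn_on G" using u(4) w(4) by (simp add: y_def hahn_on_divide hahn_on_diff)
      ultimately have "coeff (dd y / (1 + y)) r = 0" using res by (intro coeff_log_deriv)
      moreover have "u * dd (inverse u) - w * dd (inverse w) = - (dd y / (1 + y))"
      proof -
        have "1 + y \<noteq> 0" using nz(1) uy by auto
        moreover have "dd u = dd w * (1 + y) + w * dd y"
          by (subst uy) (simp add: dd_mult dd_add)
        ultimately have "dd u / u = dd w / w + dd y / (1 + y)"
          using nz(2) by (simp add: uy add_divide_distrib)
        moreover have "x * dd (inverse x) = - (dd x / x)" if "x \<noteq> 0" for x
          using that by (simp add: dd_inverse power2_eq_square)
        ultimately show ?thesis using nz by simp
      qed
      ultimately show ?thesis by simp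
    qed
    \<comment> \<open>Inserting Abel's equation for \<open>A\<close> and \<open>B\<close> isolates
      the logarithmic part; the other products contain \<open>u - w\<close> or \<open>K\<close> and
      are small.\<close>
    moreover have "u * dd A - w * dd B = (u * dd (inverse u) - w * dd (inverse w))
        - (u - w) * dd (taylor_rem u A) - w * dd K"
      by (subst (1) eqA, subst (1) eqB) (simp add: K_def dd_diff algebra_simps)
    ultimately show ?thesis by simp
  qed
  moreover have "K = (u * dd A - w * dd B) / of_nat 2 + (taylor_rem2 u A - taylor_rem2 w B)"
    by (simp add: K_def taylor_rem_split[OF u(1)] taylor_rem_split[OF w(1)] diff_divide_distrib)
  ultimately have "coeff K r = 0"
    by (simp only: coeff_add coeff_divide_of_nat)
  moreover have "A - B = inverse u - inverse w - K"
    by (subst (1) eqA, subst (1) eqB) (simp add: K_def)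
  ultimately show ?thesis by (simp add: divide_inverse)
qed

end

end


section \<open>The derivation of logarithmic transseries\<close>

instance prod :: (linordered_ab_group_add, linordered_ab_group_add) linordered_ab_group_add
proof
  fix a b c :: "'a \<times> 'b"
  show "a \<le> b \<Longrightarrow> c + a \<le> c + b"
    by (cases a; cases b; cases c) auto
qed

text \<open>\<open>wt 0\<close> is the exponent of \<open>z\<close> and \<open>wt i\<close>, for \<open>i > 0\<close>, that of \<open>l_i\<close>; the logarithmic
  derivative of \<open>z\<close>, resp. \<open>l_i\<close>, is the monomial with exponent \<open>tt 0\<close>, resp. \<open>tt i\<close>.\<close>

primrec wt :: "nat \<Rightarrow> expo \<Rightarrow> real" where
  "wt 0 e = fst e"
| "wt (Suc i) e = of_int (Poly_Mapping.lookup (snd e) i)"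

definition tt :: "nat \<Rightarrow> expo"
  where "tt i = (- 1, ones i)"

lemma wt_add: "wt i (d + e) = wt i d + wt i e"
  and wt_diff: "wt i (d - e) = wt i d - wt i e"
  and wt_minus: "wt i (- e) = - wt i e"
  and wt_0 [simp]: "wt i 0 = 0"
  by (cases i; simp add: lookup_add lookup_minus)+

lemma lookup_ones: "Poly_Mapping.lookup (ones j) i = (if i < j then 1 else 0)"
proof -
  have "Poly_Mapping.lookup (ones j) i = (\<Sum>l<j. if l = i then 1 else 0)"
    by (simp add: ones_def lookup_sum lookup_single when_def)
  then show ?thesis by simp
qed

lemma wt_tt: "wt i (tt j) = (if i = 0 then - 1 else if i \<le> j then 1 else 0)"
  by (cases i) (auto simp: tt_def lookup_ones)

lemma expo_eqI: "(\<And>i. wt i d = wt i e) \<Longrightarrow> d = e"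
proof -
  assume *: "\<And>i. wt i d = wt i e"
  have "fst d = fst e" using *[of 0] by simp
  moreover have "snd d = snd e"
    by (rule poly_mapping_eqI) (use *[of "Suc _"] in simp)
  ultimately show "d = e" by (rule prod_eqI)
qed

lemma expo_less_iff: "d < e \<longleftrightarrow> (\<exists>i. wt i d < wt i e \<and> (\<forall>l<i. wt l d = wt l e))"
proof -
  have vec: "m < n \<longleftrightarrow> (\<exists>i. Poly_Mapping.lookup m i < Poly_Mapping.lookup n i \<and>
      (\<forall>l<i. Poly_Mapping.lookup m l = Poly_Mapping.lookup n l))" for m n :: "nat \<Rightarrow>\<^sub>0 int"
    by (simp add: less_poly_mapping.rep_eq less_fun_def)
  obtain a m b n where de: "d = (a, m)" "e = (b, n)" by (cases d, cases e) auto
  have ex_split: "(\<exists>i. P i) \<longleftrightarrow> P 0 \<or> (\<exists>i. P (Suc i))" for P by (metis nat.exhaust)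
  have all_split: "(\<forall>l<Suc i. P l) \<longleftrightarrow> P 0 \<and> (\<forall>l<i. P (Suc l))" for P i
    by (auto simp: less_Suc_eq_0_disj)
  show ?thesis
    unfolding de by (subst ex_split) (auto simp: all_split vec less_prod_def')
qed

lemma tt_less: "i < j \<Longrightarrow> tt i < tt j"
  unfolding expo_less_iff by (rule exI[of _ "Suc i"]) (auto simp: wt_tt)

lemma tt_le: "i \<le> j \<Longrightarrow> tt i \<le> tt j"
  by (metis le_neq_implies_less order_le_less tt_less)

definition expos :: "nat \<Rightarrow> expo set"
  where "expos k = UNIV \<times> int_vecs k"

lemma expos_iff: "e \<in> expos k \<longleftrightarrow> (\<forall>i>k. wt i e = 0)"
proof -
  have "e \<in> expos k \<longleftrightarrow> (\<forall>i. k \<le> i \<longrightarrow> Poly_Mapping.lookup (snd e) i = 0)"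
    by (cases e) (auto simp: expos_def int_vecs_def in_keys_iff subset_iff not_less[symmetric])
  also have "\<dots> \<longleftrightarrow> (\<forall>i>k. wt i e = 0)"
    by (metis Suc_le_eq Suc_pred' gr0_implies_Suc le_less_trans less_Suc_eq_le of_int_eq_0_iff wt.simps(2) zero_less_iff_neq_zero le0)
  finally show ?thesis .
qed

lemma expos_mono: "k \<le> K \<Longrightarrow> expos k \<subseteq> expos K"
  by (auto simp: expos_iff)

lemma tt_expos: "i \<le> k \<Longrightarrow> tt i \<in> expos k"
  by (auto simp: expos_iff wt_tt)

interpretation expos: exponent_group "expos k" for k
  by standard (auto simp: expos_iff wt_add wt_minus)

text \<open>The Euler operator of z (for \<open>i = 0\<close>) or of l_i, a derivation because
  \<open>wt i\<close> is additive.\<close>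

definition wmul :: "nat \<Rightarrow> expo hahn \<Rightarrow> expo hahn"
  where "wmul i x = Hahn (\<lambda>e. wt i e * coeff x e)"

lemma coeff_wmul: "coeff (wmul i x) e = wt i e * coeff x e"
  unfolding wmul_def by (subst coeff_Hahn[OF wo_supp[of x]]) (auto simp: supp_def)

lemma wmul_mult: "wmul i (x * y) = wmul i x * y + x * wmul i y"
proof (rule hahn_eqI)
  fix e
  let ?S = "{d \<in> supp x. e - d \<in> supp y}"
  have S: "finite ?S" by (rule finite_supp_pairs)
  have "coeff (wmul i x * y) e = (\<Sum>d\<in>?S. coeff (wmul i x) d * coeff y (e - d))"
    by (rule coeff_mult_superset[OF S]) (auto simp: supp_def coeff_wmul)
  moreover have "coeff (x * wmul i y) e = (\<Sum>d\<in>?S. coeff x d * coeff (wmul i y) (e - d))"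
    by (rule coeff_mult_superset[OF S]) (auto simp: supp_def coeff_wmul)
  ultimately have "coeff (wmul i x * y + x * wmul i y) e =
      (\<Sum>d\<in>?S. coeff (wmul i x) d * coeff y (e - d) + coeff x d * coeff (wmul i y) (e - d))"
    by (simp add: sum.distrib)
  also have "\<dots> = (\<Sum>d\<in>?S. wt i e * (coeff x d * coeff y (e - d)))"
    by (rule sum.cong) (auto simp: coeff_wmul wt_diff algebra_simps)
  finally show "coeff (wmul i (x * y)) e = coeff (wmul i x * y + x * wmul i y) e"
    by (simp add: coeff_wmul coeff_mult sum_distrib_left)
qed

lemma summ_wmul:
  assumes "summ F"
  shows "summ (\<lambda>j. wmul i (F j))"
  unfolding summ_def
proof (intro conjI allI)
  show "wo (\<Union>j. supp (wmul i (F j)))"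
    by (rule wo_subset[of "\<Union>i. supp (F i)"])
      (use assms in \<open>auto simp: summ_def supp_def coeff_wmul\<close>)
  show "finite {j. coeff (wmul i (F j)) e \<noteq> 0}" for e
    by (rule finite_subset[OF _ summ_finite[OF assms, of e]]) (auto simp: coeff_wmul)
qed

lemma hsum_wmul: "summ F \<Longrightarrow> hsum (\<lambda>j. wmul i (F j)) = wmul i (hsum F)"
proof (rule hahn_eqI)
  fix e assume F: "summ F"
  show "coeff (hsum (\<lambda>j. wmul i (F j))) e = coeff (wmul i (hsum F)) e"
    by (subst coeff_hsum_superset[OF summ_wmul[OF F] summ_finite[OF F, of e]])
      (auto simp: coeff_wmul coeff_hsum[OF F] sum_distrib_left)
qed

text \<open>On exponents in \<open>expos K\<close> this is d/dz, see \<open>tderiv_coeff\<close>.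
  The cut-off keeps the sum finite and still gives a derivation of the whole field of Hahn series,
  to which the abstract Taylor calculus applies.\<close>

definition deriv :: "nat \<Rightarrow> expo hahn \<Rightarrow> expo hahn"
  where "deriv K x = (\<Sum>i\<le>K. hmonom 1 (tt i) * wmul i x)"

lemma coeff_deriv: "coeff (deriv K x) e = (\<Sum>i\<le>K. wt i (e - tt i) * coeff x (e - tt i))"
  by (simp add: deriv_def coeff_hmonom_mult coeff_wmul)

lemma deriv_hmonom: "deriv K (hmonom c d) = (\<Sum>i\<le>K. hmonom (c * wt i d) (d + tt i))"
  by (rule hahn_eqI) (auto simp: coeff_deriv coeff_hmonom eq_diff_eq diff_eq_eq intro!: sum.cong)

lemma coeff_deriv_nonzero:
  assumes "coeff (deriv K x) e \<noteq> 0"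
  obtains i where "i \<le> K" "wt i (e - tt i) \<noteq> 0" "coeff x (e - tt i) \<noteq> 0"
proof -
  have "(\<Sum>i\<le>K. wt i (e - tt i) * coeff x (e - tt i)) \<noteq> 0" using assms by (simp add: coeff_deriv)
  then obtain i where "i \<in> {..K}" "wt i (e - tt i) * coeff x (e - tt i) \<noteq> 0"
    by (rule sum.not_neutral_contains_not_neutral)
  then show ?thesis using that by simp
qed

lemma summ_sum:
  "(\<And>i. i \<in> A \<Longrightarrow> summ (F i)) \<Longrightarrow> summ (\<lambda>j. \<Sum>i\<in>A. F i j)"
  "(\<And>i. i \<in> A \<Longrightarrow> summ (F i)) \<Longrightarrow> hsum (\<lambda>j. \<Sum>i\<in>A. F i j) = (\<Sum>i\<in>A. hsum (F i))"
proof -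
  have "(\<forall>i\<in>A. summ (F i)) \<longrightarrow> summ (\<lambda>j. \<Sum>i\<in>A. F i j) \<and> hsum (\<lambda>j. \<Sum>i\<in>A. F i j) = (\<Sum>i\<in>A. hsum (F i))"
  proof (induction A rule: infinite_finite_induct)
    case (insert a A)
    then show ?case by (auto simp: summ_add hsum_add)
  qed (auto simp: summ_def)
  then show "(\<And>i. i \<in> A \<Longrightarrow> summ (F i)) \<Longrightarrow> summ (\<lambda>j. \<Sum>i\<in>A. F i j)"
    "(\<And>i. i \<in> A \<Longrightarrow> summ (F i)) \<Longrightarrow> hsum (\<lambda>j. \<Sum>i\<in>A. F i j) = (\<Sum>i\<in>A. hsum (F i))" by auto
qed

interpretation deriv: hahn_derivation "deriv K" "tt ` {..K}" "(1, 0)" for K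
proof
  fix x y :: "expo hahn" and d :: expo and F :: "nat \<Rightarrow> expo hahn"
  show "deriv K (x + y) = deriv K x + deriv K y"
    by (rule hahn_eqI) (simp add: coeff_deriv sum.distrib distrib_left)
  show "deriv K (x * y) = deriv K x * y + x * deriv K y"
    by (simp add: deriv_def wmul_mult distrib_left sum.distrib sum_distrib_left sum_distrib_right mult_ac)
  show "wo (tt ` {..K})" by (simp add: wo_finite)
  show "- (1, 0) \<le> d" if "d \<in> tt ` {..K}"
  proof -
    from that obtain i where "d = tt i" by blast
    then show ?thesis using tt_le[of 0 i] by (simp add: tt_def ones_def)
  qed
  show "supp (deriv K x) \<subseteq> supp x + tt ` {..K}"
  proof
    fix e assume "e \<in> supp (deriv K x)"
    then have "coeff (deriv K x) e \<noteq> 0" by (simp add: supp_def)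
    then obtain i where "i \<le> K" "coeff x (e - tt i) \<noteq> 0" by (rule coeff_deriv_nonzero)
    then have "(e - tt i) + tt i \<in> supp x + tt ` {..K}"
      by (intro set_plus_intro) (auto simp: supp_def)
    then show "e \<in> supp x + tt ` {..K}" by simp
  qed
  show "deriv K (hsum F) = hsum (\<lambda>i. deriv K (F i))" if F: "summ F"
    unfolding deriv_def
    by (subst summ_sum(2)) (simp_all add: summ_mult summ_wmul hsum_mult hsum_wmul F)
  show "deriv K (hmonom 1 (1, 0)) = 1"
  proof -
    have "wt i (1, 0) = (if i = 0 then 1 else 0)" for i by (cases i) auto
    then have "deriv K (hmonom 1 (1, 0)) = (\<Sum>i\<le>K. if i = 0 then hmonom 1 ((1, 0) + tt i) else 0)"
      unfolding deriv_hmonom by (intro sum.cong) auto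
    also have "\<dots> = hmonom 1 0" by (simp add: tt_def ones_def zero_prod_def)
    finally show ?thesis by (simp add: one_hahn_def)
  qed
qed

subsection \<open>Leading exponents of derivatives\<close>

text \<open>For \<open>d \<noteq> 0\<close>, the derivative of the monomial with exponent \<open>d\<close> has leading exponent \<open>lam d\<close>
  and leading coefficient \<open>wt (li d) d\<close>.\<close>

definition li :: "expo \<Rightarrow> nat"
  where "li d = (LEAST i. wt i d \<noteq> 0)"

definition lam :: "expo \<Rightarrow> expo"
  where "lam d = d + tt (li d)"

lemma wt_li: "d \<noteq> 0 \<Longrightarrow> wt (li d) d \<noteq> 0"
  unfolding li_def by (rule LeastI_ex) (metis expo_eqI wt_0)

lemma li_le: "wt i d \<noteq> 0 \<Longrightarrow> li d \<le> i"
  unfolding li_def by (rule Least_le)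

lemma li_expos: "d \<in> expos k \<Longrightarrow> d \<noteq> 0 \<Longrightarrow> li d \<le> k"
  using wt_li[of d] by (auto simp: expos_iff not_less[symmetric])

lemma lam_le: "wt i d \<noteq> 0 \<Longrightarrow> lam d \<le> d + tt i"
  unfolding lam_def by (intro add_left_mono tt_le li_le)

lemma lam_eq: "wt i d \<noteq> 0 \<Longrightarrow> lam d = d + tt i \<Longrightarrow> i = li d"
  using li_le[of i d] tt_less[of "li d" i] by (auto simp: lam_def le_less)

text \<open>If the leading indices differ, neither precedes the first index \<open>i\<close> where
  \<open>d\<close> and \<open>e\<close> differ. The added vectors then agree up to \<open>i\<close>,
  so the comparison at \<open>i\<close> survives.\<close>

lemma lam_strict_mono:
  assumes "d < e" "d \<noteq> 0" "e \<noteq> 0"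
  shows "lam d < lam e"
proof -
  obtain i where i: "wt i d < wt i e" "\<And>l. l < i \<Longrightarrow> wt l d = wt l e"
    using assms(1) unfolding expo_less_iff by blast
  show ?thesis
  proof (cases "li d = li e")
    case True
    then show ?thesis using assms(1) by (simp add: lam_def)
  next
    case False
    have "i \<le> li d \<and> i \<le> li e"
    proof (rule ccontr)
      assume "\<not> ?thesis"
      then have "li d < i \<or> li e < i" by auto
      then show False
        using wt_li[OF assms(2)] wt_li[OF assms(3)] i(2) li_le[of "li d" e] li_le[of "li e" d] False
        by (metis le_antisym le_less_trans)
    qed
    then have "wt l (tt (li d)) = wt l (tt (li e))" if "l \<le> i" for l
      using that by (auto simp: wt_tt)
    then show ?thesis
      unfolding expo_less_iff lam_def using i by (intro exI[of _ i]) (auto simp: wt_add)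
  qed
qed

lemma lam_mono_iff: "d \<noteq> 0 \<Longrightarrow> e \<noteq> 0 \<Longrightarrow> lam d \<le> lam e \<longleftrightarrow> d \<le> e"
  by (metis lam_strict_mono leD leI order_le_less)

lemma lam_less_iff: "d \<noteq> 0 \<Longrightarrow> e \<noteq> 0 \<Longrightarrow> lam d < lam e \<longleftrightarrow> d < e"
  by (metis lam_mono_iff not_le)

text \<open>The leading index of the preimage is the first place \<open>j\<close> where
  \<open>e\<close> departs from \<open>tt k\<close>: subtracting \<open>tt j\<close> clears the
  earlier entries and leaves a nonzero one at \<open>j\<close>.\<close>

lemma lam_surj:
  assumes e: "e \<in> expos k" "e \<noteq> tt k"
  obtains d where "d \<in> expos k" "d \<noteq> 0" "lam d = e"
proof -
  define j where "j = (LEAST i. wt i e \<noteq> wt i (tt k))"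
  have ex: "\<exists>i. wt i e \<noteq> wt i (tt k)" using e(2) expo_eqI by blast
  have j: "wt j e \<noteq> wt j (tt k)" unfolding j_def by (rule LeastI_ex[OF ex])
  have less_j: "wt i e = wt i (tt k)" if "i < j" for i
    using not_less_Least that unfolding j_def by blast
  have jk: "j \<le> k"
    using j e(1) by (auto simp: expos_iff wt_tt not_less[symmetric] split: if_splits)
  define d where "d = e - tt j"
  have wd: "wt j d \<noteq> 0" using j jk by (auto simp: d_def wt_diff wt_tt)
  have "wt i d = 0" if "i < j" for i
    using less_j[OF that] that jk by (auto simp: d_def wt_diff wt_tt)
  then have "li d = j"
    unfolding li_def by (intro Least_equality wd) (meson not_le)
  then have "lam d = e" by (simp add: lam_def d_def)
  moreover have "d \<noteq> 0" using wd by auto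
  moreover have "d \<in> expos k"
    using e(1) jk by (auto simp: d_def expos_iff wt_diff wt_tt)
  ultimately show ?thesis using that by blast
qed

text \<open>Another contribution would come from an exponent not below \<open>d\<close> whose
  derivative starts no later than \<open>lam d\<close>, against strict monotonicity. The bound
  spares the constant term, whose derivative vanishes.\<close>

lemma coeff_deriv_lam:
  assumes y: "y \<in> hahn_on (expos K)" and d: "d \<in> expos K" "d \<noteq> 0"
    and min: "\<And>c. c \<noteq> 0 \<Longrightarrow> coeff y c \<noteq> 0 \<Longrightarrow> d \<le> c"
  shows "coeff (deriv K y) (lam d) = wt (li d) d * coeff y d"
proof -
  have "wt i (lam d - tt i) * coeff y (lam d - tt i) = (if i = li d then wt (li d) d * coeff y d else 0)" for i
  proof (cases "i = li d")
    case False
    show ?thesis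
    proof (rule ccontr)
      assume "\<not> ?thesis"
      then have c: "wt i (lam d - tt i) \<noteq> 0" "coeff y (lam d - tt i) \<noteq> 0" using False by auto
      let ?c = "lam d - tt i"
      have "?c \<noteq> 0" using c(1) by auto
      moreover from this have "d \<le> ?c" using min c(2) by blast
      moreover have "lam ?c \<le> lam d" using lam_le[OF c(1)] by simp
      ultimately have "?c = d" using d(2) lam_mono_iff by (metis order_antisym)
      then show False using lam_eq[of i d] c(1) False by (metis diff_add_cancel)
    qed
  qed (simp add: lam_def)
  then show ?thesis using li_expos[OF d] by (simp add: coeff_deriv)
qed

lemma deriv_eq_0_imp:
  assumes y: "y \<in> hahn_on (expos K)" "deriv K y = 0" and d: "d \<noteq> 0"
  shows "coeff y d = 0"
proof (rule ccontr)
  assume "coeff y d \<noteq> 0"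
  then have "d \<in> supp y - {0}" using d by (simp add: supp_def)
  moreover have "wo (supp y - {0})" by (rule wo_subset[OF wo_supp]) auto
  ultimately obtain m where m: "m \<in> supp y - {0}" "\<And>t. t \<in> supp y - {0} \<Longrightarrow> m \<le> t"
    by (metis wo_least)
  have "coeff (deriv K y) (lam m) = wt (li m) m * coeff y m"
    by (rule coeff_deriv_lam[OF y(1)]) (use m y in \<open>auto simp: supp_def hahn_on_def\<close>)
  then show False using m wt_li[of m] y(2) by (auto simp: supp_def)
qed

text \<open>Only exponents \<open>tt k - tt i\<close> could contribute: for \<open>i \<le> k\<close>
  their weight \<open>i\<close> is 0, and for \<open>i > k\<close> they lie outside level
  \<open>k\<close>.\<close>

lemma coeff_deriv_tt:
  assumes "x \<in> hahn_on (expos k)"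
  shows "coeff (deriv K x) (tt k) = 0"
proof (rule ccontr)
  assume "\<not> ?thesis"
  then obtain i where i: "wt i (tt k - tt i) \<noteq> 0" "coeff x (tt k - tt i) \<noteq> 0"
    by (rule coeff_deriv_nonzero)
  then have "tt k - tt i \<in> expos k" using assms by (rule_tac hahn_onD)
  then show False using i(1) by (auto simp: expos_iff wt_diff wt_tt split: if_splits)
qed

lemma deriv_on: "x \<in> hahn_on (expos k) \<Longrightarrow> deriv K x \<in> hahn_on (expos k)"
proof (rule hahn_onI)
  fix e assume x: "x \<in> hahn_on (expos k)" and "coeff (deriv K x) e \<noteq> 0"
  then obtain i where i: "wt i (e - tt i) \<noteq> 0" "coeff x (e - tt i) \<noteq> 0"
    by (metis coeff_deriv_nonzero)
  have e: "e - tt i \<in> expos k" using hahn_onD[OF x i(2)] .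
  then have "i \<le> k" using i(1) by (auto simp: expos_iff not_less[symmetric])
  from expos.add_mem[OF e tt_expos[OF this]] show "e \<in> expos k" by simp
qed

subsection \<open>Formal integration\<close>

text \<open>Inverts differentiation on leading terms only. Its support is well-ordered because
  \<open>lam\<close> is increasing.\<close>

definition leading_integral :: "nat \<Rightarrow> expo hahn \<Rightarrow> expo hahn"
  where "leading_integral k x =
    Hahn (\<lambda>d. if d \<in> expos k \<and> d \<noteq> 0 then coeff x (lam d) / wt (li d) d else 0)"

lemma coeff_leading_integral: "coeff (leading_integral k x) d =
    (if d \<in> expos k \<and> d \<noteq> 0 then coeff x (lam d) / wt (li d) d else 0)"
proof -
  have "wo {d. d \<noteq> 0 \<and> lam d \<in> supp x}"
    unfolding wo_iff_least
  proof (intro allI impI)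
    fix T assume T: "T \<subseteq> {d. d \<noteq> 0 \<and> lam d \<in> supp x}" "T \<noteq> {}"
    then have "wo (lam ` T)" by (intro wo_subset[OF wo_supp[of x]]) auto
    then obtain m where "m \<in> T" "\<And>t. t \<in> T \<Longrightarrow> lam m \<le> lam t"
      using T(2) wo_least[of "lam ` T"] by (metis (no_types, lifting) ex_in_conv imageE imageI)
    then show "\<exists>m\<in>T. \<forall>t\<in>T. m \<le> t" using T(1) lam_mono_iff by blast
  qed
  then show ?thesis
    unfolding leading_integral_def by (subst coeff_Hahn) (auto simp: supp_def)
qed

text \<open>Differentiating \<open>leading_integral\<close> reproduces leading terms, so the error
  map contracts, and the leading integral of its fixed point is the desired integral. The upward
  closed set \<open>U\<close> carries lower bounds on exponents from \<open>x\<close> to the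
  integral.\<close>

lemma integral_exists:
  assumes kK: "k \<le> K" and U: "\<And>d e. d \<in> U \<Longrightarrow> d \<le> e \<Longrightarrow> e \<in> U"
    and x: "x \<in> hahn_on (expos k)" "coeff x (tt k) = 0" "supp x \<subseteq> U"
  obtains y where "y \<in> hahn_on (expos k)" "deriv K y = x" "coeff y 0 = 0"
    "\<And>d. coeff y d \<noteq> 0 \<Longrightarrow> lam d \<in> U"
proof -
  let ?G = "(expos k - {tt k}) \<inter> U"
  let ?I = "leading_integral k"
  have I_on: "?I x \<in> hahn_on (expos K)" "?I x \<in> hahn_on (expos k)" for x
    using expos_mono[OF kK] by (auto intro!: hahn_onI simp: coeff_leading_integral split: if_splits)
  have I_diff: "?I (x - y) = ?I x - ?I y" for x y
    by (rule hahn_eqI) (simp add: coeff_leading_integral diff_divide_distrib)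
  obtain y where y: "y \<in> hahn_on ?G" "y + x - deriv K (?I y) = y"
  proof (rule hahn_fixed_point[of ?G "\<lambda>y. y + x - deriv K (?I y)"])
    fix y assume y: "y \<in> hahn_on ?G"
    have "deriv K (?I y) \<in> hahn_on ?G"
    proof (rule hahn_onI)
      fix e assume e: "coeff (deriv K (?I y)) e \<noteq> 0"
      then have "e \<in> expos k" using deriv_on[OF I_on(2)] by (rule_tac hahn_onD)
      moreover have "e \<noteq> tt k" using e coeff_deriv_tt[OF I_on(2)] by blast
      moreover have "e \<in> U"
      proof -
        obtain i where i: "wt i (e - tt i) \<noteq> 0" "coeff (?I y) (e - tt i) \<noteq> 0"
          using e by (rule coeff_deriv_nonzero)
        then have "coeff y (lam (e - tt i)) \<noteq> 0"
          by (auto simp: coeff_leading_integral split: if_splits)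
        then have "lam (e - tt i) \<in> U" using hahn_onD[OF y] by blast
        then show ?thesis using U lam_le[OF i(1)] by simp
      qed
      ultimately show "e \<in> ?G" by blast
    qed
    moreover have "x \<in> hahn_on ?G" using x by (auto simp: hahn_on_def supp_def)
    ultimately show "y + x - deriv K (?I y) \<in> hahn_on ?G"
      using y by (intro hahn_on_add hahn_on_diff)
  next
    fix y1 y2 :: "expo hahn" and e assume on: "y1 \<in> hahn_on ?G" "y2 \<in> hahn_on ?G" and e: "vge (y1 - y2) e"
    let ?y = "y1 - y2"
    have y: "?y \<in> hahn_on ?G" using on by (rule hahn_on_diff)
    have "coeff (deriv K (?I ?y)) e' = coeff ?y e'" if e': "e' \<le> e" for e'
    proof (cases "e' \<in> expos k \<and> e' \<noteq> tt k")
      case True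
      then obtain d where d: "d \<in> expos k" "d \<noteq> 0" "lam d = e'" using lam_surj by metis
      have "coeff (deriv K (?I ?y)) (lam d) = wt (li d) d * coeff (?I ?y) d"
      proof (rule coeff_deriv_lam[OF I_on(1)])
        show "d \<in> expos K" using d(1) expos_mono[OF kK] by blast
        fix c assume "c \<noteq> 0" "coeff (?I ?y) c \<noteq> 0"
        moreover from this have "coeff ?y (lam c) \<noteq> 0"
          by (auto simp: coeff_leading_integral split: if_splits)
        ultimately have "e \<le> lam c" using e unfolding vge_def by (metis not_le)
        then have "lam d \<le> lam c" using d(3) e' by simp
        then show "d \<le> c" using lam_mono_iff d(2) \<open>c \<noteq> 0\<close> by blast
      qed (rule d(2))
      also have "\<dots> = coeff ?y (lam d)"
        using d wt_li[OF d(2)] by (simp add: coeff_leading_integral)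
      finally show ?thesis by (simp add: d(3))
    next
      case False
      then have "coeff ?y e' = 0" using hahn_onD[OF y] by blast
      moreover have "coeff (deriv K (?I ?y)) e' = 0"
        using False hahn_onD[OF deriv_on[OF I_on(2)]] coeff_deriv_tt[OF I_on(2)] by blast
      ultimately show ?thesis by simp
    qed
    then have "vgt (?y - deriv K (?I ?y)) e"
      unfolding vgt_def by (metis coeff_diff diff_self)
    moreover have "y1 + x - deriv K (?I y1) - (y2 + x - deriv K (?I y2)) = ?y - deriv K (?I ?y)"
      by (simp add: I_diff deriv.dd_diff)
    ultimately show "vgt (y1 + x - deriv K (?I y1) - (y2 + x - deriv K (?I y2))) e" by (simp only:)
  qed
  show ?thesis
  proof (rule that[of "?I y"])
    show "deriv K (?I y) = x" using y(2) by (simp add: algebra_simps)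
    show "coeff (?I y) 0 = 0" by (simp add: coeff_leading_integral)
    fix d assume "coeff (?I y) d \<noteq> 0"
    then have "coeff y (lam d) \<noteq> 0" by (auto simp: coeff_leading_integral split: if_splits)
    then show "lam d \<in> U" using hahn_onD[OF y(1)] by blast
  qed (rule I_on)
qed

interpretation level: derivation_subfield "deriv (Suc k)" "tt ` {..Suc k}" "(1, 0)" "expos k" for k
proof
  fix x assume x: "x \<in> hahn_on (expos k)"
  then show "deriv (Suc k) x \<in> hahn_on (expos k)" by (rule deriv_on)
  define c where "c = coeff x (tt k)"
  \<comment> \<open>The exponent of l_{k+1}^{-1}, the one monomial outside level \<open>k\<close>
    that integration of the residue term brings in.\<close>
  let ?m = "tt k - tt (Suc k)"
  have m: "deriv (Suc k) (hmonom (- c) ?m) = hmonom c (tt k)"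
  proof -
    have "wt i ?m = (if i = Suc k then - 1 else 0)" for i by (auto simp: wt_diff wt_tt)
    then have "deriv (Suc k) (hmonom (- c) ?m) =
      (\<Sum>i\<le>Suc k. if i = Suc k then hmonom c (tt k) else 0)"
      unfolding deriv_hmonom by (intro sum.cong) auto
    then show ?thesis by simp
  qed
  have "x - hmonom c (tt k) \<in> hahn_on (expos k)"
    using x by (intro hahn_on_diff hahn_on_hmonom tt_expos) auto
  then obtain y where "deriv (Suc k) y = x - hmonom c (tt k)"
    using integral_exists[of k "Suc k" UNIV "x - hmonom c (tt k)"]
    by (auto simp: c_def coeff_hmonom)
  then have "deriv (Suc k) (y + hmonom (- c) ?m) = x"
    by (simp add: deriv.dd_add m)
  then show "\<exists>y. deriv (Suc k) y = x" ..
qed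


section \<open>Transseries as Hahn series\<close>

lemma Supp_coeff [simp]: "Supp (coeff x) = supp x"
  by (simp add: Supp_def supp_def)

lemma Linf_iff: "f \<in> Linf k \<longleftrightarrow> (\<exists>x\<in>hahn_on (expos k). f = coeff x)"
proof
  assume "f \<in> Linf k"
  then have f: "Supp f \<subseteq> expos k" "wo (Supp f)"
    by (simp_all add: Linf_def expos_def well_order_on_iff_wo)
  then have "coeff (Hahn f) = f" by (intro coeff_Hahn[OF f(2)]) (simp add: Supp_def)
  with f(1) show "\<exists>x\<in>hahn_on (expos k). f = coeff x"
    by (intro bexI[of _ "Hahn f"]) (auto simp: hahn_on_def supp_def Supp_def)
next
  assume "\<exists>x\<in>hahn_on (expos k). f = coeff x"
  then show "f \<in> Linf k"
    by (auto simp: Linf_def hahn_on_def expos_def well_order_on_iff_wo simp del: relation_of_def)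
qed

lemma coeff_eq_iff [simp]: "coeff x = coeff y \<longleftrightarrow> x = y"
  by (rule coeff_inject)

lemma coeff_plus: "coeff x + coeff y = coeff (x + y)"
  and coeff_sub: "coeff x - coeff y = coeff (x - y)"
  and coeff_zero: "(0 :: 'a::linordered_ab_group_add \<Rightarrow> real) = coeff 0"
  by (simp_all add: fun_eq_iff)

lemma monomial_coeff: "monomial d = coeff (hmonom 1 d)"
  by (simp add: fun_eq_iff monomial_def coeff_hmonom del: split_paired_All)

lemma scale_coeff: "scale c (coeff x) = coeff (hmonom c 0 * x)"
  by (simp add: fun_eq_iff scale_def coeff_hmonom_mult)

lemma tmult_coeff: "coeff x \<star> coeff y = coeff (x * y)"
  by (simp add: fun_eq_iff tmult_def coeff_mult del: split_paired_All)

lemma tpow_coeff: "tpow (coeff x) i = coeff (x ^ i)"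
  by (induction i) (simp_all add: tpow_def monomial_coeff one_hahn_def tmult_coeff)

lemma ord_coeff:
  assumes "vge x e" "coeff x e \<noteq> 0"
  shows "ord (coeff x) = e"
  unfolding ord_def Supp_coeff
  by (rule Least_equality) (use assms in \<open>auto simp: vge_iff supp_def\<close>)

lemma ord_less_iff: "x \<noteq> 0 \<Longrightarrow> d < ord (coeff x) \<longleftrightarrow> vgt x d"
proof -
  assume "x \<noteq> 0"
  then obtain e where e: "vge x e" "coeff x e \<noteq> 0" by (rule hahn_order)
  have "d < e" if "vgt x d"
    using that e(2) unfolding vgt_def by (metis not_less)
  then show ?thesis
    using ord_coeff[OF e] vge_less_vgt[OF e(1), of d] by auto
qed

lemma sum_fun_apply: "(\<Sum>i\<in>A. f i) e = (\<Sum>i\<in>A. f i e)" for f :: "'i \<Rightarrow> 'a \<Rightarrow> 'b::comm_monoid_add"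
  by (induction A rule: infinite_finite_induct) auto

lemma monomial_deriv_eq:
  assumes "d \<in> expos K"
  shows "monomial_deriv d e = (\<Sum>i\<le>K. if e = d + tt i then wt i d else 0)"
proof -
  obtain \<alpha> n where d: "d = (\<alpha>, n)" by fastforce
  have n: "Poly_Mapping.keys n \<subseteq> {..<K}" using assms by (simp add: d expos_def int_vecs_def)
  have tt: "(\<alpha> - 1, n + ones i) = d + tt i" for i by (simp add: d tt_def)
  have "monomial_deriv d e = (if e = d + tt 0 then wt 0 d else 0) +
      (\<Sum>i\<in>Poly_Mapping.keys n. if e = d + tt (Suc i) then wt (Suc i) d else 0)"
    unfolding monomial_deriv_def d
    by (simp add: sum_fun_apply scale_def monomial_def tt_def ones_def if_distrib cong: if_cong)
  also have "(\<Sum>i\<in>Poly_Mapping.keys n. if e = d + tt (Suc i) then wt (Suc i) d else 0) =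
      (\<Sum>i<K. if e = d + tt (Suc i) then wt (Suc i) d else 0)"
    by (rule sum.mono_neutral_left) (use n in \<open>auto simp: d in_keys_iff\<close>)
  also have "(if e = d + tt 0 then wt 0 d else 0) + \<dots> = (\<Sum>i\<le>K. if e = d + tt i then wt i d else 0)"
    by (rule sum.atMost_shift[symmetric])
  finally show ?thesis .
qed

lemma tt_inj: "tt i = tt j \<longleftrightarrow> i = j"
  by (metis less_irrefl nat_neq_iff tt_less)

lemma tderiv_coeff:
  assumes x: "x \<in> hahn_on (expos K)"
  shows "tderiv (coeff x) = coeff (deriv K x)"
proof (rule ext)
  fix e
  let ?S = "(\<lambda>i. e - tt i) ` {..K}"
  have inj: "inj_on (\<lambda>i. e - tt i) {..K}" by (auto simp: inj_on_def tt_inj)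
  have "tderiv (coeff x) e = (\<Sum>d\<in>?S. coeff x d * monomial_deriv d e)"
    unfolding tderiv_def termwise_def Supp_coeff
  proof (rule sum.mono_neutral_left)
    show "{d \<in> supp x. monomial_deriv d e \<noteq> 0} \<subseteq> ?S"
    proof
      fix d assume d: "d \<in> {d \<in> supp x. monomial_deriv d e \<noteq> 0}"
      then have "d \<in> expos K" using x by (auto simp: hahn_on_def)
      from monomial_deriv_eq[OF this, of e] d
      have "(\<Sum>i\<le>K. if e = d + tt i then wt i d else 0) \<noteq> 0" by simp
      then obtain i where "i \<in> {..K}" "(if e = d + tt i then wt i d else 0) \<noteq> 0"
        by (rule sum.not_neutral_contains_not_neutral)
      then show "d \<in> ?S" by (auto split: if_splits)
    qed
  qed (auto simp: supp_def)
  also have "\<dots> = (\<Sum>i\<le>K. coeff x (e - tt i) * monomial_deriv (e - tt i) e)"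
    by (simp add: sum.reindex[OF inj])
  also have "\<dots> = (\<Sum>i\<le>K. wt i (e - tt i) * coeff x (e - tt i))"
  proof (rule sum.cong[OF refl])
    fix i assume i: "i \<in> {..K}"
    show "coeff x (e - tt i) * monomial_deriv (e - tt i) e = wt i (e - tt i) * coeff x (e - tt i)"
    proof (cases "coeff x (e - tt i) = 0")
      case False
      then have "e - tt i \<in> expos K" using hahn_onD[OF x] by blast
      from monomial_deriv_eq[OF this, of e]
      have "monomial_deriv (e - tt i) e = (\<Sum>j\<le>K. if j = i then wt i (e - tt i) else 0)"
        by (simp add: eq_diff_eq diff_add_eq algebra_simps tt_inj cong: if_cong)
      also have "\<dots> = wt i (e - tt i)" using i by simp
      finally show ?thesis by simp
    qed simp
  qed
  finally show "tderiv (coeff x) e = coeff (deriv K x) e" by (simp add: coeff_deriv)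
qed

lemma tderiv_funpow_coeff:
  assumes "x \<in> hahn_on (expos K)"
  shows "(tderiv ^^ i) (coeff x) = coeff ((deriv K ^^ i) x)"
proof -
  have "(deriv K ^^ i) x \<in> hahn_on (expos K)" for i
    by (induction i) (use assms in \<open>auto intro: deriv_on\<close>)
  then show ?thesis by (induction i) (auto simp: tderiv_coeff)
qed

abbreviation zz :: "expo hahn" where "zz \<equiv> hmonom 1 (1, 0)"

lemma id_ts_coeff: "id_ts = coeff zz"
  by (simp add: id_ts_def monomial_coeff)

lemma zz_on: "zz \<in> hahn_on (expos k)"
  by (auto intro!: hahn_on_hmonom simp: expos_def int_vecs_def)

lemma hahn_on_mono: "k \<le> K \<Longrightarrow> x \<in> hahn_on (expos k) \<Longrightarrow> x \<in> hahn_on (expos K)"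
  using expos_mono by (auto simp: hahn_on_def)

lemma taylor_term_coeff:
  assumes "x \<in> hahn_on (expos K)"
  shows "taylor_term (coeff x) (coeff u) i = coeff (deriv.tay K u x i)"
proof -
  have "(fact i :: expo hahn) = hmonom (fact i) 0"
    using of_nat_hahn[of "fact i", where 'e = expo] by (simp add: of_nat_fact)
  then have "inverse (fact i :: expo hahn) = hmonom (1 / fact i) 0"
    by (simp add: inverse_hmonom)
  then show ?thesis
    by (simp add: taylor_term_def tderiv_funpow_coeff[OF assms] tpow_coeff scale_coeff tmult_coeff
        deriv.tay_def deriv.dv_def divide_inverse mult_ac)
qed

lemma tcomp_coeff:
  assumes x: "x \<in> hahn_on (expos K)" and u: "vgt u (1, 0)"
  shows "tcomp (coeff x) (coeff (zz + u)) = coeff (deriv.comp K u x)"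
proof (rule ext)
  fix e
  let ?T = "deriv.tay K u x"
  have S: "summ ?T" by (rule deriv.summ_tay[OF u])
  have u_eq: "coeff (zz + u) - id_ts = coeff u"
    by (simp add: id_ts_coeff fun_eq_iff del: split_paired_All)
  let ?I = "{i. 1 \<le> i \<and> coeff (?T i) e \<noteq> 0}"
  have fin: "finite ?I" by (rule finite_subset[OF _ summ_finite[OF S, of e]]) auto
  have "coeff (deriv.comp K u x) e = (\<Sum>i\<in>insert 0 ?I. coeff (?T i) e)"
    unfolding deriv.comp_def by (rule coeff_hsum_superset[OF S]) (use fin in \<open>auto simp: not_less_eq_eq\<close>)
  also have "\<dots> = coeff x e + (\<Sum>i\<in>?I. coeff (?T i) e)"
    using fin by (subst sum.insert) (auto simp: deriv.tay_def)
  finally show "tcomp (coeff x) (coeff (zz + u)) e = coeff (deriv.comp K u x) e"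
    unfolding tcomp_def u_eq taylor_term_coeff[OF x] by simp
qed

section \<open>Parabolic transseries, their group and conjugation\<close>

definition small :: "nat \<Rightarrow> expo hahn set"
  where "small k = {u \<in> hahn_on (expos k). vgt u (1, 0)}"

lemma parabolic_iff: "f \<in> parabolic k \<longleftrightarrow> (\<exists>u\<in>small k. f = coeff (zz + u))"
proof
  assume "f \<in> parabolic k"
  then obtain g where g: "f = id_ts + g" "g \<in> Linf k" "g = 0 \<or> (1, 0) < ord g"
    by (auto simp: parabolic_def Lpos_def)
  obtain u where u: "u \<in> hahn_on (expos k)" "g = coeff u" using g(2) by (auto simp: Linf_iff)
  have "vgt u (1, 0)"
    using g(3) ord_less_iff[of u "(1, 0)"] by (cases "u = 0") (auto simp: u(2) coeff_zero)
  with u g(1) show "\<exists>u\<in>small k. f = coeff (zz + u)"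
    by (auto simp: small_def id_ts_coeff coeff_plus)
next
  assume "\<exists>u\<in>small k. f = coeff (zz + u)"
  then obtain u where u: "u \<in> hahn_on (expos k)" "vgt u (1, 0)" "f = coeff (zz + u)"
    by (auto simp: small_def)
  have "(0 :: expo) < (1, 0)" by (simp add: zero_prod_def)
  then have "coeff u = 0 \<or> (1, 0) < ord (coeff u) \<and> 0 < ord (coeff u)"
    using ord_less_iff[of u] u(2) vgt_mono[OF u(2), of 0]
    by (cases "u = 0") (auto simp: coeff_zero)
  then show "f \<in> parabolic k"
    using u(1,3) by (auto simp: parabolic_def Lpos_def Linf_iff id_ts_coeff coeff_plus[symmetric])
qed

abbreviation cmp :: "nat \<Rightarrow> expo hahn \<Rightarrow> expo hahn \<Rightarrow> expo hahn"
  where "cmp k \<equiv> deriv.comp (Suc k)"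

lemma tcomp_small:
  assumes "x \<in> hahn_on (expos k)" "u \<in> small k"
  shows "tcomp (coeff x) (coeff (zz + u)) = coeff (cmp k u x)"
  using assms hahn_on_mono[of k "Suc k"] by (intro tcomp_coeff) (auto simp: small_def)

lemma cmp_zz: "u \<in> small k \<Longrightarrow> cmp k u zz = zz + u"
  using deriv.comp_z[of u "Suc k"] by (simp add: small_def deriv.z_def)

lemma cmp_add: "u \<in> small k \<Longrightarrow> cmp k u (x + y) = cmp k u x + cmp k u y"
  by (simp add: small_def deriv.comp_add)

lemma cmp_cmp:
  "u \<in> small k \<Longrightarrow> w \<in> small k \<Longrightarrow> cmp k u (cmp k w x) = cmp k (u + cmp k u w) x"
  by (simp add: small_def deriv.comp_comp)

lemma cmp_zero: "cmp k 0 x = x"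
  by (simp add: deriv.comp_decomp)

lemma small_cmp: "u \<in> small k \<Longrightarrow> w \<in> small k \<Longrightarrow> cmp k u w \<in> small k"
  by (simp add: small_def level.comp_on deriv.vgt_comp)

lemma small_add: "u \<in> small k \<Longrightarrow> w \<in> small k \<Longrightarrow> u + w \<in> small k"
  by (simp add: small_def hahn_on_add vgt_add)

lemma tcomp_parabolic:
  assumes "h \<in> small k" "u \<in> small k"
  shows "tcomp (coeff (zz + h)) (coeff (zz + u)) = coeff (zz + (u + cmp k u h))"
proof -
  have "zz + h \<in> hahn_on (expos k)" using assms by (simp add: small_def hahn_on_add zz_on)
  then show ?thesis using assms by (simp add: tcomp_small cmp_add cmp_zz add.assoc)
qed

lemma comp_inverse_coeff:
  assumes h: "h \<in> small k" "h' \<in> small k" "h + cmp k h h' = 0" "h' + cmp k h' h = 0"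
  shows "comp_inverse k (coeff (zz + h)) = coeff (zz + h')"
  unfolding comp_inverse_def
proof (rule the_equality)
  show "coeff (zz + h') \<in> parabolic k \<and> tcomp (coeff (zz + h)) (coeff (zz + h')) = id_ts \<and>
      tcomp (coeff (zz + h')) (coeff (zz + h)) = id_ts"
    using h by (auto simp: parabolic_iff tcomp_parabolic id_ts_coeff)
next
  fix \<psi> assume \<psi>: "\<psi> \<in> parabolic k \<and> tcomp (coeff (zz + h)) \<psi> = id_ts \<and> tcomp \<psi> (coeff (zz + h)) = id_ts"
  then obtain g where g: "g \<in> small k" "\<psi> = coeff (zz + g)" by (auto simp: parabolic_iff)
  then have hg: "h + cmp k h g = 0"
    using \<psi> h(1) by (simp add: tcomp_parabolic id_ts_coeff)
  then have "cmp k h' (cmp k h g) = cmp k h' (cmp k h h')"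
    using h(3) by (metis add_left_imp_eq)
  then show "\<psi> = coeff (zz + h')"
    using h g by (simp add: cmp_cmp cmp_zero)
qed

text \<open>Right composition with z + h is bijective, so conjugation by an explicit inverse can be
  traded for the equation \<phi> \<circ> f = g \<circ> \<phi>.\<close>

lemma conjugate_coeff:
  assumes h: "h \<in> small k" and u: "u \<in> small k"
  shows "\<exists>w\<in>small k. conjugate k (coeff (zz + h)) (coeff (zz + u)) = coeff (zz + w) \<and> level.conjby k h u w"
    and "w \<in> small k \<Longrightarrow>
      conjugate k (coeff (zz + h)) (coeff (zz + u)) = coeff (zz + w) \<longleftrightarrow> level.conjby k h u w"
proof -
  obtain h' where h': "h' \<in> small k" "h + cmp k h h' = 0" "h' + cmp k h' h = 0"
    using level.inverse_exists[of h k] h unfolding small_def by auto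
  let ?v = "u + cmp k u h"
  have v: "?v \<in> small k" using h u by (intro small_add small_cmp)
  have conj: "conjugate k (coeff (zz + h)) (coeff (zz + u)) = coeff (zz + (h' + cmp k h' ?v))"
    unfolding conjugate_def tcomp_parabolic[OF h u] comp_inverse_coeff[OF h h']
      tcomp_parabolic[OF v h'(1)] ..
  have iff: "zz + (h' + cmp k h' ?v) = zz + w \<longleftrightarrow> level.conjby k h u w" if w: "w \<in> small k" for w
  proof -
    have inv: "cmp k h (cmp k h' x) = x" "cmp k h' (cmp k h x) = x" for x
      using h h' by (simp_all add: cmp_cmp cmp_zero)
    have "zz + (h' + cmp k h' ?v) = cmp k h' (zz + ?v)"
      using h' by (simp add: cmp_add cmp_zz add.assoc)
    then have "zz + (h' + cmp k h' ?v) = zz + w \<longleftrightarrow> cmp k h' (zz + ?v) = zz + w" by simp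
    also have "\<dots> \<longleftrightarrow> zz + ?v = cmp k h (zz + w)" using inv by metis
    also have "\<dots> \<longleftrightarrow> level.conjby k h u w"
      using h by (simp add: cmp_add cmp_zz level.conjby_def add.assoc)
    finally show ?thesis .
  qed
  have w0: "h' + cmp k h' ?v \<in> small k" by (rule small_add[OF h'(1) small_cmp[OF h'(1) v]])
  then show "\<exists>w\<in>small k. conjugate k (coeff (zz + h)) (coeff (zz + u)) = coeff (zz + w) \<and> level.conjby k h u w"
    using conj iff[OF w0] by blast
  show "conjugate k (coeff (zz + h)) (coeff (zz + u)) = coeff (zz + w) \<longleftrightarrow> level.conjby k h u w"
    if "w \<in> small k"
    using conj iff[OF that] by simp
qed

section \<open>Reciprocals and integrals of transseries\<close>

lemma tinverse_coeff:
  assumes "x \<in> hahn_on (expos k)" "x \<noteq> 0"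
  shows "tinverse k (coeff x) = coeff (inverse x)"
  unfolding tinverse_def
proof (rule the_equality)
  show "coeff (inverse x) \<in> Linf k \<and> coeff x \<star> coeff (inverse x) = monomial 0"
    using assms expos.hahn_on_inverse[of x k]
    by (auto simp: Linf_iff tmult_coeff monomial_coeff one_hahn_def[symmetric])
next
  fix g assume "g \<in> Linf k \<and> coeff x \<star> g = monomial 0"
  then obtain y where "g = coeff y" "x * y = 1"
    by (auto simp: Linf_iff tmult_coeff monomial_coeff one_hahn_def)
  then show "g = coeff (inverse x)" using inverse_unique by metis
qed

lemma monomial_integral_on:
  assumes d: "d \<in> expos k" "d \<noteq> tt k"
  shows "monomial_integral k d \<in> Linf k"
proof -
  let ?P = "\<lambda>g. g \<in> Linf k \<and> tderiv g = monomial d \<and> g 0 = 0"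
  have "hmonom 1 d \<in> hahn_on (expos k)" using d by (intro hahn_on_hmonom)
  then obtain y where y: "y \<in> hahn_on (expos k)" "deriv k y = hmonom 1 d" "coeff y 0 = 0"
    using integral_exists[of k k UNIV "hmonom 1 d"] d by (auto simp: coeff_hmonom)
  have "?P (coeff y)" using y by (auto simp: Linf_iff tderiv_coeff monomial_coeff)
  moreover have "g = coeff y" if g: "?P g" for g
  proof -
    obtain x where x: "x \<in> hahn_on (expos k)" "g = coeff x"
      using g by (auto simp: Linf_iff)
    then have x': "deriv k x = hmonom 1 d" "coeff x 0 = 0"
      using g by (simp_all add: tderiv_coeff monomial_coeff)
    have xy: "x - y \<in> hahn_on (expos k)" "deriv k (x - y) = 0"
      using x x' y by (auto intro: hahn_on_diff simp: deriv.dd_diff)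
    have "coeff x e = coeff y e" for e
      using deriv_eq_0_imp[OF xy, of e] x' y by (cases "e = 0") auto
    then show ?thesis using x(2) hahn_eqI[of x y] by simp
  qed
  ultimately have "?P (THE g. ?P g)" by (rule theI)
  then show ?thesis using d by (simp add: monomial_integral_def tt_def)
qed

text \<open>All other monomials of level \<open>k\<close> have their integral in level
  \<open>k\<close>, where l_{k+1}, which is entry \<open>k\<close> counted from 0, has exponent
  0.\<close>

lemma tintegral_coeff:
  assumes x: "x \<in> hahn_on (expos k)"
  shows "tintegral k (coeff x) (0, Poly_Mapping.single k (- 1)) = - coeff x (tt k)"
proof -
  let ?e = "(0, Poly_Mapping.single k (- 1)) :: expo"
  have "?e \<notin> expos k" by (auto simp: expos_def int_vecs_def)
  have 0: "monomial_integral k d ?e = 0" if d: "d \<in> supp x" "d \<noteq> tt k" for d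
  proof -
    have "d \<in> expos k" using d(1) x by (auto simp: hahn_on_def)
    then obtain y where "y \<in> hahn_on (expos k)" "monomial_integral k d = coeff y"
      using monomial_integral_on d(2) by (metis Linf_iff)
    then show ?thesis using hahn_onD \<open>?e \<notin> expos k\<close> by metis
  qed
  have 1: "monomial_integral k (tt k) ?e = - 1"
    by (simp add: monomial_integral_def tt_def monomial_def)
  have "tintegral k (coeff x) ?e = (\<Sum>d\<in>{tt k}. coeff x d * monomial_integral k d ?e)"
    unfolding tintegral_def termwise_def Supp_coeff
    by (rule sum.mono_neutral_left) (use 0 in \<open>auto simp: supp_def\<close>)
  then show ?thesis by (simp add: 1)
qed


section \<open>The conjugacy classification\<close>

declare split_paired_All [simp del]

lemma vgtD: "vgt x d \<Longrightarrow> coeff x e \<noteq> 0 \<Longrightarrow> d < e"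
  unfolding vgt_def by (metis not_le)

lemma lam_less_tt:
  assumes "d < 0" "d \<in> expos k"
  shows "lam d < tt k"
proof -
  obtain i where i: "wt i d < 0" "\<And>l. l < i \<Longrightarrow> wt l d = 0"
    using assms(1) unfolding expo_less_iff by auto
  have "d \<noteq> 0" using assms(1) by auto
  then have "li d = i" using li_le[of i d] i wt_li[of d] by (metis le_neq_implies_less less_irrefl)
  moreover from this have "i \<le> k" using li_expos[OF assms(2) \<open>d \<noteq> 0\<close>] by simp
  ultimately show ?thesis
    unfolding expo_less_iff lam_def using i by (intro exI[of _ i]) (auto simp: wt_add wt_tt)
qed

lemma li_minus [simp]: "li (- d) = li d"
  by (simp add: li_def wt_minus)

lemma lam_minus: "lam (- d) + d + d = lam d"
  by (simp add: lam_def)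

lemma tt_less_lam:
  assumes "0 < d" "d \<in> expos k"
  shows "tt k < lam d"
proof -
  obtain i where i: "0 < wt i d" "\<And>l. l < i \<Longrightarrow> wt l d = 0"
    using assms(1) unfolding expo_less_iff by auto
  have "d \<noteq> 0" using assms(1) by auto
  then have "li d = i" using li_le[of i d] i wt_li[of d] by (metis le_neq_implies_less less_irrefl)
  moreover from this have "i \<le> k" using li_expos[OF assms(2) \<open>d \<noteq> 0\<close>] by simp
  ultimately show ?thesis
    unfolding expo_less_iff lam_def using i by (intro exI[of _ i]) (auto simp: wt_add wt_tt)
qed

lemma vgt_deriv_lam:
  assumes "vgt x d" "d \<noteq> 0"
  shows "vgt (deriv K x) (lam d)"
  unfolding vgt_iff
proof
  fix e assume "e \<in> supp (deriv K x)"
  then obtain i where i: "wt i (e - tt i) \<noteq> 0" "coeff x (e - tt i) \<noteq> 0"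
    by (auto simp: supp_def elim: coeff_deriv_nonzero)
  have "d < e - tt i" by (rule vgtD[OF assms(1) i(2)])
  moreover have "e - tt i \<noteq> 0" using i(1) by auto
  ultimately have "lam d < lam (e - tt i)" using lam_less_iff assms(2) by blast
  also have "\<dots> \<le> e" using lam_le[OF i(1)] by simp
  finally show "lam d < e" .
qed

text \<open>If \<open>f - id\<close> has order \<open>e\<close>, then \<open>e + gap e\<close> is the largest exponent of the principal
  part, and \<open>res_exp k e\<close> is the exponent of the residual monomial.\<close>

definition gap :: "expo \<Rightarrow> expo"
  where "gap e = lam ((1, 0) - e) + e"

definition res_exp :: "nat \<Rightarrow> expo \<Rightarrow> expo"
  where "res_exp k e = e + e + tt k"

context
  fixes k :: nat and e :: expo
  assumes e: "(1, 0) < e" "e \<in> expos k"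
begin

lemma shifted_on: "(1, 0) - e \<in> expos k" "e - (1, 0) \<in> expos k"
  using e(2) expos.add_mem[of e k "- (1, 0)"] expos.minus_mem[of "e - (1, 0)" k]
    expos.minus_mem[of "(1, 0)" k] by (auto simp: expos_def int_vecs_def)

lemma gap_nonneg: "0 \<le> gap e"
proof -
  have "(1, 0) - e + tt 0 \<le> lam ((1, 0) - e)"
    unfolding lam_def by (intro add_left_mono tt_le) simp
  then have "(1, 0) - e + tt 0 + e \<le> gap e" unfolding gap_def by (rule add_right_mono)
  moreover have "(1, 0) - e + tt 0 + e = 0"
    by (cases e) (simp add: tt_def ones_def zero_prod_def)
  ultimately show ?thesis by simp
qed

lemma add_gap_less_res: "e + gap e < res_exp k e"
  using lam_less_tt[of "(1, 0) - e" k] e(1) shifted_on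
  by (simp add: gap_def res_exp_def algebra_simps)

text \<open>This is the hypothesis \<open>r \<le> s + p - one\<close> of
  \<open>coeff_abel_diff\<close> for \<open>r = tt k\<close>, \<open>s = gap e\<close> and
  \<open>p = e - (1, 0)\<close>. The right side equals \<open>lam p\<close> with \<open>p\<close>
  positive.\<close>

lemma tt_le_gap: "tt k \<le> gap e + (e - (1, 0)) - (1, 0)"
proof -
  have "tt k < lam (e - (1, 0))" using e(1) shifted_on by (intro tt_less_lam) simp_all
  also have "lam (e - (1, 0)) = gap e + (e - (1, 0)) - (1, 0)"
    using lam_minus[of "e - (1, 0)"] by (simp add: gap_def algebra_simps)
  finally show ?thesis by simp
qed

end

lemma small_order:
  assumes "u \<in> small k" "coeff u e \<noteq> 0"
  shows "(1, 0) < e" "e \<in> expos k"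
  using assms vgtD[of u "(1, 0)" e] hahn_onD[of u "expos k" e] by (simp_all add: small_def)

text \<open>Agreement up to \<open>e + gap e\<close> already gives the order bound required of the
  integral of \<open>A - B\<close>; what remains is that this integral exists in level
  \<open>k\<close>.\<close>

lemma conjby_iff_residue:
  assumes u: "u \<in> small k" "vge u e" "coeff u e \<noteq> 0"
    and w: "w \<in> small k" "vge w e" "coeff w e \<noteq> 0"
    and uw: "vgt (u - w) (e + gap e)"
  shows "(\<exists>h\<in>small k. level.conjby k h u w) \<longleftrightarrow> coeff (1 / u - 1 / w) (tt k) = 0"
proof -
  note e = small_order[OF u(1,3)]
  define p where "p = e - (1, 0)"
  have pe: "(1, 0) + p = e" and p: "0 < p" using e(1) by (simp_all add: p_def)
  have nz: "u \<noteq> 0" "w \<noteq> 0" using u(3) w(3) by auto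
  have u': "vgt u (1, 0)" "u \<in> hahn_on (expos k)" and w': "vgt w (1, 0)" "w \<in> hahn_on (expos k)"
    using u(1) w(1) by (auto simp: small_def)
  obtain A where A: "level.abel k u A" using level.abel_exists[OF u'] .
  obtain B where B: "level.abel k w B" using level.abel_exists[OF w'] .
  note orders = u'(1) u(2,3)[folded pe] u'(2) w'(1) w(2,3)[folded pe] w'(2) p A B
  have uw': "vgt (u - w) ((1, 0) + p + gap e)" using uw by (simp add: pe)
  have res: "coeff (A - B) (tt k) = coeff (1 / u - 1 / w) (tt k)"
    by (rule level.coeff_abel_diff[OF orders gap_nonneg[OF e] uw'])
      (use tt_le_gap[OF e] in \<open>auto simp: p_def coeff_deriv_tt\<close>)
  have lamgap: "- e + gap e = lam ((1, 0) - e)" by (simp add: gap_def)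
  have AB: "vgt (A - B) (lam ((1, 0) - e))"
    using level.vgt_abel_diff[OF orders uw'] unfolding pe lamgap .
  have B_ord: "vge B (- e)" "coeff B (- e) \<noteq> 0"
    using level.abel_order[OF w'(1) w(2,3) B] w(3) by auto
  have AB_on: "A - B \<in> hahn_on (expos k)"
    using A B by (auto simp: level.abel_def intro: hahn_on_diff)
  show ?thesis
    unfolding res[symmetric]
  proof
    assume "\<exists>h\<in>small k. level.conjby k h u w"
    then obtain h where h: "vgt h (1, 0)" "h \<in> hahn_on (expos k)" "level.conjby k h u w"
      by (auto simp: small_def)
    obtain r where "r \<in> hahn_on (expos k)" "A - B = deriv (Suc k) r"
      using level.conjby_imp_abel[OF h(1,2) u'(1) nz(1) w'(1) nz(2) A B B_ord(1) h(3)] by metis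
    then show "coeff (A - B) (tt k) = 0" using coeff_deriv_tt by metis
  next
    assume 0: "coeff (A - B) (tt k) = 0"
    have ne: "(1, 0) - e \<noteq> 0" using e(1) by auto
    \<comment> \<open>\<open>U\<close> transports the bound through integration, since
      \<open>lam\<close> reflects the order of nonzero exponents.\<close>
    define U where "U = {d. lam ((1, 0) - e) < d}"
    have up: "d' \<in> U" if "d \<in> U" "d \<le> d'" for d d'
      using that by (simp add: U_def less_le_trans)
    have supp: "supp (A - B) \<subseteq> U" using AB by (auto simp: U_def vgt_iff)
    obtain r where r: "r \<in> hahn_on (expos k)" "deriv (Suc k) r = A - B" "coeff r 0 = 0"
      "\<And>d. coeff r d \<noteq> 0 \<Longrightarrow> lam d \<in> U"
    proof (rule integral_exists[of k "Suc k" U "A - B", OF _ _ AB_on 0 supp])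
      show "d' \<in> U" if "d \<in> U" "d \<le> d'" for d d' using that by (rule up)
    qed simp_all
    have "vgt r ((1, 0) + - e)"
      unfolding vgt_iff
    proof
      fix d assume "d \<in> supp r"
      then have "coeff r d \<noteq> 0" by (simp add: supp_def)
      moreover from this have "d \<noteq> 0" using r(3) by auto
      ultimately have "(1, 0) - e < d" using r(4)[of d] lam_less_iff[OF ne, of d] by (simp add: U_def)
      then show "(1, 0) + - e < d" by simp
    qed
    from level.abel_imp_conjby[OF u'(1) nz(1) w'(1) nz(2) A B B_ord r(1) this r(2)[symmetric]]
    show "\<exists>h\<in>small k. level.conjby k h u w" by (metis (mono_tags, lifting) CollectI small_def)
  qed
qed

text \<open>\<open>A - B\<close> has order above that of \<open>B\<close>, so \<open>A\<close> and
  \<open>B\<close>, and with them \<open>u\<close> and \<open>w\<close>, share their orders. Then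
  \<open>lam\<close> sharpens the bound on the derivative of \<open>r\<close>, which is carried back
  to \<open>u - w\<close>.\<close>

lemma conjby_head:
  assumes h: "h \<in> small k" and u: "u \<in> small k" "vge u e" "coeff u e \<noteq> 0"
    and w: "w \<in> small k" and conj: "level.conjby k h u w"
  shows "vge w e" "coeff w e \<noteq> 0" "vgt (u - w) (e + gap e)"
proof -
  note e = small_order[OF u(1,3)]
  have u': "vgt u (1, 0)" "u \<in> hahn_on (expos k)" and w': "vgt w (1, 0)" "w \<in> hahn_on (expos k)"
    and h': "vgt h (1, 0)" "h \<in> hahn_on (expos k)"
    using u(1) w h by (auto simp: small_def)
  have u0: "u \<noteq> 0" using u(3) by auto
  \<comment> \<open>If z + u were conjugate to the identity, z + h would be invariant under z + u
    and hence constant, but its derivative has constant term 1.\<close>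
  have w0: "w \<noteq> 0"
  proof
    assume "w = 0"
    then have "deriv.comp (Suc k) u (zz + h) = zz + h"
      using conj u(1) by (simp add: level.conjby_def cmp_add cmp_zz deriv.comp_decomp[OF h'(1)] deriv.taylor_rem_0[OF h'(1)] add.assoc)
    then have "deriv (Suc k) (zz + h) = 0" by (rule level.comp_fixed_imp_const[OF u'(1) u0])
    then have "1 + deriv (Suc k) h = 0" by (simp add: deriv.dd_add deriv.dd_z)
    then have "coeff (1 + deriv (Suc k) h) 0 = coeff 0 0" by simp
    moreover have "coeff (deriv (Suc k) h) 0 = 0"
      using deriv.vgt_dd[OF h'(1)] by (simp add: vgt_iff_vge)
    ultimately show False by (simp add: one_hahn_def coeff_hmonom)
  qed
  obtain d where d: "vge w d" "coeff w d \<noteq> 0" using hahn_order[OF w0] .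
  obtain A where A: "level.abel k u A" using level.abel_exists[OF u'] .
  obtain B where B: "level.abel k w B" using level.abel_exists[OF w'] .
  note A_ord = level.abel_order[OF u'(1) u(2,3) A] and B_ord = level.abel_order[OF w'(1) d B]
  obtain r where r: "r \<in> hahn_on (expos k)" "vgt r ((1, 0) + - d)" "A - B = deriv (Suc k) r"
    using level.conjby_imp_abel[OF h' u'(1) u0 w'(1) w0 A B B_ord(1) conj] .
  have "vgt (A - B) (- d)"
    using deriv.vgt_dd[OF r(2), of "Suc k"] by (simp add: r(3))
  then have "vge (B + (A - B)) (- d)" "coeff (A - B) (- d) = 0"
    using B_ord(1) by (simp_all only: vgt_iff_vge vge_add)
  then have A_d: "vge A (- d)" "coeff A (- d) \<noteq> 0" using B_ord(2) d(2) by auto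
  have "coeff A (- e) \<noteq> 0" using A_ord(2) u(3) by simp
  then have "- d \<le> - e" "- e \<le> - d"
    using A_d A_ord(1) by (auto simp: vge_iff supp_def)
  then have de: "d = e" by simp
  show w_ord: "vge w e" "coeff w e \<noteq> 0" using d de by auto
  define p where "p = e - (1, 0)"
  have pe: "(1, 0) + p = e" and p: "0 < p" using e(1) by (simp_all add: p_def)
  note orders = u'(1) u(2,3)[folded pe] u'(2) w'(1) w_ord[folded pe] w'(2) p A B
  have "vgt (A - B) (lam ((1, 0) - e))"
    using vgt_deriv_lam[of r "(1, 0) - e" "Suc k"] r(2,3) e(1) de by simp
  then have "vgt (A - B) (- ((1, 0) + p) + gap e)" by (simp add: pe gap_def)
  from level.vgt_diff_of_abel[OF orders this] show "vgt (u - w) (e + gap e)" by (simp add: pe)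
qed

lemma inverse_diff_residue:
  assumes u: "vge u e" "coeff u e = a" and w: "vge w e" "coeff w e = a" and a: "a \<noteq> 0"
    and uw: "vge (u - w) (res_exp k e)"
  shows "coeff (1 / u - 1 / w) (tt k) = - coeff (u - w) (res_exp k e) / a\<^sup>2"
proof -
  have nz: "u \<noteq> 0" "w \<noteq> 0" using assms by auto
  have inv: "vge (inverse u) (- e)" "vge (inverse w) (- e)"
    "coeff (inverse u) (- e) = 1 / a" "coeff (inverse w) (- e) = 1 / a"
    using hahn_inverse_order[of u e] hahn_inverse_order[of w e] assms by auto
  have "1 / u - 1 / w = - ((u - w) * (inverse u * inverse w))"
    using nz by (simp add: field_simps)
  moreover have "tt k = res_exp k e + (- e + - e)" by (simp add: res_exp_def)
  ultimately show ?thesis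
    using coeff_mult_lead[OF uw vge_mult[OF inv(1,2)]] coeff_mult_lead[OF inv(1,2)]
    by (simp only: coeff_minus inv) (simp add: power2_eq_square minus_divide_left)
qed

subsection \<open>The normal form\<close>

definition truncate :: "expo hahn \<Rightarrow> expo \<Rightarrow> expo hahn"
  where "truncate x e = Hahn (\<lambda>d. if d \<le> e then coeff x d else 0)"

lemma coeff_truncate: "coeff (truncate x e) d = (if d \<le> e then coeff x d else 0)"
  unfolding truncate_def by (subst coeff_Hahn[OF wo_supp[of x]]) (auto simp: supp_def)

definition nform :: "nat \<Rightarrow> expo hahn \<Rightarrow> expo \<Rightarrow> real \<Rightarrow> expo hahn"
  where "nform k u e c = truncate u (e + gap e) + hmonom c (res_exp k e)"

context
  fixes k u e
  assumes u: "u \<in> small k" "vge u e" "coeff u e \<noteq> 0"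
begin

lemma truncate_small: "truncate u d \<in> small k"
  using u(1) unfolding small_def vgt_def
  by (auto simp: coeff_truncate hahn_on_def supp_def split: if_splits)

lemma truncate_order: "vge (truncate u (e + gap e)) e" "coeff (truncate u (e + gap e)) e = coeff u e"
  using u(2) gap_nonneg[OF small_order[OF u(1,3)]] by (auto simp: vge_def coeff_truncate)

lemma res_exp_props: "e < res_exp k e" "e + gap e < res_exp k e" "res_exp k e \<in> expos k"
proof -
  note e = small_order[OF u(1,3)]
  show *: "e + gap e < res_exp k e" by (rule add_gap_less_res[OF e])
  have "e \<le> e + gap e" using gap_nonneg[OF e] by simp
  then show "e < res_exp k e" using * by (rule le_less_trans)
  show "res_exp k e \<in> expos k"
    using e(2) tt_expos[of k k] by (auto simp: res_exp_def intro!: expos.add_mem)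
qed

lemma nform_small: "nform k u e c \<in> small k"
proof -
  have "(1, 0) < res_exp k e" using small_order(1)[OF u(1,3)] res_exp_props(1) by simp
  then have "vgt (hmonom c (res_exp k e)) (1, 0)" by (rule vge_less_vgt[OF vge_hmonom[OF order_refl]])
  then have "hmonom c (res_exp k e) \<in> small k"
    using res_exp_props(3) by (simp add: small_def hahn_on_hmonom)
  then show ?thesis unfolding nform_def by (intro small_add truncate_small)
qed

lemma nform_order: "vge (nform k u e c) e" "coeff (nform k u e c) e = coeff u e"
proof -
  show "vge (nform k u e c) e"
    unfolding nform_def
    by (intro vge_add truncate_order vge_hmonom less_imp_le res_exp_props(1))
  show "coeff (nform k u e c) e = coeff u e"
    using res_exp_props(1) by (auto simp: nform_def coeff_hmonom truncate_order(2))
qed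

lemma vgt_nform: "vgt (u - nform k u e c) (e + gap e)"
  unfolding vgt_def
proof (intro allI impI)
  fix d assume d: "d \<le> e + gap e"
  then have "d \<noteq> res_exp k e" using res_exp_props(2) by auto
  with d show "coeff (u - nform k u e c) d = 0"
    by (simp add: nform_def coeff_truncate coeff_hmonom)
qed

text \<open>The residual term shifts the residue of the reciprocal by -c / a^2, with a the leading
  coefficient, so a single \<open>c\<close> balances the residues. The reciprocal of the truncated
  series accounts for the residue that the principal part has by itself.\<close>

lemma conjby_nform_iff:
  "(\<exists>h\<in>small k. level.conjby k h u (nform k u e c)) \<longleftrightarrow>
    c = - (coeff u e)\<^sup>2 * (coeff (1 / u) (tt k) - coeff (1 / truncate u (e + gap e)) (tt k))"
proof -
  let ?t = "truncate u (e + gap e)" and ?w = "nform k u e c" and ?a = "coeff u e"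
  have diff: "?w - ?t = hmonom c (res_exp k e)"
    by (simp only: nform_def add_diff_cancel_left')
  have "coeff (1 / ?w - 1 / ?t) (tt k) = - c / ?a\<^sup>2"
    using inverse_diff_residue[OF nform_order[of c] truncate_order u(3), of k]
    by (simp add: diff vge_hmonom coeff_hmonom)
  moreover have "(\<exists>h\<in>small k. level.conjby k h u ?w) \<longleftrightarrow> coeff (1 / u - 1 / ?w) (tt k) = 0"
    by (rule conjby_iff_residue[OF u nform_small nform_order(1) _ vgt_nform])
      (use u(3) in \<open>simp add: nform_order\<close>)
  ultimately have "(\<exists>h\<in>small k. level.conjby k h u ?w) \<longleftrightarrow>
      coeff (1 / u) (tt k) - coeff (1 / ?t) (tt k) = - c / ?a\<^sup>2"
    unfolding coeff_diff by linarith
  also have "\<dots> \<longleftrightarrow> c = - ?a\<^sup>2 * (coeff (1 / u) (tt k) - coeff (1 / ?t) (tt k))"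
    using u(3) by (auto simp: field_simps)
  finally show ?thesis .
qed

text \<open>Conjugation preserves the coefficients up to the end of the principal part by
  \<open>conjby_head\<close>. When all coefficients below the residual exponent agree, the residue
  of the reciprocal determines the next one.\<close>

lemma nform_minimal:
  assumes h: "h \<in> small k" and w: "w \<in> small k" and conj: "level.conjby k h (nform k u e c) w"
  shows "\<And>d. d \<le> e + gap e \<Longrightarrow> coeff w d = coeff (nform k u e c) d"
    and "(\<And>d. d < res_exp k e \<Longrightarrow> coeff w d = coeff (nform k u e c) d) \<Longrightarrow>
      coeff w (res_exp k e) = coeff (nform k u e c) (res_exp k e)"
proof -
  let ?v = "nform k u e c"
  have v: "?v \<in> small k" "vge ?v e" "coeff ?v e \<noteq> 0"
    using nform_small nform_order u(3) by auto
  note head = conjby_head[OF h v w conj]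
  show *: "coeff w d = coeff ?v d" if "d \<le> e + gap e" for d
    using head(3) that unfolding vgt_def by (metis coeff_diff right_minus_eq)
  assume eq: "\<And>d. d < res_exp k e \<Longrightarrow> coeff w d = coeff ?v d"
  then have vge: "vge (?v - w) (res_exp k e)" by (simp add: vge_def del: split_paired_All)
  have we: "coeff w e = coeff ?v e" using eq res_exp_props(1) by simp
  have "coeff (1 / ?v - 1 / w) (tt k) = 0"
    using conjby_iff_residue[OF v w head] h conj by blast
  then have "coeff (?v - w) (res_exp k e) = 0"
    using inverse_diff_residue[OF v(2) refl head(1) we v(3) vge] v(3) by simp
  then show "coeff w (res_exp k e) = coeff ?v (res_exp k e)" by simp
qed

end

section \<open>Principal part and normal form as Hahn series\<close>

lemma last_index_eq:
  assumes "(1, 0) < (\<beta>, n)"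
  shows "(\<beta>, last_index \<beta> n) = (\<beta>, n) + gap (\<beta>, n)"
proof (cases "\<beta> = 1")
  case True
  have sub: "(1, 0) - (\<beta>, n) = (0, - n)" using True by simp
  have "n \<noteq> 0" using assms True by auto
  then have ex: "\<exists>i. Poly_Mapping.lookup n i \<noteq> 0" by (metis lookup_zero poly_mapping_eqI)
  \<comment> \<open>Entry \<open>i\<close> of \<open>n\<close> is weight \<open>Suc i\<close>,
    because weight 0 belongs to z.\<close>
  have "li (0, - n) = Suc (LEAST i. Poly_Mapping.lookup n i \<noteq> 0)"
    unfolding li_def
  proof (rule Least_equality)
    show "wt (Suc (LEAST i. Poly_Mapping.lookup n i \<noteq> 0)) (0, - n) \<noteq> 0"
      using LeastI_ex[OF ex] by simp
    fix i assume "wt i (0, - n) \<noteq> 0"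
    then show "Suc (LEAST i. Poly_Mapping.lookup n i \<noteq> 0) \<le> i"
      by (cases i) (auto intro: Least_le)
  qed
  then show ?thesis
    unfolding gap_def sub lam_def by (simp add: last_index_def True tt_def)
next
  case False
  have "li ((1, 0) - (\<beta>, n)) = 0"
    unfolding li_def by (rule Least_equality) (use False in auto)
  then show ?thesis
    unfolding gap_def lam_def by (simp add: last_index_def False tt_def ones_def)
qed

lemma res_expo_eq:
  assumes "vge u e" "coeff u e \<noteq> 0"
  shows "res_expo (coeff (zz + u)) k = res_exp k e"
proof -
  have "coeff (zz + u) - id_ts = coeff u" by (simp add: id_ts_coeff coeff_sub)
  then show ?thesis
    unfolding res_expo_def using ord_coeff[OF assms]
    by (cases e) (simp add: res_exp_def tt_def algebra_simps)
qed

lemma principal_part_coeff: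
  assumes u: "u \<in> small k" "vge u (\<beta>, n)" "coeff u (\<beta>, n) \<noteq> 0"
  shows "principal_part (coeff (zz + u)) =
    coeff (hmonom 1 (- \<beta>, 0) * truncate u ((\<beta>, n) + gap (\<beta>, n)))"
proof (rule ext)
  fix e :: expo
  obtain \<alpha> m where e: "e = (\<alpha>, m)" by fastforce
  note order = small_order[OF u(1,3)]
  have sub: "coeff (zz + u) - id_ts = coeff u" by (simp add: id_ts_coeff coeff_sub)
  have rhs: "coeff (hmonom 1 (- \<beta>, 0) * truncate u ((\<beta>, n) + gap (\<beta>, n))) (\<alpha>, m) =
      (if (\<alpha> + \<beta>, m) \<le> (\<beta>, last_index \<beta> n) then coeff u (\<alpha> + \<beta>, m) else 0)"
    by (simp add: coeff_hmonom_mult coeff_truncate last_index_eq[OF order(1)])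
  \<comment> \<open>Coefficients are read off f rather than f - id; the term z of f sits at (1, 0),
    below all exponents concerned.\<close>
  have z: "coeff zz (\<beta>, m) = 0" if "n \<le> m" for m
    using order(1) that by (auto simp: coeff_hmonom)
  show "principal_part (coeff (zz + u)) e =
      coeff (hmonom 1 (- \<beta>, 0) * truncate u ((\<beta>, n) + gap (\<beta>, n))) e"
  proof (cases "(\<beta>, n) \<le> (\<alpha> + \<beta>, m)")
    case False
    then have "coeff u (\<alpha> + \<beta>, m) = 0" using u(2) by (auto simp: vge_def not_le)
    then show ?thesis
      unfolding e rhs principal_part_def sub ord_coeff[OF u(2,3)]
      using False by (auto simp: scale_def monomial_def)
  next
    case True
    then show ?thesis
      unfolding e rhs principal_part_def sub ord_coeff[OF u(2,3)]
      using order(1) z[of m] z[of n]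
      by (auto simp: scale_def monomial_def last_index_def)
  qed
qed

lemma normal_form_coeff:
  assumes u: "u \<in> small k" "vge u e" "coeff u e \<noteq> 0"
  shows "normal_form k (coeff (zz + u)) c = coeff (zz + nform k u e c)"
proof -
  obtain \<beta> n where e: "e = (\<beta>, n)" by fastforce
  have sub: "coeff (zz + u) - id_ts = coeff u" by (simp add: id_ts_coeff coeff_sub)
  have "hmonom 1 (\<beta>, 0) * (hmonom 1 (- \<beta>, 0) * x) = x" for x :: "expo hahn"
    by (simp add: mult.assoc[symmetric] hmonom_mult one_hahn_def[symmetric] zero_prod_def[symmetric])
  then show ?thesis
    unfolding normal_form_def sub ord_coeff[OF u(2,3)] res_expo_eq[OF u(2,3)]
      principal_part_coeff[OF u[unfolded e], folded e]
    by (simp add: e id_ts_coeff monomial_coeff tmult_coeff scale_coeff hmonom_mult coeff_plus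
        nform_def add.assoc)
qed


lemma truncate_gap_monomial:
  assumes "vge u (\<beta>, n)" "(1, 0) < (\<beta>, n)" "\<beta> \<noteq> 1"
  shows "truncate u ((\<beta>, n) + gap (\<beta>, n)) = hmonom (coeff u (\<beta>, n)) (\<beta>, n)"
proof (rule hahn_eqI)
  fix d
  have "(\<beta>, n) + gap (\<beta>, n) = (\<beta>, n)"
    using last_index_eq[OF assms(2)] assms(3) by (simp add: last_index_def)
  moreover have "coeff u d = 0" if "d < (\<beta>, n)" using assms(1) that by (simp add: vge_def)
  ultimately show "coeff (truncate u ((\<beta>, n) + gap (\<beta>, n))) d = coeff (hmonom (coeff u (\<beta>, n)) (\<beta>, n)) d"
    by (simp add: coeff_truncate coeff_hmonom le_less)
qed

theorem mainTheorem1: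
  fixes k :: nat and f L :: transseries and \<beta> a :: real and n :: "nat \<Rightarrow>\<^sub>0 int"
    and fc :: "real \<Rightarrow> transseries"
  assumes "f \<in> parabolic k" and "f \<noteq> id_ts"
    and "(\<beta>, n) = ord (f - id_ts)"
    and "a = f (\<beta>, n)"
    and "L = principal_part f"
    and "fc = normal_form k f"
  shows
    "(\<exists>c. \<exists>\<phi>\<in>parabolic k. conjugate k \<phi> f = fc c) \<and>
     (\<exists>!c. \<exists>\<phi>\<in>parabolic k. conjugate k \<phi> f = fc c) \<and>
     (\<forall>c. (\<exists>\<phi>\<in>parabolic k. conjugate k \<phi> f = fc c) \<longrightarrow>
       (\<beta> = 1 \<longrightarrow>
         c = - (scale (a\<^sup>2) (tinverse k (f - id_ts)) (-1, ones k)
                - scale (a\<^sup>2) (tinverse k (monomial (1, 0) \<star> L)) (-1, ones k)) \<and>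
         c = scale (a\<^sup>2) (tintegral k (tinverse k (f - id_ts))) (0, Poly_Mapping.single k (-1))
             + scale (a\<^sup>2) (tinverse k (monomial (1, 0) \<star> L)) (-1, ones k)) \<and>
       (\<beta> > 1 \<longrightarrow>
         c = - scale (a\<^sup>2) (tinverse k (f - id_ts)) (-1, ones k) \<and>
         c = scale (a\<^sup>2) (tintegral k (tinverse k (f - id_ts))) (0, Poly_Mapping.single k (-1))) \<and>
       (\<forall>\<psi>\<in>parabolic k.
         \<not> Supp (conjugate k \<psi> (fc c)) \<subset> Supp (fc c) \<and>
         (\<forall>e \<le> (\<beta>, last_index \<beta> n). conjugate k \<psi> (fc c) e = fc c e) \<and>
         ((\<forall>e < res_expo f k. conjugate k \<psi> (fc c) e = fc c e) \<longrightarrow>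
            conjugate k \<psi> (fc c) (res_expo f k) = fc c (res_expo f k))))"
proof -
  obtain u where u: "u \<in> small k" and f: "f = coeff (zz + u)"
    using assms(1) by (auto simp: parabolic_iff)
  have "u \<noteq> 0" using assms(2) f by (auto simp: id_ts_coeff)
  have sub: "f - id_ts = coeff u" by (simp add: f id_ts_coeff coeff_sub)
  define e where "e = (\<beta>, n)"
  obtain d where "vge u d" "coeff u d \<noteq> 0" using hahn_order[OF \<open>u \<noteq> 0\<close>] .
  then have ue: "vge u e" "coeff u e \<noteq> 0"
    using ord_coeff[of u d] assms(3) by (auto simp: sub e_def)
  note u_all = u ue and order = small_order[OF u ue(2)]
  have a: "a = coeff u e"
    using order(1) by (auto simp: assms(4) f e_def coeff_hmonom)
  define t where "t = truncate u (e + gap e)"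
  define r where "r = res_exp k e"
  have t: "t \<in> hahn_on (expos k)" "t \<noteq> 0"
    using truncate_small[OF u_all] truncate_order(2)[OF u_all] ue(2)
    by (auto simp: t_def small_def)
  have fc: "fc c = coeff (zz + nform k u e c)" for c
    by (simp add: assms(6) f normal_form_coeff[OF u_all])
  have res: "res_expo f k = r" by (simp add: f res_expo_eq[OF ue] r_def)
  have head: "(\<beta>, last_index \<beta> n) = e + gap e"
    using last_index_eq order(1) by (simp add: e_def)
  have u_on: "u \<in> hahn_on (expos k)" using u by (simp add: small_def)
  have inv_u: "tinverse k (f - id_ts) = coeff (inverse u)"
    by (simp add: sub tinverse_coeff u_on \<open>u \<noteq> 0\<close>)
  have inv_t: "tinverse k (monomial (1, 0) \<star> L) = coeff (inverse t)" if "\<beta> = 1"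
  proof -
    have "monomial (1, 0) \<star> L = coeff t"
      unfolding assms(5) f principal_part_coeff[OF u_all[unfolded e_def]]
      using that by (simp add: t_def e_def monomial_coeff tmult_coeff mult.assoc[symmetric] hmonom_mult
        one_hahn_def[symmetric] zero_prod_def[symmetric])
    then show ?thesis by (simp add: tinverse_coeff t)
  qed
  have int_u: "tintegral k (coeff (inverse u)) (0, Poly_Mapping.single k (- 1)) = - coeff (inverse u) (tt k)"
    by (rule tintegral_coeff[OF expos.hahn_on_inverse[OF u_on]])
  define C where "C = - a\<^sup>2 * (coeff (inverse u) (tt k) - coeff (inverse t) (tt k))"
  \<comment> \<open>This equivalence settles existence, uniqueness and the formula for c
    together.\<close>
  have conj_iff: "(\<exists>\<phi>\<in>parabolic k. conjugate k \<phi> f = fc c) \<longleftrightarrow> c = C" for c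
  proof -
    have "(\<exists>\<phi>\<in>parabolic k. conjugate k \<phi> f = fc c) \<longleftrightarrow>
        (\<exists>h\<in>small k. conjugate k (coeff (zz + h)) f = fc c)"
      unfolding Bex_def parabolic_iff by blast
    also have "\<dots> \<longleftrightarrow> (\<exists>h\<in>small k. level.conjby k h u (nform k u e c))"
      unfolding f fc
      by (intro bex_cong refl conjugate_coeff(2) u nform_small[OF u_all])
    also have "\<dots> \<longleftrightarrow> c = C"
      unfolding conjby_nform_iff[OF u_all] by (simp add: C_def a t_def divide_inverse)
    finally show ?thesis .
  qed
  \<comment> \<open>Here 1 / t is a single monomial with z-exponent -\<beta>, which differs from
    -1.\<close>
  have gt1: "coeff (inverse t) (tt k) = 0" if "\<beta> > 1"
  proof -
    have "t = hmonom a e"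
      using truncate_gap_monomial[of u \<beta> n] ue(1) order(1) that by (simp add: t_def e_def a)
    then show ?thesis
      using that ue(2) a by (simp add: inverse_hmonom coeff_hmonom e_def tt_def)
  qed
  have minimal: "\<not> Supp (conjugate k \<psi> (fc c)) \<subset> Supp (fc c) \<and>
      (\<forall>d \<le> e + gap e. conjugate k \<psi> (fc c) d = fc c d) \<and>
      ((\<forall>d < r. conjugate k \<psi> (fc c) d = fc c d) \<longrightarrow> conjugate k \<psi> (fc c) r = fc c r)"
    if \<psi>: "\<psi> \<in> parabolic k" for \<psi> c
  proof -
    obtain h where h: "h \<in> small k" "\<psi> = coeff (zz + h)" using \<psi> by (auto simp: parabolic_iff)
    let ?v = "nform k u e c"
    obtain w where w: "w \<in> small k" "conjugate k \<psi> (fc c) = coeff (zz + w)" "level.conjby k h ?v w"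
      using conjugate_coeff(1)[OF h(1) nform_small[OF u_all]] by (auto simp: h(2) fc)
    note min = nform_minimal[OF u_all h(1) w(1,3), folded r_def]
    have le: "\<forall>d \<le> e + gap e. coeff (zz + w) d = coeff (zz + ?v) d"
      using min(1) by simp
    have lt: "coeff (zz + w) r = coeff (zz + ?v) r" if "\<forall>d < r. coeff (zz + w) d = coeff (zz + ?v) d"
      using min(2) that by simp
    \<comment> \<open>A smaller support would force equality at all exponents other than
      \<open>r\<close>, and then at \<open>r\<close> by invariance of the residual coefficient, so
      the inclusion could not be proper.\<close>
    have "\<not> supp (zz + w) \<subset> supp (zz + ?v)"
    proof
      assume sub: "supp (zz + w) \<subset> supp (zz + ?v)"
      \<comment> \<open>Apart from the residual monomial, all exponents of \<open>fc c\<close> are at most \<open>e + gap e\<close>.\<close>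
      have v: "coeff (zz + ?v) d = 0" if "\<not> d \<le> e + gap e" "d \<noteq> r" for d
      proof -
        have "e \<le> e + gap e" using gap_nonneg[OF order] by simp
        then have "(1, 0) \<le> e + gap e" using order(1) by (meson le_less_trans less_imp_le order_trans)
        then show ?thesis
          using that by (auto simp: nform_def coeff_hmonom coeff_truncate r_def)
      qed
      have "coeff (zz + w) d = coeff (zz + ?v) d" if "d \<noteq> r" for d
        using le v[OF _ that] sub by (cases "d \<le> e + gap e") (auto simp: in_supp_iff simp del: coeff_add)
      moreover from this have "coeff (zz + w) r = coeff (zz + ?v) r"
        by (intro lt) (auto simp del: coeff_add)
      ultimately have "zz + w = zz + ?v" by (intro hahn_eqI) metis
      with sub show False by simp
    qed
    moreover have "conjugate k \<psi> (coeff (zz + ?v)) = coeff (zz + w)" using w(2) unfolding fc .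
    ultimately show ?thesis using le lt by (simp only: fc Supp_coeff) blast
  qed
  have "(\<beta> = 1 \<longrightarrow>
         C = - (scale (a\<^sup>2) (tinverse k (f - id_ts)) (-1, ones k)
                - scale (a\<^sup>2) (tinverse k (monomial (1, 0) \<star> L)) (-1, ones k)) \<and>
         C = scale (a\<^sup>2) (tintegral k (tinverse k (f - id_ts))) (0, Poly_Mapping.single k (-1))
             + scale (a\<^sup>2) (tinverse k (monomial (1, 0) \<star> L)) (-1, ones k))"
    using inv_t by (simp add: scale_def int_u inv_u C_def tt_def[symmetric] algebra_simps)
  moreover have "(\<beta> > 1 \<longrightarrow>
         C = - scale (a\<^sup>2) (tinverse k (f - id_ts)) (-1, ones k) \<and>
         C = scale (a\<^sup>2) (tintegral k (tinverse k (f - id_ts))) (0, Poly_Mapping.single k (-1)))"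
    using gt1 by (simp add: scale_def int_u inv_u C_def tt_def[symmetric])
  ultimately show ?thesis
    unfolding conj_iff head res using minimal by blast
qed

end
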